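(* The system $\mathsf{Z}_2^\omega$ does not prove $\mathsf{WHBC}$, where $\mathsf{WHBC}$ is the statement: for every $\varepsilon>0$, every closed set $C\subseteq[0,1]$, and all sequences of reals $(a_n)_{n\in\mathbb{N}},(b_n)_{n\in\mathbb{N}}$ with $C\subseteq\bigcup_{n\in\mathbb{N}}(a_n,b_n)$, there are $n_0\in\mathbb{N}$ and reals $c_0,d_0,\dots,c_{m_0},d_{m_0}$ such that $C\subseteq\bigcup_{n\le n_0}(a_n,b_n)\cup\bigcup_{m\le m_0}(c_m,d_m)$ and $\sum_{m\le m_0}|c_m-d_m|<\varepsilon$.
   Context: Metatheory is ZFC. Framework: Kohlenbach's higher-order arithmetic with base theory $\mathsf{RCA}_0^\omega$ (language with variables of all finite types over $\mathbb{N}$; axioms: basic arithmetic, combinators, primitive recursor $\mathbf{R}_0$, extensionality, quantifier-free induction, $\mathsf{QF\text{-}AC}^{1,0}$). For $k\ge1$, $\mathsf{S}_k^2$ is the type-2 functional with values in $\{0,1\}$ deciding the truth of $\Sigma^1_k$-formulas with function parameters (for $k=0$ it is $\exists^2$); $\Pi^1_k\text{-}\mathsf{CA}_0^\omega$ is $\mathsf{RCA}_0^\omega$ plus existence of $\mathsf{S}_k^2$, and $\mathsf{Z}_2^\omega=\bigcup_k\Pi^1_k\text{-}\mathsf{CA}_0^\omega$. Reals are represented by fast-converging Cauchy sequences of rationals. A set of reals is given by a function $Y:\mathbb{R}\to\mathbb{R}$, where $x\in Y$ means $Y(x)>0$; $Y$ is open if for every $x\in Y$ there is a rational $r>0$ with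 $B(x,r)\subseteq Y$; $Y$ is closed if its complement is open. *)

theory Defs
  imports Main
begin

section \<open>The language of all finite types\<close>

datatype ty = N | Fn ty ty  (infixr "\<rightarrow>" 60)

abbreviation ty1 :: ty where "ty1 \<equiv> N \<rightarrow> N"
abbreviation ty2 :: ty where "ty2 \<equiv> ty1 \<rightarrow> N"

text \<open>Variables carry their type; variables with the same index and different types are
  different variables.\<close>

type_synonym var = "nat \<times> ty"

datatype con = Zero | One | Plus | Times | CombK ty ty | CombS ty ty ty | Rec0

datatype tm = Var var | Con con | App tm tm  (infixl "\<cdot>" 100)

primrec con_type :: "con \<Rightarrow> ty" where
  "con_type Zero = N"
| "con_type One = N"
| "con_type Plus = N \<rightarrow> N \<rightarrow> N"
| "con_type Times = N \<rightarrow> N \<rightarrow> N"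
| "con_type (CombK \<sigma> \<tau>) = \<sigma> \<rightarrow> \<tau> \<rightarrow> \<sigma>"
| "con_type (CombS \<rho> \<sigma> \<tau>) = (\<rho> \<rightarrow> \<sigma> \<rightarrow> \<tau>) \<rightarrow> (\<rho> \<rightarrow> \<sigma>) \<rightarrow> \<rho> \<rightarrow> \<tau>"
| "con_type Rec0 = (N \<rightarrow> N \<rightarrow> N) \<rightarrow> N \<rightarrow> N \<rightarrow> N"

primrec type_of :: "tm \<Rightarrow> ty option" where
  "type_of (Var x) = Some (snd x)"
| "type_of (Con c) = Some (con_type c)"
| "type_of (s \<cdot> t) =
     (case type_of s of
        Some (\<sigma> \<rightarrow> \<tau>) \<Rightarrow> if type_of t = Some \<sigma> then Some \<tau> else None
      | _ \<Rightarrow> None)"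

text \<open>The prime formulas are equations and inequalities of type \<open>N\<close> only; equality at higher types
  is defined (\<open>eq_at\<close> below).\<close>

datatype fm = Eq tm tm | Less tm tm | Falsum | Imp fm fm | All var fm

abbreviation Neg :: "fm \<Rightarrow> fm" where "Neg A \<equiv> Imp A Falsum"
abbreviation Conj :: "fm \<Rightarrow> fm \<Rightarrow> fm" where "Conj A B \<equiv> Neg (Imp A (Neg B))"
abbreviation Disj :: "fm \<Rightarrow> fm \<Rightarrow> fm" where "Disj A B \<equiv> Imp (Neg A) B"
abbreviation Ex :: "var \<Rightarrow> fm \<Rightarrow> fm" where "Ex x A \<equiv> Neg (All x (Neg A))"

primrec wff :: "fm \<Rightarrow> bool" where
  "wff (Eq s t) \<longleftrightarrow> type_of s = Some N \<and> type_of t = Some N"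
| "wff (Less s t) \<longleftrightarrow> type_of s = Some N \<and> type_of t = Some N"
| "wff Falsum \<longleftrightarrow> True"
| "wff (Imp A B) \<longleftrightarrow> wff A \<and> wff B"
| "wff (All x A) \<longleftrightarrow> wff A"

primrec quantifier_free :: "fm \<Rightarrow> bool" where
  "quantifier_free (Eq s t) \<longleftrightarrow> True"
| "quantifier_free (Less s t) \<longleftrightarrow> True"
| "quantifier_free Falsum \<longleftrightarrow> True"
| "quantifier_free (Imp A B) \<longleftrightarrow> quantifier_free A \<and> quantifier_free B"
| "quantifier_free (All x A) \<longleftrightarrow> False"

primrec vars_tm :: "tm \<Rightarrow> var set" where
  "vars_tm (Var x) = {x}"
| "vars_tm (Con c) = {}"
| "vars_tm (s \<cdot> t) = vars_tm s \<union> vars_tm t"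

primrec free_vars :: "fm \<Rightarrow> var set" where
  "free_vars (Eq s t) = vars_tm s \<union> vars_tm t"
| "free_vars (Less s t) = vars_tm s \<union> vars_tm t"
| "free_vars Falsum = {}"
| "free_vars (Imp A B) = free_vars A \<union> free_vars B"
| "free_vars (All x A) = free_vars A - {x}"

primrec subst_tm :: "var \<Rightarrow> tm \<Rightarrow> tm \<Rightarrow> tm" where
  "subst_tm x u (Var y) = (if y = x then u else Var y)"
| "subst_tm x u (Con c) = Con c"
| "subst_tm x u (s \<cdot> t) = subst_tm x u s \<cdot> subst_tm x u t"

text \<open>\<open>subst x u A\<close> replaces the free occurrences of \<open>x\<close> without renaming bound variables, so it is
  only used when \<open>u\<close> is free for \<open>x\<close> in \<open>A\<close>.\<close>

primrec subst :: "var \<Rightarrow> tm \<Rightarrow> fm \<Rightarrow> fm" where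
  "subst x u (Eq s t) = Eq (subst_tm x u s) (subst_tm x u t)"
| "subst x u (Less s t) = Less (subst_tm x u s) (subst_tm x u t)"
| "subst x u Falsum = Falsum"
| "subst x u (Imp A B) = Imp (subst x u A) (subst x u B)"
| "subst x u (All y A) = (if y = x then All y A else All y (subst x u A))"

primrec free_for :: "tm \<Rightarrow> var \<Rightarrow> fm \<Rightarrow> bool" where
  "free_for u x (Eq s t) \<longleftrightarrow> True"
| "free_for u x (Less s t) \<longleftrightarrow> True"
| "free_for u x Falsum \<longleftrightarrow> True"
| "free_for u x (Imp A B) \<longleftrightarrow> free_for u x A \<and> free_for u x B"
| "free_for u x (All y A) \<longleftrightarrow> x \<notin> free_vars (All y A) \<or> (y \<notin> vars_tm u \<and> free_for u x A)"


section \<open>Classical many-sorted provability\<close>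

text \<open>A Hilbert calculus. Generalisation is unrestricted, so a non-logical axiom with free variables
  has the strength of its universal closure.\<close>

inductive provable :: "fm set \<Rightarrow> fm \<Rightarrow> bool"  (infix "\<turnstile>" 50) for T :: "fm set" where
  axiom: "A \<in> T \<Longrightarrow> T \<turnstile> A"
| prop_K: "wff A \<Longrightarrow> wff B \<Longrightarrow> T \<turnstile> Imp A (Imp B A)"
| prop_S: "wff A \<Longrightarrow> wff B \<Longrightarrow> wff C \<Longrightarrow>
    T \<turnstile> Imp (Imp A (Imp B C)) (Imp (Imp A B) (Imp A C))"
| double_neg: "wff A \<Longrightarrow> T \<turnstile> Imp (Neg (Neg A)) A"
| all_inst: "wff A \<Longrightarrow> type_of t = Some (snd x) \<Longrightarrow> free_for t x A \<Longrightarrow>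
    T \<turnstile> Imp (All x A) (subst x t A)"
| all_imp: "wff A \<Longrightarrow> wff B \<Longrightarrow> x \<notin> free_vars A \<Longrightarrow>
    T \<turnstile> Imp (All x (Imp A B)) (Imp A (All x B))"
| mp: "T \<turnstile> Imp A B \<Longrightarrow> T \<turnstile> A \<Longrightarrow> T \<turnstile> B"
| gen: "T \<turnstile> A \<Longrightarrow> T \<turnstile> All x A"


section \<open>Writing formulas\<close>

text \<open>
  Concrete formulas are written as functions from a nesting depth to formulas: the quantifier
  \<open>all \<tau> F\<close> used at depth \<open>n\<close> binds the variable of index \<open>n\<close>, passes that variable to \<open>F\<close>, and
  continues at depth \<open>n + 1\<close>. A bound variable is therefore never captured by a quantifier further
  inside, and \<open>sentence F\<close> is the resulting formula of the object language.
\<close>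

type_synonym form = "nat \<Rightarrow> fm"

definition sentence :: "form \<Rightarrow> fm" where "sentence F = F 0"

definition eq :: "tm \<Rightarrow> tm \<Rightarrow> form"  (infix "\<doteq>" 55) where "(s \<doteq> t) = (\<lambda>n. Eq s t)"
definition less :: "tm \<Rightarrow> tm \<Rightarrow> form"  (infix "\<prec>" 55) where "(s \<prec> t) = (\<lambda>n. Less s t)"
definition neg :: "form \<Rightarrow> form"  ("\<^bold>\<not> _" [53] 53) where "(\<^bold>\<not> F) = (\<lambda>n. Neg (F n))"
definition conj :: "form \<Rightarrow> form \<Rightarrow> form"  (infixr "\<^bold>\<and>" 51) where
  "(F \<^bold>\<and> G) = (\<lambda>n. Conj (F n) (G n))"
definition disj :: "form \<Rightarrow> form \<Rightarrow> form"  (infixr "\<^bold>\<or>" 50) where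
  "(F \<^bold>\<or> G) = (\<lambda>n. Disj (F n) (G n))"
definition imp :: "form \<Rightarrow> form \<Rightarrow> form"  (infixr "\<^bold>\<longrightarrow>" 49) where
  "(F \<^bold>\<longrightarrow> G) = (\<lambda>n. Imp (F n) (G n))"
definition iff :: "form \<Rightarrow> form \<Rightarrow> form"  (infixr "\<^bold>\<longleftrightarrow>" 49) where
  "(F \<^bold>\<longleftrightarrow> G) = ((F \<^bold>\<longrightarrow> G) \<^bold>\<and> (G \<^bold>\<longrightarrow> F))"
definition all :: "ty \<Rightarrow> (tm \<Rightarrow> form) \<Rightarrow> form" where
  "all \<tau> F = (\<lambda>n. All (n, \<tau>) (F (Var (n, \<tau>)) (Suc n)))"
definition ex :: "ty \<Rightarrow> (tm \<Rightarrow> form) \<Rightarrow> form" where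
  "ex \<tau> F = (\<lambda>n. Ex (n, \<tau>) (F (Var (n, \<tau>)) (Suc n)))"

definition leq :: "tm \<Rightarrow> tm \<Rightarrow> form"  (infix "\<preceq>" 55) where "(s \<preceq> t) = (\<^bold>\<not> (t \<prec> s))"

abbreviation zero :: tm  ("\<zero>") where "\<zero> \<equiv> Con Zero"
abbreviation one :: tm  ("\<one>") where "\<one> \<equiv> Con One"
abbreviation add :: "tm \<Rightarrow> tm \<Rightarrow> tm"  (infixl "\<oplus>" 65) where "s \<oplus> t \<equiv> Con Plus \<cdot> s \<cdot> t"
abbreviation mul :: "tm \<Rightarrow> tm \<Rightarrow> tm"  (infixl "\<otimes>" 70) where "s \<otimes> t \<equiv> Con Times \<cdot> s \<cdot> t"

primrec eq_at :: "ty \<Rightarrow> tm \<Rightarrow> tm \<Rightarrow> form" where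
  "eq_at N s t = (s \<doteq> t)"
| "eq_at (\<sigma> \<rightarrow> \<tau>) s t = all \<sigma> (\<lambda>z. eq_at \<tau> (s \<cdot> z) (t \<cdot> z))"


section \<open>The base theory\<close>

definition basic_axioms :: "form set" where
  "basic_axioms = {
     all N (\<lambda>m. m \<doteq> m),
     all N (\<lambda>m. all N (\<lambda>n. m \<doteq> n \<^bold>\<longrightarrow> n \<doteq> m)),
     all N (\<lambda>m. all N (\<lambda>n. all N (\<lambda>k. m \<doteq> n \<^bold>\<longrightarrow> n \<doteq> k \<^bold>\<longrightarrow> m \<doteq> k))),
     all N (\<lambda>m. all N (\<lambda>n. all N (\<lambda>k. all N (\<lambda>l.
       m \<doteq> n \<^bold>\<longrightarrow> k \<doteq> l \<^bold>\<longrightarrow> m \<prec> k \<^bold>\<longrightarrow> n \<prec> l)))),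
     all N (\<lambda>m. \<^bold>\<not> (m \<oplus> \<one> \<doteq> \<zero>)),
     all N (\<lambda>m. all N (\<lambda>n. m \<oplus> \<one> \<doteq> n \<oplus> \<one> \<^bold>\<longrightarrow> m \<doteq> n)),
     all N (\<lambda>m. m \<oplus> \<zero> \<doteq> m),
     all N (\<lambda>m. all N (\<lambda>n. m \<oplus> (n \<oplus> \<one>) \<doteq> (m \<oplus> n) \<oplus> \<one>)),
     all N (\<lambda>m. m \<otimes> \<zero> \<doteq> \<zero>),
     all N (\<lambda>m. all N (\<lambda>n. m \<otimes> (n \<oplus> \<one>) \<doteq> (m \<otimes> n) \<oplus> m)),
     all N (\<lambda>m. \<^bold>\<not> (m \<prec> \<zero>)),
     all N (\<lambda>m. all N (\<lambda>n. m \<prec> n \<oplus> \<one> \<^bold>\<longleftrightarrow> (m \<prec> n \<^bold>\<or> m \<doteq> n)))}"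

inductive_set RCA0\<omega> :: "fm set" where
  basic: "F \<in> basic_axioms \<Longrightarrow> sentence F \<in> RCA0\<omega>"
| comb_K: "sentence (all \<sigma> (\<lambda>x. all \<tau> (\<lambda>y. eq_at \<sigma> (Con (CombK \<sigma> \<tau>) \<cdot> x \<cdot> y) x))) \<in> RCA0\<omega>"
| comb_S: "sentence (all (\<rho> \<rightarrow> \<sigma> \<rightarrow> \<tau>) (\<lambda>x. all (\<rho> \<rightarrow> \<sigma>) (\<lambda>y. all \<rho> (\<lambda>z.
    eq_at \<tau> (Con (CombS \<rho> \<sigma> \<tau>) \<cdot> x \<cdot> y \<cdot> z) (x \<cdot> z \<cdot> (y \<cdot> z)))))) \<in> RCA0\<omega>"
| rec_zero: "sentence (all (N \<rightarrow> N \<rightarrow> N) (\<lambda>f. all N (\<lambda>m.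
    Con Rec0 \<cdot> f \<cdot> m \<cdot> \<zero> \<doteq> m))) \<in> RCA0\<omega>"
| rec_succ: "sentence (all (N \<rightarrow> N \<rightarrow> N) (\<lambda>f. all N (\<lambda>m. all N (\<lambda>n.
    Con Rec0 \<cdot> f \<cdot> m \<cdot> (n \<oplus> \<one>) \<doteq> f \<cdot> n \<cdot> (Con Rec0 \<cdot> f \<cdot> m \<cdot> n))))) \<in> RCA0\<omega>"
| extensionality: "sentence (all \<rho> (\<lambda>x. all \<rho> (\<lambda>y. all (\<rho> \<rightarrow> \<tau>) (\<lambda>f.
    eq_at \<rho> x y \<^bold>\<longrightarrow> eq_at \<tau> (f \<cdot> x) (f \<cdot> y))))) \<in> RCA0\<omega>"
| qf_induction: "quantifier_free A \<Longrightarrow> wff A \<Longrightarrow> n = (i, N) \<Longrightarrow>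
    Imp (Conj (subst n \<zero> A) (All n (Imp A (subst n (Var n \<oplus> \<one>) A)))) (All n A) \<in> RCA0\<omega>"
| qf_ac_10: "quantifier_free A \<Longrightarrow> wff A \<Longrightarrow> f = (i, ty1) \<Longrightarrow> n = (j, N) \<Longrightarrow> Y = (l, ty2) \<Longrightarrow>
    Y \<notin> free_vars A \<Longrightarrow>
    Imp (All f (Ex n A)) (Ex Y (All f (subst n (Var Y \<cdot> Var f) A))) \<in> RCA0\<omega>"


section \<open>Some definable terms\<close>

text \<open>\<open>lam x t\<close> is the usual bracket abstraction: a combinator term in which \<open>x\<close> no longer occurs
  and which, applied to \<open>x\<close>, is provably equal to \<open>t\<close>.\<close>

primrec lam :: "var \<Rightarrow> tm \<Rightarrow> tm" where
  "lam x (Var y) =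
     (if y = x
      then let \<rho> = snd x in Con (CombS \<rho> (\<rho> \<rightarrow> \<rho>) \<rho>) \<cdot> Con (CombK \<rho> (\<rho> \<rightarrow> \<rho>)) \<cdot> Con (CombK \<rho> \<rho>)
      else Con (CombK (snd y) (snd x)) \<cdot> Var y)"
| "lam x (Con c) = Con (CombK (con_type c) (snd x)) \<cdot> Con c"
| "lam x (s \<cdot> t) =
     Con (CombS (snd x) (the (type_of t)) (the (type_of (s \<cdot> t)))) \<cdot> lam x s \<cdot> lam x t"

text \<open>The function \<open>n \<mapsto> 2\<^sup>n\<close>, as a closed term.\<close>

definition pow2_fun :: tm where
  "pow2_fun =
     Con Rec0 \<cdot> lam (0, N) (lam (1, N) (Var (1, N) \<oplus> Var (1, N))) \<cdot> \<one>"

abbreviation pow2 :: "tm \<Rightarrow> tm" where "pow2 t \<equiv> pow2_fun \<cdot> t"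

text \<open>The injective pairing \<open>(a + b)\<^sup>2 + a\<close>.\<close>

definition pair :: "tm \<Rightarrow> tm \<Rightarrow> tm" where
  "pair s t = (s \<oplus> t) \<otimes> (s \<oplus> t) \<oplus> s"

text \<open>\<open>initial g n\<close> codes the finite sequence \<open>g 0, \<dots>, g (n - 1)\<close>: the empty sequence has code
  \<open>0\<close>, and appending \<open>k\<close> to a sequence with code \<open>v\<close> gives the code \<open>pair v k + 1\<close>.\<close>

definition initial_fun :: tm where
  "initial_fun =
     (let g = (0, ty1); m = (1, N); v = (2, N) in
      lam g (Con Rec0 \<cdot> lam m (lam v (pair (Var v) (Var g \<cdot> Var m) \<oplus> \<one>)) \<cdot> \<zero>))"

abbreviation initial :: "tm \<Rightarrow> tm \<Rightarrow> tm" where "initial g n \<equiv> initial_fun \<cdot> g \<cdot> n"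


section \<open>The functionals deciding \<open>\<Sigma>\<^sup>1\<^sub>k\<close> and full second-order arithmetic\<close>

fun initials :: "tm list \<Rightarrow> tm \<Rightarrow> tm" where
  "initials [] n = n"
| "initials [g] n = initial g n"
| "initials (g # gs) n = pair (initial g n) (initials gs n)"

text \<open>
  \<open>sigma k f\<close> is the \<open>\<Sigma>\<^sup>1\<^sub>k\<close>-formula in Kleene normal form with function parameter \<open>f\<close>:
  \<open>\<exists>g\<^sub>1 \<forall>g\<^sub>2 \<dots> Q g\<^sub>k Q' n. f \<langle>g\<^sub>1 n, \<dots>, g\<^sub>k n\<rangle> = 0\<close>, where \<open>g\<^sub>i n\<close> stands for the code of the
  initial segment of \<open>g\<^sub>i\<close> of length \<open>n\<close> and where \<open>Q'\<close> is the quantifier dual to \<open>Q\<close>; every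
  \<open>\<Sigma>\<^sup>1\<^sub>k\<close>-formula with function parameters is equivalent to \<open>sigma k f\<close> for a suitable \<open>f\<close>
  computed from its parameters. For \<open>k = 0\<close> it is \<open>\<exists>n. f n = 0\<close>, the formula decided by \<open>\<exists>\<^sup>2\<close>, and
  for \<open>k = 1\<close> it is \<open>\<exists>g \<forall>n. f (g n) = 0\<close>, the formula decided by the Suslin functional.
  The Boolean argument of \<open>alternate\<close> tells whether the next quantifier is existential.
\<close>

primrec alternate :: "nat \<Rightarrow> bool \<Rightarrow> tm \<Rightarrow> tm list \<Rightarrow> form" where
  "alternate 0 e f gs = (if e then ex else all) N (\<lambda>n. f \<cdot> initials gs n \<doteq> \<zero>)"
| "alternate (Suc k) e f gs = (if e then ex else all) ty1 (\<lambda>g. alternate k (\<not> e) f (gs @ [g]))"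

definition sigma :: "nat \<Rightarrow> tm \<Rightarrow> form" where
  "sigma k f = alternate k True f []"

text \<open>Existence of the functional \<open>S\<^sub>k\<^sup>2\<close>; the value \<open>0\<close> means that the formula is true.\<close>

definition S_exists :: "nat \<Rightarrow> fm" where
  "S_exists k = sentence (ex ty2 (\<lambda>S. all ty1 (\<lambda>f.
     (S \<cdot> f \<doteq> \<zero> \<^bold>\<or> S \<cdot> f \<doteq> \<one>) \<^bold>\<and> (S \<cdot> f \<doteq> \<zero> \<^bold>\<longleftrightarrow> sigma k f))))"

definition Pi11_CA0\<omega> :: "nat \<Rightarrow> fm set" where
  "Pi11_CA0\<omega> k = insert (S_exists k) RCA0\<omega>"

definition Z2\<omega> :: "fm set" where
  "Z2\<omega> = (\<Union>k. Pi11_CA0\<omega> k)"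


section \<open>Rational and real numbers in the object language\<close>

text \<open>\<open>(a, b, d)\<close> stands for the rational number \<open>(a - b) / d\<close>, where \<open>d\<close> denotes a positive number.\<close>

type_synonym rat_tm = "tm \<times> tm \<times> tm"

fun rat_add :: "rat_tm \<Rightarrow> rat_tm \<Rightarrow> rat_tm" where
  "rat_add (a, b, d) (a', b', d') = (a \<otimes> d' \<oplus> a' \<otimes> d, b \<otimes> d' \<oplus> b' \<otimes> d, d \<otimes> d')"
fun rat_neg :: "rat_tm \<Rightarrow> rat_tm" where
  "rat_neg (a, b, d) = (b, a, d)"
fun rat_less :: "rat_tm \<Rightarrow> rat_tm \<Rightarrow> form" where
  "rat_less (a, b, d) (a', b', d') = (a \<otimes> d' \<oplus> b' \<otimes> d \<prec> a' \<otimes> d \<oplus> b \<otimes> d')"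
definition rat_leq :: "rat_tm \<Rightarrow> rat_tm \<Rightarrow> form" where
  "rat_leq q r = (\<^bold>\<not> rat_less r q)"
definition rat_zero :: rat_tm where "rat_zero = (\<zero>, \<zero>, \<one>)"
definition rat_one :: rat_tm where "rat_one = (\<one>, \<zero>, \<one>)"

text \<open>\<open>2\<^sup>-\<^sup>n\<close> and \<open>2\<^sup>-\<^sup>n\<^sup>+\<^sup>1\<close>.\<close>

definition rat_eps :: "tm \<Rightarrow> rat_tm" where "rat_eps n = (\<one>, \<zero>, pow2 n)"
definition rat_2eps :: "tm \<Rightarrow> rat_tm" where "rat_2eps n = (\<one> \<oplus> \<one>, \<zero>, pow2 n)"

text \<open>\<open>q\<close> codes \<open>r\<close>: every rational is \<open>(a - b) / (c + 1)\<close> and is coded by a nested pair.\<close>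

definition decode_rat :: "tm \<Rightarrow> (rat_tm \<Rightarrow> form) \<Rightarrow> form" where
  "decode_rat q K =
     ex N (\<lambda>a. ex N (\<lambda>b. ex N (\<lambda>c. q \<doteq> pair (pair a b) c \<^bold>\<and> K (a, b, c \<oplus> \<one>))))"

definition ex_rat :: "(rat_tm \<Rightarrow> form) \<Rightarrow> form" where
  "ex_rat K = ex N (\<lambda>a. ex N (\<lambda>b. ex N (\<lambda>c. K (a, b, c \<oplus> \<one>))))"

text \<open>
  A real expression is given by its rational approximations: \<open>x n K\<close> says that the \<open>n\<close>-th
  approximation of \<open>x\<close> is a rational with property \<open>K\<close>. The operations are the usual ones on
  fast converging sequences, e.g. \<open>(x + y)\<^sub>n = x\<^sub>n\<^sub>+\<^sub>1 + y\<^sub>n\<^sub>+\<^sub>1\<close>.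
\<close>

type_synonym real_ex = "tm \<Rightarrow> (rat_tm \<Rightarrow> form) \<Rightarrow> form"

definition R :: "tm \<Rightarrow> real_ex" where
  "R x = (\<lambda>n K. decode_rat (x \<cdot> n) K)"
definition real_const :: "rat_tm \<Rightarrow> real_ex" where
  "real_const q = (\<lambda>n K. K q)"
definition real_add :: "real_ex \<Rightarrow> real_ex \<Rightarrow> real_ex" where
  "real_add x y = (\<lambda>n K. x (n \<oplus> \<one>) (\<lambda>q. y (n \<oplus> \<one>) (\<lambda>r. K (rat_add q r))))"
definition real_neg :: "real_ex \<Rightarrow> real_ex" where
  "real_neg x = (\<lambda>n K. x n (\<lambda>q. K (rat_neg q)))"
definition real_abs :: "real_ex \<Rightarrow> real_ex" where
  "real_abs x = (\<lambda>n K. x n (\<lambda>q.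
     (rat_leq rat_zero q \<^bold>\<and> K q) \<^bold>\<or> (rat_less q rat_zero \<^bold>\<and> K (rat_neg q))))"
definition real_dist :: "real_ex \<Rightarrow> real_ex \<Rightarrow> real_ex" where
  "real_dist x y = real_abs (real_add x (real_neg y))"

definition real_less :: "real_ex \<Rightarrow> real_ex \<Rightarrow> form" where
  "real_less x y = ex N (\<lambda>n. x n (\<lambda>q. y n (\<lambda>r. rat_less (rat_add q (rat_2eps n)) r)))"
definition real_leq :: "real_ex \<Rightarrow> real_ex \<Rightarrow> form" where
  "real_leq x y = (\<^bold>\<not> real_less y x)"
definition real_eq :: "real_ex \<Rightarrow> real_ex \<Rightarrow> form" where
  "real_eq x y = all N (\<lambda>n. x n (\<lambda>q. y n (\<lambda>r.
     rat_leq q (rat_add r (rat_2eps n)) \<^bold>\<and> rat_leq r (rat_add q (rat_2eps n)))))"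

text \<open>Reals are the \<open>x\<close> of type \<open>1\<close> coding rationals with \<open>\<bar>x\<^sub>n - x\<^sub>n\<^sub>+\<^sub>i\<bar> < 2\<^sup>-\<^sup>n\<close> for all \<open>n\<close>, \<open>i\<close>.\<close>

definition is_real :: "tm \<Rightarrow> form" where
  "is_real x = all N (\<lambda>n. all N (\<lambda>i. R x n (\<lambda>q. R x (n \<oplus> i) (\<lambda>r.
     rat_less q (rat_add r (rat_eps n)) \<^bold>\<and> rat_less r (rat_add q (rat_eps n))))))"

definition all_real :: "(tm \<Rightarrow> form) \<Rightarrow> form" where
  "all_real F = all ty1 (\<lambda>x. is_real x \<^bold>\<longrightarrow> F x)"

definition is_real_fun :: "tm \<Rightarrow> form" where
  "is_real_fun Y =
     (all_real (\<lambda>x. is_real (Y \<cdot> x)) \<^bold>\<and>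
      all_real (\<lambda>x. all_real (\<lambda>y. real_eq (R x) (R y) \<^bold>\<longrightarrow> real_eq (R (Y \<cdot> x)) (R (Y \<cdot> y)))))"

definition is_real_seq :: "tm \<Rightarrow> form" where
  "is_real_seq a = all N (\<lambda>n. is_real (a \<cdot> n))"


section \<open>Closed sets and the covering principle\<close>

definition mem :: "tm \<Rightarrow> tm \<Rightarrow> form" where
  "mem x Y = real_less (real_const rat_zero) (R (Y \<cdot> x))"

definition is_open :: "(tm \<Rightarrow> form) \<Rightarrow> form" where
  "is_open P = all_real (\<lambda>x. P x \<^bold>\<longrightarrow>
     ex_rat (\<lambda>r. rat_less rat_zero r \<^bold>\<and>
       all_real (\<lambda>y. real_less (real_dist (R x) (R y)) (real_const r) \<^bold>\<longrightarrow> P y)))"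

definition is_closed :: "tm \<Rightarrow> form" where
  "is_closed Y = is_open (\<lambda>x. \<^bold>\<not> mem x Y)"

definition in_interval :: "tm \<Rightarrow> tm \<Rightarrow> tm \<Rightarrow> form" where
  "in_interval x a b = (real_less (R a) (R x) \<^bold>\<and> real_less (R x) (R b))"

text \<open>\<open>\<Sum>\<^sub>i\<^sub>\<le>\<^sub>m \<bar>c\<^sub>i - d\<^sub>i\<bar> < \<epsilon>\<close>, expressed through the sequence \<open>s\<close> of partial sums.\<close>

definition total_length_less :: "tm \<Rightarrow> tm \<Rightarrow> tm \<Rightarrow> tm \<Rightarrow> form" where
  "total_length_less c d m \<epsilon> = ex (N \<rightarrow> ty1) (\<lambda>s.
     is_real_seq s \<^bold>\<and>
     real_eq (R (s \<cdot> \<zero>)) (real_dist (R (c \<cdot> \<zero>)) (R (d \<cdot> \<zero>))) \<^bold>\<and>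
     all N (\<lambda>i. i \<prec> m \<^bold>\<longrightarrow>
       real_eq (R (s \<cdot> (i \<oplus> \<one>)))
               (real_add (R (s \<cdot> i)) (real_dist (R (c \<cdot> (i \<oplus> \<one>))) (R (d \<cdot> (i \<oplus> \<one>)))))) \<^bold>\<and>
     real_less (R (s \<cdot> m)) (R \<epsilon>))"

text \<open>The finite lists \<open>c\<^sub>0, \<dots>, c\<^sub>m\<close> and \<open>d\<^sub>0, \<dots>, d\<^sub>m\<close> are given by sequences of reals of which only
  the entries up to \<open>m\<close> are used.\<close>

definition WHBC :: fm where
  "WHBC = sentence (
     all_real (\<lambda>\<epsilon>. all (ty1 \<rightarrow> ty1) (\<lambda>C. all (N \<rightarrow> ty1) (\<lambda>a. all (N \<rightarrow> ty1) (\<lambda>b.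
       real_less (real_const rat_zero) (R \<epsilon>) \<^bold>\<longrightarrow>
       is_real_fun C \<^bold>\<longrightarrow>
       is_closed C \<^bold>\<longrightarrow>
       all_real (\<lambda>x. mem x C \<^bold>\<longrightarrow>
         real_leq (real_const rat_zero) (R x) \<^bold>\<and> real_leq (R x) (real_const rat_one)) \<^bold>\<longrightarrow>
       is_real_seq a \<^bold>\<longrightarrow>
       is_real_seq b \<^bold>\<longrightarrow>
       all_real (\<lambda>x. mem x C \<^bold>\<longrightarrow> ex N (\<lambda>n. in_interval x (a \<cdot> n) (b \<cdot> n))) \<^bold>\<longrightarrow>
       ex N (\<lambda>n\<^sub>0. ex N (\<lambda>m\<^sub>0. ex (N \<rightarrow> ty1) (\<lambda>c. ex (N \<rightarrow> ty1) (\<lambda>d.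
         is_real_seq c \<^bold>\<and>
         is_real_seq d \<^bold>\<and>
         all_real (\<lambda>x. mem x C \<^bold>\<longrightarrow>
           ex N (\<lambda>n. n \<preceq> n\<^sub>0 \<^bold>\<and> in_interval x (a \<cdot> n) (b \<cdot> n)) \<^bold>\<or>
           ex N (\<lambda>m. m \<preceq> m\<^sub>0 \<^bold>\<and> in_interval x (c \<cdot> m) (d \<cdot> m))) \<^bold>\<and>
         total_length_less c d m\<^sub>0 \<epsilon>)))))))))"


section \<open>Well-formedness\<close>

text \<open>\<open>WHBC\<close> is a well-typed sentence and all axioms are well-typed, so the calculus does not leave
  the well-typed formulas and unprovability of \<open>WHBC\<close> is not a matter of typing.\<close>

lemma type_of_lam: "type_of t = Some \<tau> \<Longrightarrow> type_of (lam x t) = Some (snd x \<rightarrow> \<tau>)"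
  by (induction t arbitrary: \<tau>) (auto simp: Let_def split: option.splits ty.splits if_splits)

lemma vars_tm_lam: "vars_tm (lam x t) = vars_tm t - {x}"
  by (induction t) (auto simp: Let_def)

lemma type_of_app:
  "type_of (s \<cdot> t) = Some \<tau> \<longleftrightarrow> (\<exists>\<sigma>. type_of s = Some (\<sigma> \<rightarrow> \<tau>) \<and> type_of t = Some \<sigma>)"
  by (auto split: option.splits ty.splits)

lemma type_of_pow2_fun: "type_of pow2_fun = Some (N \<rightarrow> N)"
  by (simp add: pow2_fun_def)

lemma type_of_initial_fun: "type_of initial_fun = Some (ty1 \<rightarrow> N \<rightarrow> N)"
  by (simp add: initial_fun_def pair_def Let_def)

lemma type_of_pair: "type_of (pair s t) = Some N \<longleftrightarrow> type_of s = Some N \<and> type_of t = Some N"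
  by (auto simp: pair_def type_of_app simp del: type_of.simps(3))

lemma vars_tm_pow2_fun: "vars_tm pow2_fun = {}"
  by (simp add: pow2_fun_def vars_tm_lam del: lam.simps)

lemma vars_tm_initial_fun: "vars_tm initial_fun = {}"
  by (auto simp: initial_fun_def pair_def Let_def vars_tm_lam simp del: lam.simps)

lemmas form_defs = sentence_def eq_def less_def neg_def conj_def disj_def imp_def iff_def all_def
  ex_def leq_def

lemmas real_defs = rat_leq_def rat_zero_def rat_one_def rat_eps_def rat_2eps_def decode_rat_def
  ex_rat_def R_def real_const_def real_add_def real_neg_def real_abs_def real_dist_def real_less_def
  real_leq_def real_eq_def is_real_def all_real_def is_real_fun_def is_real_seq_def mem_def
  is_open_def is_closed_def in_interval_def total_length_less_def

lemma wff_WHBC: "wff WHBC"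
  unfolding WHBC_def
  by (simp add: form_defs real_defs type_of_pair type_of_app type_of_pow2_fun del: type_of.simps(3))

lemma free_vars_WHBC: "free_vars WHBC = {}"
  by code_simp

lemma wff_eq_at: "type_of s = Some \<tau> \<Longrightarrow> type_of t = Some \<tau> \<Longrightarrow> wff (eq_at \<tau> s t n)"
  by (induction \<tau> arbitrary: s t n) (auto simp: form_defs)

lemma type_of_initials:
  "\<forall>g\<in>set gs. type_of g = Some ty1 \<Longrightarrow> type_of n = Some N \<Longrightarrow> type_of (initials gs n) = Some N"
  by (induction gs n rule: initials.induct) (auto simp: type_of_initial_fun pair_def)

lemma wff_alternate:
  "type_of f = Some ty1 \<Longrightarrow> \<forall>g\<in>set gs. type_of g = Some ty1 \<Longrightarrow> wff (alternate k e f gs n)"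
  by (induction k arbitrary: e gs n) (auto simp: form_defs type_of_initials)

lemma type_of_subst_tm: "type_of u = Some (snd x) \<Longrightarrow> type_of (subst_tm x u t) = type_of t"
  by (induction t) (auto split: option.splits ty.splits)

lemma wff_subst: "type_of u = Some (snd x) \<Longrightarrow> wff A \<Longrightarrow> wff (subst x u A)"
  by (induction A) (auto simp: type_of_subst_tm)

lemma wff_RCA0\<omega>: "A \<in> RCA0\<omega> \<Longrightarrow> wff A"
  by (erule RCA0\<omega>.cases) (auto simp: basic_axioms_def form_defs wff_eq_at wff_subst)

lemma wff_S_exists: "wff (S_exists k)"
  by (simp add: S_exists_def sigma_def form_defs wff_alternate)

lemma wff_Z2\<omega>: "A \<in> Z2\<omega> \<Longrightarrow> wff A"
  unfolding Z2\<omega>_def Pi11_CA0\<omega>_def using wff_S_exists wff_RCA0\<omega> by blast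

lemma wff_provable: "Z2\<omega> \<turnstile> A \<Longrightarrow> wff A"
  by (induction rule: provable.induct) (simp_all add: wff_Z2\<omega> wff_subst)

end

theory Submission
  imports "HOL-Analysis.Analysis" Defs
begin

text \<open>
  The proof builds a model of \<open>Z2\<omega>\<close> in which \<open>WHBC\<close> fails. Its functions of type 1 are the union \<open>M\<close> of
  an increasing sequence of countable sets \<open>M\<^sub>m\<close>, each closed under countably many operations among
  which there are Skolem functions for the formulas \<open>sigma k\<close>. The higher types consist of terms which
  map sequences coded in \<open>M\<close> to sequences coded in \<open>M\<close>; every such sequence stays within some \<open>M\<^sub>m\<close>.
  Therefore a set of reals with only finitely many elements in each \<open>M\<^sub>m\<close> has its characteristic function
  in the model. The reals \<open>x\<^sub>0, x\<^sub>1, \<dots>\<close> of \<open>M\<close> being enumerated, one adds at stage \<open>m\<close> a new real in the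
  \<open>m\<close>-th rational interval, inside a fixed dense union of intervals of small total length and
  away from the small balls about \<open>x\<^sub>k\<close>, \<open>k \<le> m\<close>. The set of the new reals is closed in the model because
  almost all of its elements avoid the ball about \<open>x\<^sub>k\<close>. It is not covered by finitely many of the given
  intervals and further intervals of small total length: a real outside all of these
  and outside all the balls is a limit of new reals, and it exists since the total length is below 1.
\<close>

text \<open>The functionals must therefore be cut down to ones that keep \<open>M\<close> closed,
  while one of them still has to recognize the new reals. Asking for preservation of sequences, not
  just of single functions, does both: the condition passes to all finite types, and a sequence
  coded by one \<open>f\<close> is given by one expression, which mentions only finitely many
  generators. Truth of \<open>sigma k\<close> in \<open>M\<close> seems to depend on generators
  still to be chosen. Skolem functions remove this circularity: truth in \<open>M\<close> agrees
  with truth over all functions, so deciding it is an ordinary operation, fixed in advance. The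
  covering principle is refuted for \<epsilon> = 1/4. The cover, the balls and the additional
  intervals each have total length at most 1/4, which leaves room in the unit interval. A real
  outside all balls is coded by no element of \<open>M\<close>; so the limit points that keep the
  set from being closed in the real line are invisible in the model.\<close>

no_notation funcset (infixr "\<rightarrow>" 60)

section \<open>Closed terms and their evaluation\<close>

text \<open>A single HOL type has to carry the objects of all finite types. Untyped combinator terms
  do this, and the types are recovered later as partial equivalence relations on them.
  \<open>COp\<close> makes any set-theoretic operator on functions available as a constant.\<close>

datatype ctm =
    CK | CS | CRec | CNum nat | CBin "nat \<Rightarrow> nat \<Rightarrow> nat" | COp "(nat \<Rightarrow> nat) \<Rightarrow> nat \<Rightarrow> nat"
  | CApp ctm ctm  (infixl "\<star>" 100)

text \<open>Only the head of a term is contracted, never an argument, which makes the reduction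
  deterministic.\<close>

inductive step :: "ctm \<Rightarrow> ctm \<Rightarrow> bool" where
  step_K: "step (CK \<star> x \<star> y) x"
| step_S: "step (CS \<star> x \<star> y \<star> z) (x \<star> z \<star> (y \<star> z))"
| step_app: "step s s' \<Longrightarrow> step (s \<star> t) (s' \<star> t)"

text \<open>The rule \<open>ev_op\<close> is infinitary: an operator fires only when its argument
  has a value at every numeral, and it then receives the whole function.\<close>

inductive ev :: "ctm \<Rightarrow> nat \<Rightarrow> bool" where
  ev_num: "ev (CNum n) n"
| ev_bin: "ev s m \<Longrightarrow> ev t n \<Longrightarrow> ev (CBin h \<star> s \<star> t) (h m n)"
| ev_op: "(\<And>n. ev (t \<star> CNum n) (f n)) \<Longrightarrow> ev u m \<Longrightarrow> ev (COp F \<star> t \<star> u) (F f m)"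
| ev_rec_0: "ev u 0 \<Longrightarrow> ev a v \<Longrightarrow> ev (CRec \<star> f \<star> a \<star> u) v"
| ev_rec_Suc: "ev u (Suc n) \<Longrightarrow> ev (CRec \<star> f \<star> a \<star> CNum n) w \<Longrightarrow> ev (f \<star> CNum n \<star> CNum w) v \<Longrightarrow>
    ev (CRec \<star> f \<star> a \<star> u) v"
| ev_step: "step t t' \<Longrightarrow> ev t' n \<Longrightarrow> ev t n"

inductive_cases step_appE: "step (s \<star> t) u"
inductive_cases step_KE: "step CK u"
inductive_cases step_SE: "step CS u"
inductive_cases step_RecE: "step CRec u"
inductive_cases step_NumE: "step (CNum n) u"
inductive_cases step_BinE: "step (CBin h) u"
inductive_cases step_OpE: "step (COp F) u"

lemmas no_step = step_KE step_SE step_RecE step_NumE step_BinE step_OpE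

section \<open>Determinism of reduction and evaluation\<close>

lemma stuck:
  "\<not> step (CNum n) u" "\<not> step (CBin h \<star> s \<star> t) u" "\<not> step (COp F \<star> s \<star> t) u"
  "\<not> step (CRec \<star> f \<star> s \<star> t) u"
  by (auto elim!: step_appE no_step)

lemma step_det: "step t u \<Longrightarrow> step t u' \<Longrightarrow> u = u'"
proof (induction arbitrary: u' rule: step.induct)
  case (step_K x y)
  then show ?case by (auto elim!: step_appE no_step)
next
  case (step_S x y z)
  then show ?case by (auto elim!: step_appE no_step)
next
  case (step_app s s' t)
  have s: "s \<noteq> CK \<star> x" "s \<noteq> CS \<star> x \<star> y" for x y
    using step_app.hyps by (auto elim!: step_appE no_step)
  from step_app.prems show ?case
    by (rule step_appE) (use s step_app.IH in blast)+
qed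

inductive_cases ev_NumE: "ev (CNum n) m"

lemma ev_op_inv:
  "ev (COp F \<star> t \<star> u) n \<Longrightarrow> \<exists>g k. n = F g k \<and> (\<forall>i. ev (t \<star> CNum i) (g i)) \<and> ev u k"
  by (cases rule: ev.cases) (auto simp: stuck)

lemma ev_bin_inv: "ev (CBin h \<star> s \<star> t) n \<Longrightarrow> \<exists>j k. n = h j k \<and> ev s j \<and> ev t k"
  by (cases rule: ev.cases) (auto simp: stuck)

lemma ev_rec_inv:
  "ev (CRec \<star> f \<star> a \<star> u) v \<Longrightarrow> ev u 0 \<and> ev a v \<or>
    (\<exists>n w. ev u (Suc n) \<and> ev (CRec \<star> f \<star> a \<star> CNum n) w \<and> ev (f \<star> CNum n \<star> CNum w) v)"
  by (cases rule: ev.cases) (auto simp: stuck)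

lemma ev_step_inv: "step t t' \<Longrightarrow> ev t n \<Longrightarrow> ev t' n"
  by (erule ev.cases) (auto simp: stuck dest: step_det)

text \<open>In the case of an operator the induction hypothesis identifies the two functions
  pointwise, hence by extensionality, and \<open>F\<close> is applied to the same argument.\<close>

lemma ev_det: "ev t n \<Longrightarrow> ev t n' \<Longrightarrow> n = n'"
  apply (induction arbitrary: n' rule: ev.induct)
  subgoal by (erule ev_NumE) (simp_all add: stuck)
  subgoal by (drule ev_bin_inv) blast
  subgoal premises prems for t f u m F n'
  proof -
    obtain g k where gk: "n' = F g k" "\<forall>n. ev (t \<star> CNum n) (g n)" "ev u k"
      using ev_op_inv[OF prems(5)] by (elim exE conjE)
    have "f = g" by (rule ext) (rule prems(2)[OF gk(2)[rule_format]])
    moreover have "m = k" by (rule prems(4)[OF gk(3)])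
    ultimately show "F f m = n'" using gk(1) by simp
  qed
  subgoal by (drule ev_rec_inv) blast
  subgoal by (drule ev_rec_inv) blast
  subgoal by (blast dest: ev_step_inv)
  done

lemma ev_rec_nat:
  assumes "\<And>n y. ev (g \<star> CNum n \<star> CNum y) (H n y)" and "ev e c"
  shows "ev t n \<Longrightarrow> ev (CRec \<star> g \<star> e \<star> t) (rec_nat c H n)"
proof (induction n arbitrary: t)
  case 0
  show ?case using ev_rec_0[OF 0 assms(2)] by simp
next
  case (Suc n)
  have "ev (CRec \<star> g \<star> e \<star> CNum n) (rec_nat c H n)" by (rule Suc.IH[OF ev_num])
  from ev_rec_Suc[OF Suc.prems this assms(1)] show ?case by simp
qed

definition val :: "ctm \<Rightarrow> nat" where "val t = (THE n. ev t n)"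

lemma val_eq: "ev t n \<Longrightarrow> val t = n"
  unfolding val_def by (rule the_equality) (auto dest: ev_det)

text \<open>A binary constant with a dummy first argument serves as a name for \<open>g\<close>, so
  no further constructor is needed.\<close>

definition cfun :: "(nat \<Rightarrow> nat) \<Rightarrow> ctm" where "cfun g = CBin (\<lambda>_. g) \<star> CNum 0"

lemma ev_cfun: "ev u n \<Longrightarrow> ev (cfun g \<star> u) (g n)"
  unfolding cfun_def using ev_bin[OF ev_num, where h = "\<lambda>_. g"] by simp

definition fun_of :: "ctm \<Rightarrow> nat \<Rightarrow> nat" where "fun_of d n = val (d \<star> CNum n)"

lemma fun_of_cfun [simp]: "fun_of (cfun g) = g"
  by (auto simp: fun_of_def intro!: val_eq ev_cfun ev_num)

section \<open>A type structure of sequences\<close>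

abbreviation slice :: "(nat \<Rightarrow> nat) \<Rightarrow> nat \<Rightarrow> nat \<Rightarrow> nat" where
  "slice f i \<equiv> \<lambda>j. f (prod_encode (i, j))"

text \<open>Every closure condition is uniform in the index \<open>i\<close>, because it will be
  applied to sequences of arguments. In \<open>M_least\<close> a row without a positive value yields
  the least element of an empty predicate, one fixed number, so the operation stays total.\<close>

locale seq_model =
  fixes M :: "(nat \<Rightarrow> nat) set"
  assumes M_const: "(\<lambda>_. c) \<in> M"
    and M_fst: "(\<lambda>i. fst (prod_decode i)) \<in> M"
    and M_snd: "(\<lambda>i. snd (prod_decode i)) \<in> M"
    and M_comp: "f \<in> M \<Longrightarrow> g \<in> M \<Longrightarrow> (\<lambda>i. f (g i)) \<in> M"
    and M_pair: "f \<in> M \<Longrightarrow> g \<in> M \<Longrightarrow> (\<lambda>i. prod_encode (f i, g i)) \<in> M"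
    and M_plus: "f \<in> M \<Longrightarrow> g \<in> M \<Longrightarrow> (\<lambda>i. f i + g i) \<in> M"
    and M_times: "f \<in> M \<Longrightarrow> g \<in> M \<Longrightarrow> (\<lambda>i. f i * g i) \<in> M"
    and M_eq: "f \<in> M \<Longrightarrow> g \<in> M \<Longrightarrow> (\<lambda>i. of_bool (f i = g i)) \<in> M"
    and M_less: "f \<in> M \<Longrightarrow> g \<in> M \<Longrightarrow> (\<lambda>i. of_bool (f i < g i)) \<in> M"
    and M_rec: "h \<in> M \<Longrightarrow> a \<in> M \<Longrightarrow> b \<in> M \<Longrightarrow>
      (\<lambda>i. rec_nat (a i) (\<lambda>n y. h (prod_encode (i, prod_encode (n, y)))) (b i)) \<in> M"
    and M_least: "f \<in> M \<Longrightarrow> (\<lambda>i. LEAST n. 0 < slice f i n) \<in> M"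
begin

lemma M_id: "(\<lambda>i. i) \<in> M"
  using M_pair[OF M_fst M_snd] by simp

lemma M_slice: "f \<in> M \<Longrightarrow> slice f i \<in> M"
  using M_comp[OF _ M_pair[OF M_const M_id]] by fast

text \<open>The elements of the model are terms, and what is specified are the sequences of elements that
  belong to it (up to equality): those of type \<open>N\<close> evaluate to a sequence in \<open>M\<close>, and those of
  type \<open>\<sigma> \<rightarrow> \<tau>\<close> map sequences to sequences, along any reindexing in \<open>M\<close>.\<close>

primrec rel :: "ty \<Rightarrow> (nat \<Rightarrow> ctm) \<Rightarrow> (nat \<Rightarrow> ctm) \<Rightarrow> bool" where
  "rel N a b \<longleftrightarrow> (\<exists>f\<in>M. \<forall>i. ev (a i) (f i) \<and> ev (b i) (f i))"
| "rel (\<sigma> \<rightarrow> \<tau>) a b \<longleftrightarrow>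
    (\<forall>r\<in>M. \<forall>s s'. rel \<sigma> s s' \<longrightarrow> rel \<tau> (\<lambda>i. a (r i) \<star> s i) (\<lambda>i. b (r i) \<star> s' i))"

abbreviation eqv :: "ty \<Rightarrow> ctm \<Rightarrow> ctm \<Rightarrow> bool" where
  "eqv \<sigma> d e \<equiv> rel \<sigma> (\<lambda>_. d) (\<lambda>_. e)"

abbreviation dom_at :: "ty \<Rightarrow> ctm \<Rightarrow> bool" where
  "dom_at \<sigma> d \<equiv> eqv \<sigma> d d"

section \<open>The partial equivalence relations\<close>

lemma rel_sym: "rel \<sigma> a b \<Longrightarrow> rel \<sigma> b a"
  by (induction \<sigma> arbitrary: a b) auto

lemma rel_trans: "rel \<sigma> a b \<Longrightarrow> rel \<sigma> b c \<Longrightarrow> rel \<sigma> a c"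
proof (induction \<sigma> arbitrary: a b c)
  case N
  then obtain f g where fg: "f \<in> M" "g \<in> M" "\<forall>i. ev (a i) (f i) \<and> ev (b i) (f i)"
    "\<forall>i. ev (b i) (g i) \<and> ev (c i) (g i)" by auto
  then have "f = g" using ev_det by blast
  then show ?case using fg by auto
next
  case (Fn \<sigma> \<tau>)
  have "rel \<tau> (\<lambda>i. a (r i) \<star> s i) (\<lambda>i. c (r i) \<star> s' i)" if "r \<in> M" "rel \<sigma> s s'" for r s s'
  proof (rule Fn.IH(2))
    have "rel \<sigma> s s" using that rel_sym Fn.IH(1) by blast
    then show "rel \<tau> (\<lambda>i. a (r i) \<star> s i) (\<lambda>i. b (r i) \<star> s i)" using Fn.prems that by simp
    show "rel \<tau> (\<lambda>i. b (r i) \<star> s i) (\<lambda>i. c (r i) \<star> s' i)" using Fn.prems that by simp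
  qed
  then show ?case by simp
qed

lemma rel_refl1: "rel \<sigma> a b \<Longrightarrow> rel \<sigma> a a"
  by (rule rel_trans[OF _ rel_sym])

lemma rel_refl2: "rel \<sigma> a b \<Longrightarrow> rel \<sigma> b b"
  by (rule rel_trans[OF rel_sym])

lemma rel_reindex: "rel \<sigma> a b \<Longrightarrow> r \<in> M \<Longrightarrow> rel \<sigma> (\<lambda>i. a (r i)) (\<lambda>i. b (r i))"
proof (induction \<sigma> arbitrary: a b r)
  case N
  then obtain f where "f \<in> M" "\<forall>i. ev (a i) (f i) \<and> ev (b i) (f i)" by auto
  then show ?case unfolding rel.simps by (intro bexI[OF _ M_comp[OF _ N.prems(2)]]) simp_all
next
  case (Fn \<sigma> \<tau>)
  show ?case unfolding rel.simps
  proof (intro ballI allI impI)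
    fix q s s' assume "q \<in> M" "rel \<sigma> s s'"
    then show "rel \<tau> (\<lambda>i. a (r (q i)) \<star> s i) (\<lambda>i. b (r (q i)) \<star> s' i)"
      using Fn.prems(1) M_comp[OF Fn.prems(2) \<open>q \<in> M\<close>] by simp
  qed
qed

lemma rel_at: "rel \<sigma> a b \<Longrightarrow> eqv \<sigma> (a i) (b i)"
  by (rule rel_reindex[OF _ M_const])

lemma rel_app: "rel (\<sigma> \<rightarrow> \<tau>) a b \<Longrightarrow> rel \<sigma> s s' \<Longrightarrow> rel \<tau> (\<lambda>i. a i \<star> s i) (\<lambda>i. b i \<star> s' i)"
  using M_id by fastforce

text \<open>Reducing a function reduces every application of it, so head expansion passes from
  \<open>N\<close> to all types. The combinators then need only their contraction rules.\<close>

lemma rel_step: "(\<And>i. step (a i) (a' i)) \<Longrightarrow> rel \<sigma> a' b \<Longrightarrow> rel \<sigma> a b"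
proof (induction \<sigma> arbitrary: a a' b)
  case N
  then show ?case using ev_step by (simp, blast)
next
  case (Fn \<sigma> \<tau>)
  show ?case unfolding rel.simps
  proof (intro ballI allI impI)
    fix r s s' assume "r \<in> M" "rel \<sigma> s s'"
    then have "rel \<tau> (\<lambda>i. a' (r i) \<star> s i) (\<lambda>i. b (r i) \<star> s' i)"
      using Fn.prems(2) by simp
    then show "rel \<tau> (\<lambda>i. a (r i) \<star> s i) (\<lambda>i. b (r i) \<star> s' i)"
      by (rule Fn.IH(2)[rotated]) (rule step_app[OF Fn.prems(1)])
  qed
qed

lemma rel_steps: "(\<And>i. step (a i) (a' i)) \<Longrightarrow> (\<And>i. step (b i) (b' i)) \<Longrightarrow> rel \<sigma> a' b' \<Longrightarrow> rel \<sigma> a b"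
  by (rule rel_step, assumption, rule rel_sym, rule rel_step, assumption, rule rel_sym)

text \<open>The language compares single elements, whereas \<open>rel\<close> compares whole
  sequences. This lemma bridges the two: once both sequences belong to the model, equality can be
  checked index by index.\<close>

lemma rel_pointwise:
  "rel \<sigma> a a \<Longrightarrow> rel \<sigma> b b \<Longrightarrow> (\<And>i. eqv \<sigma> (a i) (b i)) \<Longrightarrow> rel \<sigma> a b"
proof (induction \<sigma> arbitrary: a b)
  case N
  then obtain f g where fg: "f \<in> M" "\<forall>i. ev (a i) (f i)" "\<forall>i. ev (b i) (g i)" by auto
  have "f i = g i" for i
  proof -
    obtain n where "ev (a i) n" "ev (b i) n" using N.prems(3)[of i] by auto
    then show ?thesis using fg(2,3) ev_det by metis
  qed
  then show ?case using fg by (auto intro!: bexI[of _ f])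
next
  case (Fn \<sigma> \<tau>)
  show ?case unfolding rel.simps
  proof (intro ballI allI impI)
    fix r s s' assume r: "r \<in> M" and s: "rel \<sigma> s s'"
    have a: "rel (\<sigma> \<rightarrow> \<tau>) (\<lambda>i. a (r i)) (\<lambda>i. a (r i))" "rel (\<sigma> \<rightarrow> \<tau>) (\<lambda>i. b (r i)) (\<lambda>i. b (r i))"
      by (fact rel_reindex[OF Fn.prems(1) r] rel_reindex[OF Fn.prems(2) r])+
    show "rel \<tau> (\<lambda>i. a (r i) \<star> s i) (\<lambda>i. b (r i) \<star> s' i)"
    proof (rule Fn.IH(2))
      show "rel \<tau> (\<lambda>i. a (r i) \<star> s i) (\<lambda>i. a (r i) \<star> s i)"
        "rel \<tau> (\<lambda>i. b (r i) \<star> s' i) (\<lambda>i. b (r i) \<star> s' i)"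
        by (fact rel_app[OF a(1) rel_refl1[OF s]] rel_app[OF a(2) rel_refl2[OF s]])+
      show "eqv \<tau> (a (r i) \<star> s i) (b (r i) \<star> s' i)" for i
        by (rule rel_app[OF Fn.prems(3) rel_at[OF s]])
    qed
  qed
qed

lemma eqv_fun:
  assumes d: "dom_at (\<sigma> \<rightarrow> \<tau>) d" and e: "dom_at (\<sigma> \<rightarrow> \<tau>) e"
    and de: "\<And>z. dom_at \<sigma> z \<Longrightarrow> eqv \<tau> (d \<star> z) (e \<star> z)"
  shows "eqv (\<sigma> \<rightarrow> \<tau>) d e"
proof -
  have *: "rel \<tau> (\<lambda>i. d \<star> s i) (\<lambda>i. e \<star> s' i)" if s: "rel \<sigma> s s'" for s s'
  proof (rule rel_pointwise)
    show "rel \<tau> (\<lambda>i. d \<star> s i) (\<lambda>i. d \<star> s i)" by (rule rel_app[OF d rel_refl1[OF s]])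
    show "rel \<tau> (\<lambda>i. e \<star> s' i) (\<lambda>i. e \<star> s' i)" by (rule rel_app[OF e rel_refl2[OF s]])
    fix i
    have s: "eqv \<sigma> (s i) (s' i)" by (rule rel_at[OF s])
    have 1: "eqv \<tau> (d \<star> s i) (e \<star> s i)" by (rule de[OF rel_refl1[OF s]])
    have 2: "eqv \<tau> (e \<star> s i) (e \<star> s' i)" by (rule rel_app[OF e s])
    show "eqv \<tau> (d \<star> s i) (e \<star> s' i)" by (rule rel_trans[OF 1 2])
  qed
  then show ?thesis by simp
qed

lemma eqv_fun_iff:
  assumes "dom_at (\<sigma> \<rightarrow> \<tau>) d" "dom_at (\<sigma> \<rightarrow> \<tau>) e"
  shows "eqv (\<sigma> \<rightarrow> \<tau>) d e \<longleftrightarrow> (\<forall>z. dom_at \<sigma> z \<longrightarrow> eqv \<tau> (d \<star> z) (e \<star> z))"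
  by (intro iffI allI impI, erule (1) rel_app, rule eqv_fun[OF assms], simp only:)

lemma eqv_N: "eqv N d e \<longleftrightarrow> (\<exists>n. ev d n \<and> ev e n)"
proof
  assume "\<exists>n. ev d n \<and> ev e n"
  then obtain n where "ev d n" "ev e n" by blast
  then show "eqv N d e" unfolding rel.simps by (intro bexI[OF _ M_const[of n]]) simp
qed auto

lemma dom_at_N: "dom_at N d \<longleftrightarrow> (\<exists>n. ev d n)"
  by (simp only: eqv_N conj_absorb)

lemma eqv_num: "ev d n \<Longrightarrow> eqv N d (CNum n)"
  unfolding eqv_N using ev_num by blast

lemma rel_num: "f \<in> M \<Longrightarrow> rel N (\<lambda>i. CNum (f i)) (\<lambda>i. CNum (f i))"
  by (auto intro: ev_num)

subsection \<open>The constants\<close>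

lemma rel_K: "dom_at (\<sigma> \<rightarrow> \<tau> \<rightarrow> \<sigma>) CK"
  by (auto intro!: rel_steps[OF step_K step_K] rel_reindex)

lemma rel_S: "dom_at ((\<rho> \<rightarrow> \<sigma> \<rightarrow> \<tau>) \<rightarrow> (\<rho> \<rightarrow> \<sigma>) \<rightarrow> \<rho> \<rightarrow> \<tau>) CS"
  apply (subst rel.simps, intro ballI allI impI)
  apply (subst rel.simps, intro ballI allI impI)
  apply (subst rel.simps, intro ballI allI impI)
  apply (rule rel_steps[OF step_S step_S])
  apply (rule rel_app[where \<sigma> = \<sigma>])
   apply (rule rel_app[where \<sigma> = \<rho>])
    apply (erule rel_reindex[OF rel_reindex], assumption, assumption, assumption)
  apply (rule rel_app[where \<sigma> = \<rho>])
   apply (erule rel_reindex, assumption, assumption)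
  done

lemma rel_bin:
  assumes "\<And>f g. f \<in> M \<Longrightarrow> g \<in> M \<Longrightarrow> (\<lambda>i. h (f i) (g i)) \<in> M"
  shows "dom_at (N \<rightarrow> N \<rightarrow> N) (CBin h)"
proof (subst rel.simps, intro ballI allI impI, subst rel.simps, intro ballI allI impI)
  fix r s s' q t t' assume s: "rel N s s'" and q: "q \<in> M" and t: "rel N t t'"
  obtain f where f: "f \<in> M" "\<forall>i. ev (s (q i)) (f i) \<and> ev (s' (q i)) (f i)"
    using rel_reindex[OF s q] by auto
  obtain g where g: "g \<in> M" "\<forall>i. ev (t i) (g i) \<and> ev (t' i) (g i)" using t by auto
  show "rel N (\<lambda>i. CBin h \<star> s (q i) \<star> t i) (\<lambda>i. CBin h \<star> s' (q i) \<star> t' i)"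
    unfolding rel.simps
    by (rule bexI[OF _ assms[OF f(1) g(1)]]) (use f(2) g(2) ev_bin in blast)
qed

text \<open>Here the reindexing in the arrow clause of \<open>rel\<close> pays off: evaluating the
  first component of the decoded index at the second one turns a sequence of functions into a single
  element of \<open>M\<close> whose rows they are.\<close>

lemma rel_ty1:
  assumes "rel ty1 a b"
  obtains f where "f \<in> M" "\<And>i j. ev (a i \<star> CNum j) (slice f i j)" "\<And>i j. ev (b i \<star> CNum j) (slice f i j)"
proof -
  have "rel N (\<lambda>i. a (fst (prod_decode i)) \<star> CNum (snd (prod_decode i)))
     (\<lambda>i. b (fst (prod_decode i)) \<star> CNum (snd (prod_decode i)))"
    by (rule rel_app[OF rel_reindex[OF assms M_fst] rel_num[OF M_snd]])
  then obtain f where f: "f \<in> M" "\<forall>i. ev (a (fst (prod_decode i)) \<star> CNum (snd (prod_decode i))) (f i)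
     \<and> ev (b (fst (prod_decode i)) \<star> CNum (snd (prod_decode i))) (f i)" by auto
  show ?thesis
    by (rule that[OF f(1)]) (use spec[OF f(2), of "prod_encode (i, j)" for i j] in simp_all)
qed

lemma rel_op:
  assumes "\<And>f m. f \<in> M \<Longrightarrow> m \<in> M \<Longrightarrow> (\<lambda>i. F (slice f i) (m i)) \<in> M"
  shows "dom_at (ty1 \<rightarrow> N \<rightarrow> N) (COp F)"
proof (subst rel.simps, intro ballI allI impI, subst rel.simps, intro ballI allI impI)
  fix r t t' q u u' assume t: "rel ty1 t t'" and q: "q \<in> M" and u: "rel N u u'"
  obtain f where f: "f \<in> M" "\<And>i j. ev (t (q i) \<star> CNum j) (slice f i j)"
     "\<And>i j. ev (t' (q i) \<star> CNum j) (slice f i j)"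
    using rel_ty1[OF rel_reindex[OF t q]] by blast
  obtain m where m: "m \<in> M" "\<forall>i. ev (u i) (m i) \<and> ev (u' i) (m i)" using u by auto
  show "rel N (\<lambda>i. COp F \<star> t (q i) \<star> u i) (\<lambda>i. COp F \<star> t' (q i) \<star> u' i)"
    unfolding rel.simps
    by (rule bexI[OF _ assms[OF f(1) m(1)]]) (intro allI conjI ev_op f(2,3); simp add: m(2))
qed

lemma rel_Rec: "dom_at ((N \<rightarrow> N \<rightarrow> N) \<rightarrow> N \<rightarrow> N \<rightarrow> N) CRec"
proof (subst rel.simps, intro ballI allI impI, subst rel.simps, intro ballI allI impI,
    subst rel.simps, intro ballI allI impI)
  fix r f f' q a a' p u u'
  assume f: "rel (N \<rightarrow> N \<rightarrow> N) f f'" and q: "q \<in> M" and a: "rel N a a'" and p: "p \<in> M"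
    and u: "rel N u u'"
  let ?r = "\<lambda>i. q (p i)"
  have ff: "rel (N \<rightarrow> N \<rightarrow> N) (\<lambda>i. f (?r i)) (\<lambda>i. f' (?r i))"
    using rel_reindex[OF f M_comp[OF q p]] .
  obtain c where c: "c \<in> M" "\<forall>i. ev (a (p i)) (c i) \<and> ev (a' (p i)) (c i)"
    using rel_reindex[OF a p] by auto
  obtain b where b: "b \<in> M" "\<forall>i. ev (u i) (b i) \<and> ev (u' i) (b i)" using u by auto
  \<comment> \<open>An index codes a triple: position in the sequence, recursion counter, previous
    value. One element of \<open>M\<close> thus tabulates all step functions at once, in the form
    that \<open>M_rec\<close> expects.\<close>
  let ?j = "\<lambda>i. fst (prod_decode i)" and ?n = "\<lambda>i. fst (prod_decode (snd (prod_decode i)))"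
    and ?y = "\<lambda>i. snd (prod_decode (snd (prod_decode i)))"
  have "rel N (\<lambda>i. f (?r (?j i)) \<star> CNum (?n i) \<star> CNum (?y i))
          (\<lambda>i. f' (?r (?j i)) \<star> CNum (?n i) \<star> CNum (?y i))"
    by (rule rel_app[OF rel_app[OF rel_reindex[OF ff M_fst]]])
       (rule rel_num[OF M_comp[OF M_fst M_snd]] rel_num[OF M_comp[OF M_snd M_snd]])+
  then obtain h where h: "h \<in> M" "\<forall>i. ev (f (?r (?j i)) \<star> CNum (?n i) \<star> CNum (?y i)) (h i)
     \<and> ev (f' (?r (?j i)) \<star> CNum (?n i) \<star> CNum (?y i)) (h i)" by auto
  define H where "H i n y = h (prod_encode (i, prod_encode (n, y)))" for i n y
  have H: "ev (f (?r i) \<star> CNum n \<star> CNum y) (H i n y)" "ev (f' (?r i) \<star> CNum n \<star> CNum y) (H i n y)" for i n y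
    using spec[OF h(2), of "prod_encode (i, prod_encode (n, y))"] by (simp_all add: H_def)
  have "(\<lambda>i. rec_nat (c i) (H i) (b i)) \<in> M"
    unfolding H_def by (rule M_rec[OF h(1) c(1) b(1)])
  then show "rel N (\<lambda>i. CRec \<star> f (?r i) \<star> a (p i) \<star> u i) (\<lambda>i. CRec \<star> f' (?r i) \<star> a' (p i) \<star> u' i)"
    using b c H by (auto intro!: bexI[where x = "\<lambda>i. rec_nat (c i) (H i) (b i)"] ev_rec_nat)
qed

lemma rel_cfun:
  assumes "f \<in> M"
  shows "rel ty1 (\<lambda>i. cfun (slice f i)) (\<lambda>i. cfun (slice f i))"
proof (subst rel.simps, intro ballI allI impI)
  fix r s s' assume r: "r \<in> M" "rel N s s'"
  then obtain g where g: "g \<in> M" "\<forall>i. ev (s i) (g i) \<and> ev (s' i) (g i)" by auto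
  show "rel N (\<lambda>i. cfun (slice f (r i)) \<star> s i) (\<lambda>i. cfun (slice f (r i)) \<star> s' i)"
    using g by (auto intro!: bexI[OF _ M_comp[OF assms M_pair[OF r(1) g(1)]]]
      ev_cfun[where g = "slice f (r i)" for i])
qed

lemma dom_cfun: "g \<in> M \<Longrightarrow> dom_at ty1 (cfun g)"
  using rel_at[OF rel_cfun[OF M_comp[OF _ M_snd]]] by simp

lemma dom_ty1:
  assumes "eqv ty1 d e"
  shows fun_of_in: "fun_of d \<in> M" and ev_fun_of: "ev u n \<Longrightarrow> ev (d \<star> u) (fun_of d n)"
    and fun_of_eq: "fun_of e = fun_of d"
proof -
  obtain f where f: "f \<in> M" "\<And>i j. ev (d \<star> CNum j) (slice f i j)" "\<And>i j. ev (e \<star> CNum j) (slice f i j)"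
    using rel_ty1[OF assms] by blast
  have d: "fun_of d = slice f 0" "fun_of e = slice f 0" 
    by (rule ext, simp only: fun_of_def, rule val_eq, rule f)+
  show "fun_of d \<in> M" using d M_slice f by simp
  show "fun_of e = fun_of d" using d by simp
  show "ev (d \<star> u) (fun_of d n)" if "ev u n"
  proof -
    have "eqv N (d \<star> u) (d \<star> CNum n)"
      using rel_app[OF rel_refl1[OF assms] eqv_num[OF that]] .
    moreover have "ev (d \<star> CNum n) (fun_of d n)" using d f(2)[of n 0] by simp
    ultimately show ?thesis unfolding eqv_N using ev_det by metis
  qed
qed

text \<open>The objects of type 1 are, up to equality of the model, exactly functions in
  \<open>M\<close>; the representing term does not matter.\<close>

lemma eqv_ty1:
  assumes "dom_at ty1 d" "dom_at ty1 e" shows "eqv ty1 d e \<longleftrightarrow> fun_of d = fun_of e"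
proof
  assume "fun_of d = fun_of e"
  then show "eqv ty1 d e"
    using dom_ty1(2)[OF assms(1)] dom_ty1(2)[OF assms(2)] 
    unfolding eqv_fun_iff[OF assms] dom_at_N eqv_N by metis
qed (rule dom_ty1(3)[symmetric])

lemma eqv_cfun: "dom_at ty1 d \<Longrightarrow> eqv ty1 d (cfun (fun_of d))"
  by (rule iffD2[OF eqv_ty1[OF _ dom_cfun[OF fun_of_in]]]) (assumption+, simp only: fun_of_cfun)

end

lemma ev_CNum_iff: "ev (CNum n) k \<longleftrightarrow> k = n"
  by (auto intro: ev_num elim!: ev_NumE simp: stuck)

lemma ev_CBin_iff: "ev (CBin h \<star> s \<star> t) k \<longleftrightarrow> (\<exists>i j. ev s i \<and> ev t j \<and> k = h i j)"
  using ev_bin ev_bin_inv by fastforce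

section \<open>Satisfaction\<close>

primrec const_of :: "con \<Rightarrow> ctm" where
  "const_of Zero = CNum 0"
| "const_of con.One = CNum 1"
| "const_of Plus = CBin (+)"
| "const_of Times = CBin (*)"
| "const_of (CombK \<sigma> \<tau>) = CK"
| "const_of (CombS \<rho> \<sigma> \<tau>) = CS"
| "const_of Rec0 = CRec"

type_synonym env = "var \<Rightarrow> ctm"

primrec den :: "env \<Rightarrow> tm \<Rightarrow> ctm" where
  "den \<rho> (Var x) = \<rho> x"
| "den \<rho> (Con c) = const_of c"
| "den \<rho> (s \<cdot> t) = den \<rho> s \<star> den \<rho> t"

lemma den_cong: "(\<And>x. x \<in> vars_tm t \<Longrightarrow> \<rho> x = \<rho>' x) \<Longrightarrow> den \<rho> t = den \<rho>' t"
  by (induction t) auto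

lemma den_subst: "den \<rho> (subst_tm x u t) = den (\<rho>(x := den \<rho> u)) t"
  by (induction t) auto

context seq_model
begin

lemma dom_const: "dom_at (con_type c) (const_of c)"
proof (cases c)
  case Zero
  show ?thesis unfolding Zero con_type.simps const_of.simps by (rule rel_num[OF M_const])
next
  case One
  show ?thesis unfolding One con_type.simps const_of.simps by (rule rel_num[OF M_const])
next
  case Plus
  show ?thesis unfolding Plus con_type.simps const_of.simps by (rule rel_bin[OF M_plus])
next
  case Times
  show ?thesis unfolding Times con_type.simps const_of.simps by (rule rel_bin[OF M_times])
next
  case (CombK \<sigma> \<tau>)
  show ?thesis unfolding CombK con_type.simps const_of.simps by (rule rel_K)
next
  case (CombS \<rho> \<sigma> \<tau>)
  show ?thesis unfolding CombS con_type.simps const_of.simps by (rule rel_S)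
next
  case Rec0
  show ?thesis unfolding Rec0 con_type.simps const_of.simps by (rule rel_Rec)
qed

lemma rel_den:
  assumes "\<And>x. rel (snd x) (\<lambda>i. \<rho> i x) (\<lambda>i. \<rho>' i x)"
  shows "type_of t = Some \<tau> \<Longrightarrow> rel \<tau> (\<lambda>i. den (\<rho> i) t) (\<lambda>i. den (\<rho>' i) t)"
proof (induction t arbitrary: \<tau>)
  case (Var x)
  then show ?case using assms[of x] by simp
next
  case (Con c)
  then show ?case using dom_const[of c] by (simp del: rel.simps)
next
  case (App s t)
  then obtain \<sigma> where "type_of s = Some (\<sigma> \<rightarrow> \<tau>)" "type_of t = Some \<sigma>"
    using type_of_app by blast
  then show ?case unfolding den.simps using App.IH by (intro rel_app[where \<sigma> = \<sigma>]) blast+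
qed

definition good :: "env \<Rightarrow> bool" where
  "good \<rho> \<longleftrightarrow> (\<forall>x. dom_at (snd x) (\<rho> x))"

lemma good_upd: "good \<rho> \<Longrightarrow> dom_at (snd x) d \<Longrightarrow> good (\<rho>(x := d))"
  by (auto simp add: good_def simp del: rel.simps split_paired_All)

lemma dom_den: "good \<rho> \<Longrightarrow> type_of t = Some \<tau> \<Longrightarrow> dom_at \<tau> (den \<rho> t)"
  unfolding good_def by (rule rel_den) blast+

lemma eqv_den: "(\<And>x. eqv (snd x) (\<rho> x) (\<rho>' x)) \<Longrightarrow> type_of t = Some \<tau> \<Longrightarrow> eqv \<tau> (den \<rho> t) (den \<rho>' t)"
  by (rule rel_den)

primrec sat :: "fm \<Rightarrow> env \<Rightarrow> bool" where
  "sat (Eq s t) \<rho> \<longleftrightarrow> (\<exists>n. ev (den \<rho> s) n \<and> ev (den \<rho> t) n)"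
| "sat (Less s t) \<rho> \<longleftrightarrow> (\<exists>m n. ev (den \<rho> s) m \<and> ev (den \<rho> t) n \<and> m < n)"
| "sat Falsum \<rho> \<longleftrightarrow> False"
| "sat (Imp A B) \<rho> \<longleftrightarrow> (sat A \<rho> \<longrightarrow> sat B \<rho>)"
| "sat (All x A) \<rho> \<longleftrightarrow> (\<forall>d. dom_at (snd x) d \<longrightarrow> sat A (\<rho>(x := d)))"

lemma sat_cong: "(\<And>x. x \<in> free_vars A \<Longrightarrow> \<rho> x = \<rho>' x) \<Longrightarrow> sat A \<rho> \<longleftrightarrow> sat A \<rho>'"
proof (induction A arbitrary: \<rho> \<rho>')
  case (Eq s t)
  have "den \<rho> s = den \<rho>' s" "den \<rho> t = den \<rho>' t" using Eq by (auto intro!: den_cong)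
  then show ?case by simp
next
  case (Less s t)
  have "den \<rho> s = den \<rho>' s" "den \<rho> t = den \<rho>' t" using Less by (auto intro!: den_cong)
  then show ?case by simp
next
  case (Imp A B)
  have "sat A \<rho> \<longleftrightarrow> sat A \<rho>'" "sat B \<rho> \<longleftrightarrow> sat B \<rho>'"
    using Imp.prems by (auto intro!: Imp.IH)
  then show ?case by simp
next
  case (All x A)
  have "sat A (\<rho>(x := d)) \<longleftrightarrow> sat A (\<rho>'(x := d))" for d
    using All.prems by (intro All.IH) auto
  then show ?case by simp
qed simp

lemma sat_subst: "free_for u x A \<Longrightarrow> sat (subst x u A) \<rho> \<longleftrightarrow> sat A (\<rho>(x := den \<rho> u))"
proof (induction A arbitrary: \<rho>)
  case (All y A)
  show ?case
  proof (cases "y = x")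
    case True
    then show ?thesis by (simp del: fun_upd_apply)
  next
    case False
    show ?thesis
    proof (cases "x \<in> free_vars (All y A)")
      case True
      with All.prems have y: "y \<notin> vars_tm u" and ff: "free_for u x A" by auto
      have "den (\<rho>(y := d)) u = den \<rho> u" for d using y by (auto intro!: den_cong)
      then have "sat (subst x u A) (\<rho>(y := d)) \<longleftrightarrow> sat A (\<rho>(x := den \<rho> u, y := d))" for d
        using All.IH[OF ff, of "\<rho>(y := d)"] False by (simp add: fun_upd_twist del: fun_upd_apply)
      then show ?thesis using False by (simp del: fun_upd_apply)
    next
      case x: False
      have "subst x u B = B" if "x \<notin> free_vars B" for B
      proof -
        have tm: "x \<notin> vars_tm t \<Longrightarrow> subst_tm x u t = t" for t by (induction t) auto
        show ?thesis using that by (induction B) (auto simp: tm)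
      qed
      then have "subst x u (All y A) = All y A" using x by blast
      then show ?thesis using x by (metis sat_cong fun_upd_apply)
    qed
  qed
qed (auto simp: den_subst)

lemma eqv_ev: "eqv N d e \<Longrightarrow> ev d n \<longleftrightarrow> ev e n"
  unfolding eqv_N using ev_det by blast

text \<open>Since satisfaction respects equality of the model, the value of a variable can be
  replaced by a canonical representative, \<open>CNum m\<close> or \<open>cfun g\<close>.\<close>

lemma sat_eqv:
  "(\<And>x. eqv (snd x) (\<rho> x) (\<rho>' x)) \<Longrightarrow> wff A \<Longrightarrow> sat A \<rho> \<longleftrightarrow> sat A \<rho>'"
proof (induction A arbitrary: \<rho> \<rho>')
  case (Eq s t)
  then have "eqv N (den \<rho> s) (den \<rho>' s)" "eqv N (den \<rho> t) (den \<rho>' t)"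
    by (auto intro!: eqv_den simp del: rel.simps)
  then show ?case using eqv_ev by (simp del: rel.simps)
next
  case (Less s t)
  then have "eqv N (den \<rho> s) (den \<rho>' s)" "eqv N (den \<rho> t) (den \<rho>' t)"
    by (auto intro!: eqv_den simp del: rel.simps)
  then show ?case using eqv_ev by (simp del: rel.simps)
next
  case (Imp A B)
  then have "sat A \<rho> \<longleftrightarrow> sat A \<rho>'" "sat B \<rho> \<longleftrightarrow> sat B \<rho>'"
    by (metis wff.simps(4))+
  then show ?case by simp
next
  case (All x A)
  have "sat A (\<rho>(x := d)) \<longleftrightarrow> sat A (\<rho>'(x := d))" if "dom_at (snd x) d" for d
    using All.prems that by (intro All.IH) (simp_all del: rel.simps)
  then show ?case by (simp del: rel.simps)
qed simp

lemma sat_upd_eqv: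
  assumes "good \<rho>" "wff A" "eqv (snd x) d e"
  shows "sat A (\<rho>(x := d)) \<longleftrightarrow> sat A (\<rho>(x := e))"
  by (rule sat_eqv) (use assms in \<open>simp_all add: good_def del: rel.simps split_paired_All\<close>)

lemma sat_Conj: "sat (Conj A B) \<rho> \<longleftrightarrow> sat A \<rho> \<and> sat B \<rho>"
  by simp

lemma sat_Ex: "sat (Ex x A) \<rho> \<longleftrightarrow> (\<exists>d. dom_at (snd x) d \<and> sat A (\<rho>(x := d)))"
  by simp

lemma sat_forall: "sat (all \<tau> F n) \<rho> \<longleftrightarrow>
    (\<forall>d. dom_at \<tau> d \<longrightarrow> sat (F (Var (n, \<tau>)) (Suc n)) (\<rho>((n, \<tau>) := d)))"
  by (simp add: all_def del: rel.simps)

lemma sat_exists: "sat (ex \<tau> F n) \<rho> \<longleftrightarrow>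
    (\<exists>d. dom_at \<tau> d \<and> sat (F (Var (n, \<tau>)) (Suc n)) (\<rho>((n, \<tau>) := d)))"
  by (auto simp add: ex_def simp del: rel.simps)

lemma sat_forall_N:
  assumes "good \<rho>" "wff (F (Var (n, N)) (Suc n))"
  shows "sat (all N F n) \<rho> \<longleftrightarrow> (\<forall>m. sat (F (Var (n, N)) (Suc n)) (\<rho>((n, N) := CNum m)))"
proof
  assume "\<forall>m. sat (F (Var (n, N)) (Suc n)) (\<rho>((n, N) := CNum m))"
  then show "sat (all N F n) \<rho>"
    unfolding sat_forall dom_at_N using sat_upd_eqv[OF assms, of "(n, N)"] eqv_num
    by (metis snd_conv)
qed (metis sat_forall dom_at_N ev_num)

lemma sat_connectives:
  "sat ((\<^bold>\<not> F) n) \<rho> \<longleftrightarrow> \<not> sat (F n) \<rho>"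
  "sat ((F \<^bold>\<and> G) n) \<rho> \<longleftrightarrow> sat (F n) \<rho> \<and> sat (G n) \<rho>"
  "sat ((F \<^bold>\<or> G) n) \<rho> \<longleftrightarrow> sat (F n) \<rho> \<or> sat (G n) \<rho>"
  "sat ((F \<^bold>\<longrightarrow> G) n) \<rho> \<longleftrightarrow> (sat (F n) \<rho> \<longrightarrow> sat (G n) \<rho>)"
  "sat ((F \<^bold>\<longleftrightarrow> G) n) \<rho> \<longleftrightarrow> (sat (F n) \<rho> \<longleftrightarrow> sat (G n) \<rho>)"
  by (auto simp: neg_def conj_def disj_def imp_def iff_def)

lemma sat_prime:
  "ev (den \<rho> s) a \<Longrightarrow> ev (den \<rho> t) b \<Longrightarrow> sat ((s \<doteq> t) n) \<rho> \<longleftrightarrow> a = b"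
  "ev (den \<rho> s) a \<Longrightarrow> ev (den \<rho> t) b \<Longrightarrow> sat ((s \<prec> t) n) \<rho> \<longleftrightarrow> a < b"
  by (simp_all add: eq_def less_def) (metis ev_det)+

lemma wff_forms:
  "wff (all \<tau> F n) \<longleftrightarrow> wff (F (Var (n, \<tau>)) (Suc n))"
  "wff (ex \<tau> F n) \<longleftrightarrow> wff (F (Var (n, \<tau>)) (Suc n))"
  "wff ((s \<doteq> t) n) \<longleftrightarrow> type_of s = Some N \<and> type_of t = Some N"
  "wff ((s \<prec> t) n) \<longleftrightarrow> type_of s = Some N \<and> type_of t = Some N"
  "wff ((\<^bold>\<not> A) n) \<longleftrightarrow> wff (A n)"
  "wff ((A \<^bold>\<and> B) n) \<longleftrightarrow> wff (A n) \<and> wff (B n)"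
  "wff ((A \<^bold>\<or> B) n) \<longleftrightarrow> wff (A n) \<and> wff (B n)"
  "wff ((A \<^bold>\<longrightarrow> B) n) \<longleftrightarrow> wff (A n) \<and> wff (B n)"
  "wff ((A \<^bold>\<longleftrightarrow> B) n) \<longleftrightarrow> wff (A n) \<and> wff (B n)"
  by (auto simp: form_defs)

lemma good_num: "good \<rho> \<Longrightarrow> good (\<rho>((n, N) := CNum m))"
  by (rule good_upd) (auto simp: rel_num[OF M_const] simp del: rel.simps)

section \<open>Validity of the axioms of the base theory\<close>

lemma sat_basic: "F \<in> basic_axioms \<Longrightarrow> good \<rho> \<Longrightarrow> sat (sentence F) \<rho>"
  unfolding basic_axioms_def sentence_def
  by (elim insertE emptyE)
     (simp_all only: , simp_all add: sat_forall_N good_num wff_forms sat_connectives eq_def less_def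
       ev_CBin_iff ev_CNum_iff, auto)

text \<open>A quantifier at depth \<open>n\<close> binds index \<open>n\<close>. Terms with smaller
  indices keep their denotation under that binding, which replaces any discussion of
  capture.\<close>

abbreviation below :: "nat \<Rightarrow> tm \<Rightarrow> bool" where
  "below n t \<equiv> vars_tm t \<subseteq> {..<n} \<times> UNIV"

lemma below_Suc: "below n t \<Longrightarrow> below (Suc n) t"
  by force

lemma den_upd: "below n t \<Longrightarrow> den (\<rho>((n, \<tau>) := d)) t = den \<rho> t"
  by (rule den_cong) auto

text \<open>The defined equality of the language unfolds along the type just as
  \<open>eqv_fun_iff\<close> does. Extensionality then reduces to \<open>rel_app\<close>.\<close>

lemma sat_eq_at:
  "good \<rho> \<Longrightarrow> type_of s = Some \<tau> \<Longrightarrow> type_of t = Some \<tau> \<Longrightarrow> below n s \<Longrightarrow> below n t \<Longrightarrow>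
    sat (eq_at \<tau> s t n) \<rho> \<longleftrightarrow> eqv \<tau> (den \<rho> s) (den \<rho> t)"
proof (induction \<tau> arbitrary: s t n \<rho>)
  case N
  show ?case by (simp add: eq_def eqv_N del: rel.simps)
next
  case (Fn \<sigma> \<tau>)
  have "sat (eq_at \<tau> (s \<cdot> Var (n, \<sigma>)) (t \<cdot> Var (n, \<sigma>)) (Suc n)) (\<rho>((n, \<sigma>) := d)) \<longleftrightarrow>
      eqv \<tau> (den \<rho> s \<star> d) (den \<rho> t \<star> d)" if "dom_at \<sigma> d" for d
  proof (subst Fn.IH(2))
    show "good (\<rho>((n, \<sigma>) := d))" using Fn.prems that by (intro good_upd) simp_all
    show "type_of (s \<cdot> Var (n, \<sigma>)) = Some \<tau>" "type_of (t \<cdot> Var (n, \<sigma>)) = Some \<tau>"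
      using Fn.prems by simp_all
    show "below (Suc n) (s \<cdot> Var (n, \<sigma>))" "below (Suc n) (t \<cdot> Var (n, \<sigma>))"
      using Fn.prems by force+
  qed (simp add: den_upd Fn.prems del: rel.simps)
  moreover have "dom_at (\<sigma> \<rightarrow> \<tau>) (den \<rho> s)" "dom_at (\<sigma> \<rightarrow> \<tau>) (den \<rho> t)"
    by (rule dom_den; fact Fn.prems)+
  ultimately show ?case
    unfolding eq_at.simps sat_forall by (simp add: eqv_fun_iff del: rel.simps)
qed

lemma sat_comb_K:
  assumes "good \<rho>"
  shows "sat (sentence (all \<sigma> (\<lambda>x. all \<tau> (\<lambda>y. eq_at \<sigma> (Con (CombK \<sigma> \<tau>) \<cdot> x \<cdot> y) x)))) \<rho>"
  unfolding sentence_def sat_forall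
  by (intro allI impI, subst sat_eq_at)
     (auto intro!: good_upd assms rel_step[OF step_K] simp del: rel.simps)

lemma sat_comb_S:
  assumes "good \<rho>"
  shows "sat (sentence (all (\<rho>' \<rightarrow> \<sigma> \<rightarrow> \<tau>) (\<lambda>x. all (\<rho>' \<rightarrow> \<sigma>) (\<lambda>y. all \<rho>' (\<lambda>z.
    eq_at \<tau> (Con (CombS \<rho>' \<sigma> \<tau>) \<cdot> x \<cdot> y \<cdot> z) (x \<cdot> z \<cdot> (y \<cdot> z))))))) \<rho>"
  unfolding sentence_def sat_forall
proof (intro allI impI)
  fix d e f
  assume d: "dom_at (\<rho>' \<rightarrow> \<sigma> \<rightarrow> \<tau>) d" and e: "dom_at (\<rho>' \<rightarrow> \<sigma>) e" and f: "dom_at \<rho>' f"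
  have "eqv \<tau> (CS \<star> d \<star> e \<star> f) (d \<star> f \<star> (e \<star> f))"
    by (rule rel_step[OF step_S rel_app[OF rel_app[OF d f] rel_app[OF e f]]])
  then show "sat (eq_at \<tau> (Con (CombS \<rho>' \<sigma> \<tau>) \<cdot> Var (0, \<rho>' \<rightarrow> \<sigma> \<rightarrow> \<tau>) \<cdot> Var (Suc 0, \<rho>' \<rightarrow> \<sigma>) \<cdot>
      Var (Suc (Suc 0), \<rho>')) (Var (0, \<rho>' \<rightarrow> \<sigma> \<rightarrow> \<tau>) \<cdot> Var (Suc (Suc 0), \<rho>') \<cdot>
      (Var (Suc 0, \<rho>' \<rightarrow> \<sigma>) \<cdot> Var (Suc (Suc 0), \<rho>'))) (Suc (Suc (Suc 0))))
    (\<rho>((0, \<rho>' \<rightarrow> \<sigma> \<rightarrow> \<tau>) := d, (Suc 0, \<rho>' \<rightarrow> \<sigma>) := e, (Suc (Suc 0), \<rho>') := f))"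
    using d e f by (subst sat_eq_at) (auto intro!: good_upd assms simp del: rel.simps)
qed

lemma sat_extensionality:
  assumes "good \<rho>"
  shows "sat (sentence (all \<sigma> (\<lambda>x. all \<sigma> (\<lambda>y. all (\<sigma> \<rightarrow> \<tau>) (\<lambda>f.
    eq_at \<sigma> x y \<^bold>\<longrightarrow> eq_at \<tau> (f \<cdot> x) (f \<cdot> y)))))) \<rho>"
  unfolding sentence_def sat_forall sat_connectives
proof (intro allI impI)
  fix d e f
  assume d: "dom_at \<sigma> d" and e: "dom_at \<sigma> e" and f: "dom_at (\<sigma> \<rightarrow> \<tau>) f"
  let ?\<rho> = "\<rho>((0, \<sigma>) := d, (Suc 0, \<sigma>) := e, (Suc (Suc 0), \<sigma> \<rightarrow> \<tau>) := f)"
  have g: "good ?\<rho>" using assms d e f by (intro good_upd) simp_all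
  assume "sat (eq_at \<sigma> (Var (0, \<sigma>)) (Var (Suc 0, \<sigma>)) (Suc (Suc (Suc 0)))) ?\<rho>"
  then have "eqv \<sigma> d e" by (subst (asm) sat_eq_at[OF g]) (simp_all del: rel.simps)
  then show "sat (eq_at \<tau> (Var (Suc (Suc 0), \<sigma> \<rightarrow> \<tau>) \<cdot> Var (0, \<sigma>))
      (Var (Suc (Suc 0), \<sigma> \<rightarrow> \<tau>) \<cdot> Var (Suc 0, \<sigma>)) (Suc (Suc (Suc 0)))) ?\<rho>"
    using rel_app[OF f] by (subst sat_eq_at[OF g]) (simp_all del: rel.simps)
qed

lemma sat_rec_zero:
  "sat (sentence (all (N \<rightarrow> N \<rightarrow> N) (\<lambda>f. all N (\<lambda>m. Con Rec0 \<cdot> f \<cdot> m \<cdot> \<zero> \<doteq> m)))) \<rho>"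
  unfolding sentence_def sat_forall
  by (auto simp: eq_def dom_at_N intro: ev_rec_0 ev_num simp del: rel.simps)

lemma sat_rec_succ:
  "sat (sentence (all (N \<rightarrow> N \<rightarrow> N) (\<lambda>f. all N (\<lambda>m. all N (\<lambda>n.
    Con Rec0 \<cdot> f \<cdot> m \<cdot> (n \<oplus> \<one>) \<doteq> f \<cdot> n \<cdot> (Con Rec0 \<cdot> f \<cdot> m \<cdot> n)))))) \<rho>"
  unfolding sentence_def sat_forall
proof (intro allI impI)
  fix f m n
  assume f: "dom_at (N \<rightarrow> N \<rightarrow> N) f" and m: "dom_at N m" and n: "dom_at N n"
  have rec: "dom_at (N \<rightarrow> N) (CRec \<star> f \<star> m)" by (rule rel_app[OF rel_app[OF rel_Rec f] m])
  obtain v where v: "ev n v" using n dom_at_N by blast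
  have nv: "eqv N n (CNum v)" by (rule eqv_num[OF v])
  obtain w where w: "ev (CRec \<star> f \<star> m \<star> CNum v) w"
    using rel_app[OF rec rel_refl2[OF nv]] dom_at_N by blast
  have rw: "eqv N (CRec \<star> f \<star> m \<star> n) (CNum w)"
    by (rule rel_trans[OF rel_app[OF rec nv] eqv_num[OF w]])
  obtain k where k: "ev (f \<star> n \<star> (CRec \<star> f \<star> m \<star> n)) k" "ev (f \<star> CNum v \<star> CNum w) k"
    using rel_app[OF rel_app[OF f nv] rw] eqv_N by blast
  have "ev (CBin (+) \<star> n \<star> CNum 1) (Suc v)" using ev_bin[OF v ev_num[of 1], of "(+)"] by simp
  then have "ev (CRec \<star> f \<star> m \<star> (CBin (+) \<star> n \<star> CNum 1)) k"
    by (rule ev_rec_Suc[OF _ w k(2)])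
  then show "sat ((Con Rec0 \<cdot> Var (0, N \<rightarrow> N \<rightarrow> N) \<cdot> Var (Suc 0, N) \<cdot> (Var (Suc (Suc 0), N) \<oplus> \<one>) \<doteq>
      Var (0, N \<rightarrow> N \<rightarrow> N) \<cdot> Var (Suc (Suc 0), N) \<cdot>
      (Con Rec0 \<cdot> Var (0, N \<rightarrow> N \<rightarrow> N) \<cdot> Var (Suc 0, N) \<cdot> Var (Suc (Suc 0), N))) (Suc (Suc (Suc 0))))
    (\<rho>((0, N \<rightarrow> N \<rightarrow> N) := f, (Suc 0, N) := m, (Suc (Suc 0), N) := n))"
    using k(1) by (auto simp: eq_def)
qed

lemma free_for_quantifier_free: "quantifier_free A \<Longrightarrow> free_for u x A"
  by (induction A) auto

lemma sat_qf_induction: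
  assumes "quantifier_free A" "wff A" "good \<rho>" "n = (i, N)"
  shows "sat (Imp (Conj (subst n \<zero> A) (All n (Imp A (subst n (Var n \<oplus> \<one>) A)))) (All n A)) \<rho>"
proof -
  let ?P = "\<lambda>m. sat A (\<rho>(n := CNum m))"
  have num: "sat A (\<rho>(n := d)) \<longleftrightarrow> ?P m" if "ev d m" for d m
    using assms that by (intro sat_upd_eqv) (simp_all add: eqv_num del: rel.simps)
  have suc: "sat (subst n (Var n \<oplus> \<one>) A) (\<rho>(n := CNum m)) \<longleftrightarrow> ?P (Suc m)" for m
    using num[OF ev_bin[OF ev_num[of m] ev_num[of 1], of "(+)"]]
    by (simp add: sat_subst free_for_quantifier_free[OF assms(1)])
  have dom: "dom_at (snd n) d \<longleftrightarrow> (\<exists>m. ev d m)" for d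
    using assms(4) dom_at_N by (simp del: rel.simps)
  show ?thesis
  proof (subst sat.simps(4), rule impI, unfold sat_Conj, unfold sat.simps(4,5), intro allI impI, elim conjE)
    fix d
    assume 0: "sat (subst n \<zero> A) \<rho>" and d: "dom_at (snd n) d"
      and S: "\<forall>d. dom_at (snd n) d \<longrightarrow> sat A (\<rho>(n := d)) \<longrightarrow>
        sat (subst n (Var n \<oplus> \<one>) A) (\<rho>(n := d))"
    have "?P m" for m
    proof (induction m)
      case 0
      then show ?case using \<open>sat (subst n \<zero> A) \<rho>\<close>
        by (simp add: sat_subst free_for_quantifier_free[OF assms(1)] del: fun_upd_apply)
    next
      case (Suc m)
      have "dom_at (snd n) (CNum m)" unfolding dom using ev_num by blast
      then show ?case using S Suc suc by blast
    qed
    then show "sat A (\<rho>(n := d))" using d num dom by blast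
  qed
qed

text \<open>\<open>COp\<close> also expects a number; the combinators supply the dummy value 0,
  which leaves an object of type 2.\<close>

definition functional :: "((nat \<Rightarrow> nat) \<Rightarrow> nat) \<Rightarrow> ctm" where
  "functional F = CS \<star> COp (\<lambda>f _. F f) \<star> (CK \<star> CNum 0)"

lemma dom_functional:
  assumes "\<And>f. f \<in> M \<Longrightarrow> (\<lambda>i. F (slice f i)) \<in> M"
  shows "dom_at ty2 (functional F)"
proof -
  have op: "dom_at (ty1 \<rightarrow> N \<rightarrow> N) (COp (\<lambda>f _. F f))" by (rule rel_op) (rule assms)
  have k: "dom_at (ty1 \<rightarrow> N) (CK \<star> CNum 0)" by (rule rel_app[OF rel_K rel_num[OF M_const]])
  show ?thesis unfolding functional_def by (rule rel_app[OF rel_app[OF rel_S op] k])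
qed

lemma ev_functional:
  assumes "dom_at ty1 d" shows "ev (functional F \<star> d) (F (fun_of d))"
proof -
  have "ev (COp (\<lambda>f _. F f) \<star> d \<star> (CK \<star> CNum 0 \<star> d)) (F (fun_of d))"
    by (rule ev_op[where F = "\<lambda>f _. F f", OF ev_fun_of[OF assms ev_num] ev_step[OF step_K ev_num]])
  then show ?thesis unfolding functional_def by (rule ev_step[OF step_S])
qed

text \<open>Terms denote sequences of numbers in \<open>M\<close> along a sequence of assignments,
  and \<open>M\<close> is closed under comparing them. Uniformity in \<open>i\<close> is what later
  puts a choice functional into the model.\<close>

lemma quantifier_free_decidable:
  assumes E: "\<And>x. rel (snd x) (\<lambda>i. E i x) (\<lambda>i. E i x)"
  shows "quantifier_free A \<Longrightarrow> wff A \<Longrightarrow> \<exists>h\<in>M. \<forall>i. 0 < h i \<longleftrightarrow> sat A (E i)"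
proof (induction A)
  case (Eq s t)
  have "rel N (\<lambda>i. den (E i) s) (\<lambda>i. den (E i) s)" "rel N (\<lambda>i. den (E i) t) (\<lambda>i. den (E i) t)"
    using Eq.prems by (auto intro!: rel_den E simp del: rel.simps)
  then obtain f g where f: "f \<in> M" "\<forall>i. ev (den (E i) s) (f i)" and g: "g \<in> M" "\<forall>i. ev (den (E i) t) (g i)"
    by auto
  then have "sat (Eq s t) (E i) \<longleftrightarrow> f i = g i" for i using ev_det by (simp, metis)
  then show ?case by (intro bexI[OF _ M_eq[OF f(1) g(1)]]) simp
next
  case (Less s t)
  have "rel N (\<lambda>i. den (E i) s) (\<lambda>i. den (E i) s)" "rel N (\<lambda>i. den (E i) t) (\<lambda>i. den (E i) t)"
    using Less.prems by (auto intro!: rel_den E simp del: rel.simps)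
  then obtain f g where f: "f \<in> M" "\<forall>i. ev (den (E i) s) (f i)" and g: "g \<in> M" "\<forall>i. ev (den (E i) t) (g i)"
    by auto
  then have "sat (Less s t) (E i) \<longleftrightarrow> f i < g i" for i using ev_det by (simp, metis)
  then show ?case by (intro bexI[OF _ M_less[OF f(1) g(1)]]) simp
next
  case Falsum
  show ?case by (intro bexI[OF _ M_const[of 0]]) simp
next
  case (Imp A B)
  then obtain f g where f: "f \<in> M" "\<forall>i. 0 < f i \<longleftrightarrow> sat A (E i)" and g: "g \<in> M" "\<forall>i. 0 < g i \<longleftrightarrow> sat B (E i)"
    by (metis quantifier_free.simps(4) wff.simps(4))
  \<comment> \<open>With positive meaning true, an implication is the sum of the negated premise and
    the conclusion.\<close>
  have "0 < (of_bool (f i = 0) + g i :: nat) \<longleftrightarrow> sat (Imp A B) (E i)" for i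
    using f(2)[rule_format, of i] g(2)[rule_format, of i] by auto
  then show ?case by (intro bexI[OF _ M_plus[OF M_eq[OF f(1) M_const[of 0]] g(1)]]) blast
qed simp

lemma sat_qf_ac:
  assumes A: "quantifier_free A" "wff A" and f: "f = (i, ty1)" and n: "n = (j, N)" and Y: "Y = (l, ty2)"
    and Y_A: "Y \<notin> free_vars A" and "good \<rho>"
  shows "sat (Imp (All f (Ex n A)) (Ex Y (All f (subst n (Var Y \<cdot> Var f) A)))) \<rho>"
proof -
  define P where "P g m \<longleftrightarrow> sat A (\<rho>(f := cfun g, n := CNum m))" for g m
  \<comment> \<open>The choice functional picks the least witness, which \<open>M_least\<close> can
    compute along sequences.\<close>
  define F where "F g = (LEAST m. P g m)" for g
  have P: "sat A (\<rho>(f := d, n := e)) \<longleftrightarrow> P (fun_of d) m" if "dom_at ty1 d" "ev e m" for d e m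
    unfolding P_def
  proof (rule sat_eqv)
    fix x show "eqv (snd x) ((\<rho>(f := d, n := e)) x) ((\<rho>(f := cfun (fun_of d), n := CNum m)) x)"
      using eqv_cfun[OF that(1)] eqv_num[OF that(2)] \<open>good \<rho>\<close> f n
      by (auto simp add: good_def simp del: rel.simps split_paired_All)
  qed (fact A)
  have dom: "dom_at ty2 (functional F)"
  proof (rule dom_functional)
    fix g assume g: "g \<in> M"
    \<comment> \<open>These assignments run through all pairs of a row of \<open>g\<close> and a
      candidate \<open>m\<close>, so that the decision function for \<open>A\<close> has a row for
      every row of \<open>g\<close>.\<close>
    define E where "E = (\<lambda>k. \<rho>(f := cfun (slice g (fst (prod_decode k))), n := CNum (snd (prod_decode k))))"
    have "rel (snd x) (\<lambda>i. E i x) (\<lambda>i. E i x)" for x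
    proof -
      consider "x = n" | "x = f" | "x \<noteq> n" "x \<noteq> f" by blast
      then show ?thesis
      proof cases
        case 1
        then show ?thesis using n rel_num[OF M_snd] by (simp add: E_def del: rel.simps)
      next
        case 2
        then show ?thesis using f n rel_reindex[OF rel_cfun[OF g] M_fst] by (simp add: E_def del: rel.simps)
      next
        case 3
        then show ?thesis using \<open>good \<rho>\<close> by (simp add: E_def good_def del: rel.simps split_paired_All)
      qed
    qed
    from quantifier_free_decidable[OF this A] obtain h where
      h: "h \<in> M" "\<forall>i. 0 < h i \<longleftrightarrow> sat A (E i)" by blast
    have "0 < slice h i m \<longleftrightarrow> P (slice g i) m" for i m
      using h(2) by (simp add: E_def P_def)
    then show "(\<lambda>i. F (slice g i)) \<in> M" using M_least[OF h(1)] by (simp add: F_def)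
  qed
  have "sat (Ex Y (All f (subst n (Var Y \<cdot> Var f) A))) \<rho>" if "sat (All f (Ex n A)) \<rho>"
  proof -
    have *: "\<exists>e. dom_at (snd n) e \<and> sat A (\<rho>(f := d, n := e))" if "dom_at (snd f) d" for d
      using \<open>sat (All f (Ex n A)) \<rho>\<close> that by (simp only: sat.simps(5) sat_Ex)
    have "sat (subst n (Var Y \<cdot> Var f) A) (\<rho>(Y := functional F, f := d))" if "dom_at (snd f) d" for d
    proof -
      have d: "dom_at ty1 d" using f that by (simp del: rel.simps)
      have "\<exists>m. P (fun_of d) m" using *[OF that] d P f n by (metis dom_at_N snd_conv)
      then have F: "P (fun_of d) (F (fun_of d))" unfolding F_def by (rule LeastI_ex)
      have "sat A (\<rho>(Y := functional F, f := d, n := functional F \<star> d)) \<longleftrightarrow>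
          sat A (\<rho>(f := d, n := functional F \<star> d))"
        by (rule sat_cong) (use Y_A in auto)
      also have "\<dots>" using P[OF d ev_functional[OF d]] F by simp
      finally show ?thesis
        using f Y by (simp add: sat_subst free_for_quantifier_free[OF A(1)] del: fun_upd_apply)
          (simp del: fun_upd_apply add: fun_upd_same fun_upd_other)
    qed
    moreover have "dom_at (snd Y) (functional F)" using dom Y by (simp del: rel.simps)
    ultimately show ?thesis unfolding sat_Ex sat.simps(5) by blast
  qed
  then show ?thesis by (subst sat.simps(4)) (rule impI)
qed

text \<open>Bracket abstraction satisfies the beta rule up to equality of the model; this gives the
  closed terms for powers of two and for codes of initial segments their intended values.\<close>

lemma rel_lam:
  assumes "good \<rho>" "dom_at (snd x) d"
  shows "type_of t = Some \<tau> \<Longrightarrow> eqv \<tau> (den \<rho> (lam x t) \<star> d) (den (\<rho>(x := d)) t)"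
proof (induction t arbitrary: \<tau>)
  case (Var y)
  show ?case
  proof (cases "y = x")
    case True
    have "eqv \<tau> (CS \<star> CK \<star> CK \<star> d) d"
      by (rule rel_step[OF step_S rel_step[OF step_K]]) (use Var True assms in simp)
    then show ?thesis using True by (simp add: Let_def del: rel.simps)
  next
    case False
    have "eqv \<tau> (CK \<star> \<rho> y \<star> d) (\<rho> y)"
      by (rule rel_step[OF step_K]) (use Var assms in \<open>auto simp add: good_def simp del: rel.simps split_paired_All\<close>)
    then show ?thesis using False by (simp del: rel.simps)
  qed
next
  case (Con c)
  have "eqv \<tau> (CK \<star> const_of c \<star> d) (const_of c)"
    by (rule rel_step[OF step_K]) (use Con dom_const[of c] in \<open>simp del: rel.simps\<close>)
  then show ?case by (simp del: rel.simps)
next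
  case (App s t)
  then obtain \<sigma> where "type_of s = Some (\<sigma> \<rightarrow> \<tau>)" "type_of t = Some \<sigma>"
    using type_of_app by blast
  then have "eqv (\<sigma> \<rightarrow> \<tau>) (den \<rho> (lam x s) \<star> d) (den (\<rho>(x := d)) s)"
    "eqv \<sigma> (den \<rho> (lam x t) \<star> d) (den (\<rho>(x := d)) t)" using App.IH by blast+
  from rel_step[OF step_S rel_app[OF this]] show ?case by (simp del: fun_upd_apply)
qed

lemma rel_lam2:
  assumes "good \<rho>" "dom_at (snd x) d" "dom_at (snd y) e" "type_of t = Some \<tau>"
  shows "eqv \<tau> (den \<rho> (lam x (lam y t)) \<star> d \<star> e) (den (\<rho>(x := d, y := e)) t)"
  by (rule rel_trans[OF rel_app[OF rel_lam[OF assms(1,2) type_of_lam[OF assms(4)]] assms(3)]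
        rel_lam[OF good_upd[OF assms(1,2)] assms(3,4)]])

lemma ev_pow2:
  assumes "good \<rho>" "ev u n" shows "ev (den \<rho> pow2_fun \<star> u) (2 ^ n)"
proof -
  have "eqv N (den \<rho> (lam (0, N) (lam (1, N) (Var (1, N) \<oplus> Var (1, N)))) \<star> CNum i \<star> CNum w)
      (den (\<rho>((0, N) := CNum i, (1, N) := CNum w)) (Var (1, N) \<oplus> Var (1, N)))" for i w
    by (rule rel_lam2[OF assms(1)]) (simp_all add: rel_num[OF M_const] del: rel.simps)
  from eqv_ev[OF this] have "ev (den \<rho> (lam (0, N) (lam (1, N) (Var (1, N) \<oplus> Var (1, N)))) \<star> CNum i \<star> CNum w)
      (w + w)" for i w by (simp add: ev_CBin_iff ev_CNum_iff)
  from ev_rec_nat[OF this ev_num[of 1] assms(2)]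
  have "ev (den \<rho> pow2_fun \<star> u) (rec_nat 1 (\<lambda>i w. w + w) n)"
    by (simp add: pow2_fun_def del: lam.simps)
  moreover have "rec_nat 1 (\<lambda>i w. w + w) n = (2 ^ n :: nat)" by (induction n) auto
  ultimately show ?thesis by simp
qed

end

section \<open>The functionals deciding \<open>\<Sigma>\<^sup>1\<^sub>k\<close>\<close>

definition pairN :: "nat \<Rightarrow> nat \<Rightarrow> nat" where "pairN a b = (a + b) * (a + b) + a"

definition seq_code :: "(nat \<Rightarrow> nat) \<Rightarrow> nat \<Rightarrow> nat" where
  "seq_code g = rec_nat 0 (\<lambda>m v. pairN v (g m) + 1)"

fun seq_codes :: "(nat \<Rightarrow> nat) list \<Rightarrow> nat \<Rightarrow> nat" where
  "seq_codes [] n = n"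
| "seq_codes [g] n = seq_code g n"
| "seq_codes (g # gs) n = pairN (seq_code g n) (seq_codes gs n)"

text \<open>The truth value of \<open>alternate\<close> when the function quantifiers range over \<open>X\<close>.\<close>

primrec alt :: "(nat \<Rightarrow> nat) set \<Rightarrow> nat \<Rightarrow> bool \<Rightarrow> (nat \<Rightarrow> nat) \<Rightarrow> (nat \<Rightarrow> nat) list \<Rightarrow> bool" where
  "alt X 0 e f gs \<longleftrightarrow> (if e then \<exists>n. f (seq_codes gs n) = 0 else \<forall>n. f (seq_codes gs n) = 0)"
| "alt X (Suc k) e f gs \<longleftrightarrow>
    (if e then \<exists>g\<in>X. alt X k (\<not> e) f (gs @ [g]) else \<forall>g\<in>X. alt X k (\<not> e) f (gs @ [g]))"

context seq_model
begin

lemma ev_pair: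
  "ev (den \<rho> s) a \<Longrightarrow> ev (den \<rho> t) b \<Longrightarrow> ev (den \<rho> (pair s t)) (pairN a b)"
  unfolding pair_def pairN_def den.simps const_of.simps by (intro ev_bin)

lemma ev_initial:
  assumes "good \<rho>" "dom_at ty1 d" "ev u n"
  shows "ev (den \<rho> initial_fun \<star> d \<star> u) (seq_code (fun_of d) n)"
proof -
  let ?b = "pair (Var (2, N)) (Var (0, ty1) \<cdot> Var (1, N)) \<oplus> \<one>"
  let ?\<rho> = "\<rho>((0, ty1) := d)"
  let ?F = "lam (1, N) (lam (2, N) ?b)"
  have b: "type_of ?b = Some N" by (simp add: type_of_pair)
  have good: "good ?\<rho>" using assms by (intro good_upd) simp_all
  have "eqv N (den ?\<rho> ?F \<star> CNum i \<star> CNum w) (den (?\<rho>((1, N) := CNum i, (2, N) := CNum w)) ?b)" for i w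
    by (rule rel_lam2[OF good]) (simp_all add: rel_num[OF M_const] type_of_pair del: rel.simps)
  from eqv_ev[OF this] have "ev (den ?\<rho> ?F \<star> CNum i \<star> CNum w) (pairN w (fun_of d i) + 1)" for i w
    using ev_fun_of[OF assms(2) ev_num[of i]]
    by (simp add: ev_CBin_iff ev_CNum_iff) (rule ev_pair; simp add: ev_num)
  from ev_rec_nat[OF this ev_num[of 0] assms(3)]
  have "ev (den ?\<rho> (Con Rec0 \<cdot> ?F \<cdot> \<zero>) \<star> u) (seq_code (fun_of d) n)"
    by (simp add: seq_code_def del: lam.simps)
  moreover have "eqv (N \<rightarrow> N) (den \<rho> (lam (0, ty1) (Con Rec0 \<cdot> ?F \<cdot> \<zero>)) \<star> d) (den ?\<rho> (Con Rec0 \<cdot> ?F \<cdot> \<zero>))"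
    by (rule rel_lam[OF assms(1)]) (use assms(2) type_of_lam[OF type_of_lam[OF b]] in \<open>simp_all del: rel.simps lam.simps\<close>)
  from rel_app[OF this rel_refl1[OF eqv_num[OF assms(3)]]]
  have "eqv N (den \<rho> initial_fun \<star> d \<star> u) (den ?\<rho> (Con Rec0 \<cdot> ?F \<cdot> \<zero>) \<star> u)"
    by (simp only: initial_fun_def Let_def)
  ultimately show ?thesis using eqv_ev by blast
qed

lemma ev_initials:
  assumes "good \<rho>" "\<forall>g\<in>set gs. dom_at ty1 (den \<rho> g)" "ev (den \<rho> n) m"
  shows "ev (den \<rho> (initials gs n)) (seq_codes (map (\<lambda>g. fun_of (den \<rho> g)) gs) m)"
  using assms(2,3)
proof (induction gs n rule: initials.induct)
  case (1 n)
  then show ?case by simp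
next
  case (2 g n)
  then show ?case using ev_initial[OF assms(1)] by (simp del: rel.simps)
next
  case (3 g g' gs n)
  have "ev (den \<rho> (initial g n)) (seq_code (fun_of (den \<rho> g)) m)"
    using 3 ev_initial[OF assms(1)] by (simp del: rel.simps)
  then show ?case using 3 by (simp add: ev_pair del: rel.simps)
qed

lemma all_dom_ty1: "(\<forall>d. dom_at ty1 d \<longrightarrow> P (fun_of d)) \<longleftrightarrow> (\<forall>g\<in>M. P g)"
  using dom_cfun fun_of_cfun fun_of_in by metis

lemma ex_dom_ty1: "(\<exists>d. dom_at ty1 d \<and> P (fun_of d)) \<longleftrightarrow> (\<exists>g\<in>M. P g)"
  using dom_cfun fun_of_cfun fun_of_in by metis

text \<open>By \<open>all_dom_ty1\<close> and \<open>ex_dom_ty1\<close> the quantifiers of type 1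
  range over \<open>M\<close>, so the formula expresses truth relative to \<open>M\<close>, not yet
  truth over all functions.\<close>

lemma sat_alternate:
  "good \<rho> \<Longrightarrow> type_of f = Some ty1 \<Longrightarrow> below n f \<Longrightarrow> \<forall>g\<in>set gs. type_of g = Some ty1 \<and> below n g \<Longrightarrow>
    sat (alternate k e f gs n) \<rho> \<longleftrightarrow> alt M k e (fun_of (den \<rho> f)) (map (\<lambda>g. fun_of (den \<rho> g)) gs)"
proof (induction k arbitrary: e gs n \<rho>)
  case 0
  have "sat ((f \<cdot> initials gs (Var (n, N)) \<doteq> \<zero>) (Suc n)) (\<rho>((n, N) := d)) \<longleftrightarrow>
      fun_of (den \<rho> f) (seq_codes (map (\<lambda>g. fun_of (den \<rho> g)) gs) m) = 0" if d: "ev d m" for d m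
  proof (rule sat_prime)
    let ?\<rho> = "\<rho>((n, N) := d)"
    have good: "good ?\<rho>" using 0 d by (intro good_upd) (auto simp: dom_at_N simp del: rel.simps)
    have eq: "den ?\<rho> g = den \<rho> g" if "g \<in> set gs" for g using 0 that den_upd by blast
    have "ev (den ?\<rho> (initials gs (Var (n, N)))) (seq_codes (map (\<lambda>g. fun_of (den ?\<rho> g)) gs) m)"
      by (rule ev_initials[OF good]) (use 0 d dom_den[OF good] in \<open>simp_all del: rel.simps\<close>)
    moreover have "map (\<lambda>g. fun_of (den ?\<rho> g)) gs = map (\<lambda>g. fun_of (den \<rho> g)) gs" using eq by simp
    ultimately show "ev (den ?\<rho> (f \<cdot> initials gs (Var (n, N))))
        (fun_of (den \<rho> f) (seq_codes (map (\<lambda>g. fun_of (den \<rho> g)) gs) m))"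
      using ev_fun_of[OF dom_den[OF 0(1,2)]] den_upd[OF 0(3)] by simp
  qed (simp add: ev_num)
  note * = this
  show ?case
  proof (cases e)
    case True
    then show ?thesis using * by (simp add: sat_exists dom_at_N del: rel.simps) (metis ev_num)
  next
    case False
    then show ?thesis using * by (simp add: sat_forall dom_at_N del: rel.simps) (metis ev_num)
  qed
next
  case (Suc k)
  have "sat (alternate k (\<not> e) f (gs @ [Var (n, ty1)]) (Suc n)) (\<rho>((n, ty1) := d)) \<longleftrightarrow>
      alt M k (\<not> e) (fun_of (den \<rho> f)) (map (\<lambda>g. fun_of (den \<rho> g)) gs @ [fun_of d])"
    if d: "dom_at ty1 d" for d
  proof -
    let ?\<rho> = "\<rho>((n, ty1) := d)"
    have good: "good ?\<rho>" using Suc.prems d by (intro good_upd) simp_all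
    have eq: "map (\<lambda>g. fun_of (den ?\<rho> g)) gs = map (\<lambda>g. fun_of (den \<rho> g)) gs"
      using Suc.prems(4) den_upd by (metis (mono_tags, lifting) map_eq_conv)
    have "sat (alternate k (\<not> e) f (gs @ [Var (n, ty1)]) (Suc n)) ?\<rho> \<longleftrightarrow>
        alt M k (\<not> e) (fun_of (den ?\<rho> f)) (map (\<lambda>g. fun_of (den ?\<rho> g)) (gs @ [Var (n, ty1)]))"
      by (rule Suc.IH[OF good Suc.prems(2) below_Suc[OF Suc.prems(3)]])
        (use Suc.prems(4) below_Suc in fastforce)
    then show ?thesis using eq den_upd[OF Suc.prems(3)] by simp
  qed
  note * = this
  show ?case
  proof (cases e)
    case True
    then show ?thesis using * ex_dom_ty1 by (simp add: sat_exists del: rel.simps cong: conj_cong)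
  next
    case False
    then show ?thesis using * all_dom_ty1 by (simp add: sat_forall del: rel.simps)
  qed
qed

end

locale Z2_model = seq_model +
  assumes M_sigma: "f \<in> M \<Longrightarrow> (\<lambda>i. of_bool (\<not> alt M k True (slice f i) [])) \<in> M"
begin

lemma sat_S_exists:
  assumes "good \<rho>" shows "sat (S_exists k) \<rho>"
proof -
  define S where "S = functional (\<lambda>f. of_bool (\<not> alt M k True f []))"
  have S: "dom_at ty2 S" unfolding S_def by (rule dom_functional) (rule M_sigma)
  show ?thesis unfolding S_exists_def sentence_def sat_exists
  proof (intro exI[of _ S] conjI S, unfold sat_forall, intro allI impI)
    fix d assume d: "dom_at ty1 d"
    let ?\<rho> = "\<rho>((0, ty2) := S, (Suc 0, ty1) := d)"
    have good: "good ?\<rho>" using assms S d by (intro good_upd) simp_all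
    let ?S = "Var (0, ty2)" and ?f = "Var (Suc 0, ty1)"
    have v: "ev (den ?\<rho> (?S \<cdot> ?f)) (of_bool (\<not> alt M k True (fun_of d) []))"
      using ev_functional[OF d, of "\<lambda>f. of_bool (\<not> alt M k True f [])"] by (simp only: S_def) simp
    have "sat (sigma k ?f (Suc (Suc 0))) ?\<rho> \<longleftrightarrow> alt M k True (fun_of d) []"
      unfolding sigma_def by (subst sat_alternate[OF good]) simp_all
    then show "sat (((?S \<cdot> ?f \<doteq> \<zero> \<^bold>\<or> ?S \<cdot> ?f \<doteq> \<one>) \<^bold>\<and> (?S \<cdot> ?f \<doteq> \<zero> \<^bold>\<longleftrightarrow> sigma k ?f)) (Suc (Suc 0))) ?\<rho>"
      unfolding sat_connectives using sat_prime(1)[OF v, of \<zero> 0] sat_prime(1)[OF v, of \<one> 1]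
      by (simp add: ev_num)
  qed
qed

theorem sat_Z2\<omega>: "A \<in> Z2\<omega> \<Longrightarrow> good \<rho> \<Longrightarrow> sat A \<rho>"
  unfolding Z2\<omega>_def Pi11_CA0\<omega>_def
proof (elim UN_E insertE)
  fix k assume "A = S_exists k" "good \<rho>"
  then show ?thesis using sat_S_exists by simp
next
  assume "A \<in> RCA0\<omega>" and good: "good \<rho>"
  then show ?thesis
  proof cases
    case (basic F)
    then show ?thesis using sat_basic good by blast
  next
    case (qf_induction A n i)
    then show ?thesis using sat_qf_induction good by blast
  next
    case (qf_ac_10 A f i n j Y l)
    then show ?thesis using sat_qf_ac good by blast
  qed (use good sat_comb_K sat_comb_S sat_extensionality sat_rec_zero sat_rec_succ in blast)+
qed

text \<open>The induction keeps the assignment arbitrary, since generalisation may bind a variable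
  that is free in the axioms used.\<close>

theorem soundness: "Z2\<omega> \<turnstile> A \<Longrightarrow> good \<rho> \<Longrightarrow> sat A \<rho>"
proof (induction arbitrary: \<rho> rule: provable.induct)
  case (axiom A)
  then show ?case by (rule sat_Z2\<omega>)
next
  case (all_inst A t x)
  have "sat (subst x t A) \<rho> \<longleftrightarrow> sat A (\<rho>(x := den \<rho> t))" by (rule sat_subst[OF all_inst.hyps(3)])
  moreover have "dom_at (snd x) (den \<rho> t)" by (rule dom_den[OF all_inst.prems all_inst.hyps(2)])
  ultimately show ?case by (simp only: sat.simps) blast
next
  case (all_imp A B x)
  have "sat A (\<rho>(x := d)) \<longleftrightarrow> sat A \<rho>" for d using all_imp.hyps(3) by (intro sat_cong) auto
  then show ?case by (simp only: sat.simps) blast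
next
  case (mp A B)
  then show ?case by simp
next
  case (gen A x)
  then show ?case using good_upd by (simp only: sat.simps) blast
qed simp_all

end

section \<open>Coded reals\<close>

text \<open>The value lies between the square of \<open>a + b\<close> and the next square, so it
  determines \<open>a + b\<close>, and the remainder is \<open>a\<close>.\<close>

lemma pairN_inj: "pairN a b = pairN c d \<longleftrightarrow> a = c \<and> b = d"
proof
  assume eq: "pairN a b = pairN c d"
  have less: "pairN a b < pairN c d" if "a + b < c + d" for a b c d
  proof -
    have "pairN a b < Suc (a + b) * Suc (a + b)" by (simp add: pairN_def algebra_simps)
    also have "\<dots> \<le> (c + d) * (c + d)" using that by (intro mult_le_mono) simp_all
    also have "\<dots> \<le> pairN c d" by (simp add: pairN_def)
    finally show ?thesis .
  qed
  then have "a + b = c + d" using eq by (metis less_irrefl nat_neq_iff)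
  then show "a = c \<and> b = d" using eq by (simp add: pairN_def)
qed simp

definition rat_code :: "nat \<Rightarrow> real \<Rightarrow> bool" where
  "rat_code c q \<longleftrightarrow> (\<exists>a b d. c = pairN (pairN a b) d \<and> q = (real a - real b) / real (d + 1))"

lemma rat_code_unique: "rat_code c q \<Longrightarrow> rat_code c q' \<Longrightarrow> q = q'"
  by (auto simp: rat_code_def pairN_inj)

lemma rat_code_exists: assumes "q \<in> \<rat>" shows "\<exists>c. rat_code c q"
proof -
  obtain i n where in': "q = of_int i / of_nat n" "0 < n"
    using assms by (metis Rats_cases' of_nat_0_less_iff of_int_of_nat_eq zero_less_imp_eq_int)
  \<comment> \<open>The numerator is split into its positive and negative parts; the code stores the
    denominator minus 1.\<close>
  have "q = (real (nat i) - real (nat (- i))) / real (n - 1 + 1)" using in' by simp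
  then show ?thesis unfolding rat_code_def by blast
qed

section \<open>Fast approximations of real numbers\<close>

definition approx :: "(nat \<Rightarrow> real) \<Rightarrow> real \<Rightarrow> bool" where
  "approx q x \<longleftrightarrow> (\<forall>n. \<bar>q n - x\<bar> \<le> 1 / 2 ^ n)"

definition code_real :: "(nat \<Rightarrow> nat) \<Rightarrow> real \<Rightarrow> bool" where
  "code_real f x \<longleftrightarrow> (\<exists>q. (\<forall>n. rat_code (f n) (q n)) \<and> (\<forall>n i. \<bar>q n - q (n + i)\<bar> < 1 / 2 ^ n) \<and> approx q x)"

lemma approx_small:
  assumes "0 < e" shows "\<exists>n. 1 / 2 ^ n < (e::real)"
  using real_arch_pow_inv[of e "1/2"] assms by (auto simp: power_one_over)

lemma approx_le:
  assumes "approx q x" "approx r y" "\<And>n. q n \<le> r n + 2 / 2 ^ n" shows "x \<le> y"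
proof (rule ccontr)
  assume "\<not> x \<le> y"
  \<comment> \<open>Two approximation errors and the tolerance \<open>2 / 2 ^ n\<close> add up to
    four units of \<open>1 / 2 ^ n\<close>.\<close>
  then obtain n where n: "1 / 2 ^ n < (x - y) / 4" using approx_small[of "(x - y) / 4"] by auto
  have "x \<le> q n + 1 / 2 ^ n" "r n \<le> y + 1 / 2 ^ n"
    using assms(1,2) unfolding approx_def by (smt (verit))+
  then show False using assms(3)[of n] n by (simp add: field_simps)
qed

lemma approx_unique: "approx q x \<Longrightarrow> approx q y \<Longrightarrow> x = y"
  by (rule antisym) (rule approx_le[of q _ q], simp_all)+

lemma approx_less:
  assumes "approx q x" "approx r y" shows "(\<exists>n. q n + 2 / 2 ^ n < r n) \<longleftrightarrow> x < y"
proof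
  assume "\<exists>n. q n + 2 / 2 ^ n < r n"
  then obtain n where n: "q n + 2 / 2 ^ n < r n" ..
  have "x \<le> q n + 1 / 2 ^ n" "r n \<le> y + 1 / 2 ^ n"
    using assms unfolding approx_def by (smt (verit))+
  moreover have "2 / 2 ^ n = 2 * (1 / 2 ^ n :: real)" by simp
  ultimately show "x < y" using n by linarith
next
  assume "x < y"
  then show "\<exists>n. q n + 2 / 2 ^ n < r n"
    using approx_le[OF assms(2,1)] by (meson not_le)
qed

lemma approx_eq:
  assumes "approx q x" "approx r y"
  shows "(\<forall>n. q n \<le> r n + 2 / 2 ^ n \<and> r n \<le> q n + 2 / 2 ^ n) \<longleftrightarrow> x = y"
proof
  assume "\<forall>n. q n \<le> r n + 2 / 2 ^ n \<and> r n \<le> q n + 2 / 2 ^ n"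
  then show "x = y" using approx_le[OF assms] approx_le[OF assms(2,1)] by (intro antisym) auto
next
  assume "x = y"
  have "q n \<le> x + 1 / 2 ^ n" "x \<le> q n + 1 / 2 ^ n" "r n \<le> x + 1 / 2 ^ n" "x \<le> r n + 1 / 2 ^ n" for n
    using assms \<open>x = y\<close> unfolding approx_def by (smt (verit))+
  then show "\<forall>n. q n \<le> r n + 2 / 2 ^ n \<and> r n \<le> q n + 2 / 2 ^ n"
    by (smt (verit) add_divide_distrib)
qed

text \<open>The shift of the index by one halves each of the two errors, so their sum stays within
  the bound.\<close>

lemma approx_add:
  assumes "approx q x" "approx r y" shows "approx (\<lambda>n. q (n + 1) + r (n + 1)) (x + y)"
  unfolding approx_def
proof
  fix n
  have "\<bar>q (n + 1) - x\<bar> \<le> 1 / 2 ^ n / 2" "\<bar>r (n + 1) - y\<bar> \<le> 1 / 2 ^ n / 2"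
    using assms unfolding approx_def by (metis power_add power_one_right divide_divide_eq_left)+
  moreover have "\<bar>a - x\<bar> \<le> e / 2 \<Longrightarrow> \<bar>b - y\<bar> \<le> e / 2 \<Longrightarrow> \<bar>a + b - (x + y)\<bar> \<le> e" for a b e :: real
    by (simp add: abs_if split: if_splits)
  ultimately show "\<bar>q (n + 1) + r (n + 1) - (x + y)\<bar> \<le> 1 / 2 ^ n" by blast
qed

lemma approx_neg: "approx q x \<Longrightarrow> approx (\<lambda>n. - q n) (- x)"
  unfolding approx_def by (smt (verit))

lemma approx_abs: "approx q x \<Longrightarrow> approx (\<lambda>n. \<bar>q n\<bar>) \<bar>x\<bar>"
  unfolding approx_def by (smt (verit))

lemma fast_Cauchy_approx:
  assumes "\<And>n i. \<bar>q n - q (n + i)\<bar> < 1 / 2 ^ n"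
  shows "\<exists>x. approx q x"
proof -
  have "Cauchy q"
  proof (rule metric_CauchyI)
    fix e :: real assume "0 < e"
    then obtain n where n: "1 / 2 ^ n < e / 2" using approx_small[of "e / 2"] by auto
    have "dist (q k) (q l) < e" if "n \<le> k" "n \<le> l" for k l
      using assms[of n "k - n"] assms[of n "l - n"] that n by (simp add: dist_real_def)
    then show "\<exists>K. \<forall>k\<ge>K. \<forall>l\<ge>K. dist (q k) (q l) < e" by blast
  qed
  then obtain x where x: "q \<longlonglongrightarrow> x" using Cauchy_convergent_iff convergent_def by blast
  have "\<bar>q n - x\<bar> \<le> 1 / 2 ^ n" for n
  proof (rule LIMSEQ_le_const2)
    show "(\<lambda>i. \<bar>q n - q (i + n)\<bar>) \<longlonglongrightarrow> \<bar>q n - x\<bar>"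
      using x by (intro tendsto_intros LIMSEQ_ignore_initial_segment)
    show "\<exists>N. \<forall>i\<ge>N. \<bar>q n - q (i + n)\<bar> \<le> 1 / 2 ^ n"
      using assms by (metis add.commute less_imp_le)
  qed
  then show ?thesis unfolding approx_def by blast
qed

lemma code_real_unique: "code_real f x \<Longrightarrow> code_real f y \<Longrightarrow> x = y"
  unfolding code_real_def by (metis approx_unique rat_code_unique ext)

lemma code_real_const: "rat_code c q \<Longrightarrow> code_real (\<lambda>_. c) q"
  unfolding code_real_def approx_def by (intro exI[of _ "\<lambda>_. q"]) simp

lemma code_real_exists:
  fixes x :: real
  shows "\<exists>f. code_real f x"
proof -
  \<comment> \<open>Rounding down with two extra binary digits leaves an error below a quarter of
    \<open>1 / 2 ^ n\<close>; this is ample for the strict inequality between any two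
    approximations.\<close>
  define q where "q n = of_int \<lfloor>x * 2 ^ (n + 2)\<rfloor> / (2 ^ (n + 2) :: real)" for n
  have "q n \<in> \<rat>" for n unfolding q_def by (intro Rats_divide Rats_power) simp_all
  then have "\<forall>n. \<exists>c. rat_code c (q n)" using rat_code_exists by blast
  then obtain f where f: "\<And>n. rat_code (f n) (q n)" by (auto dest!: choice)
  have q: "q n \<le> x" "x - q n < 1 / 2 ^ n / 4" for n
  proof -
    define p m where "p = (2 ^ (n + 2) :: real)" and "m = (of_int \<lfloor>x * p\<rfloor> :: real)"
    have p: "0 < p" "1 / p = 1 / 2 ^ n / 4" and m: "m \<le> x * p" "x * p < m + 1" and qn: "q n = m / p"
      by (simp_all add: p_def m_def q_def power_add)
    show "q n \<le> x" using p m unfolding qn by (simp add: pos_divide_le_eq)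
    have "x < (m + 1) / p" using p m by (simp add: pos_less_divide_eq)
    then show "x - q n < 1 / 2 ^ n / 4" using p unfolding qn by (simp add: add_divide_distrib)
  qed
  have "\<bar>q n - q (n + i)\<bar> < 1 / 2 ^ n" for n i
  proof -
    have "0 < (1 / 2 ^ n :: real)" "1 / 2 ^ (n + i) \<le> (1 / 2 ^ n :: real)" by (simp_all add: field_simps)
    moreover have "\<bar>a - b\<bar> < e" if "a \<le> x" "x - a < e / 4" "b \<le> x" "x - b < e' / 4" "0 < e" "e' \<le> e"
      for a b e e' :: real using that by (simp add: abs_if)
    ultimately show ?thesis using q by blast
  qed
  moreover have "\<bar>q n - x\<bar> \<le> 1 / 2 ^ n" for n
  proof -
    have "0 < (1 / 2 ^ n :: real)" by simp
    moreover have "\<bar>a - x\<bar> \<le> e" if "a \<le> x" "x - a < e / 4" "0 < e" for a e :: real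
      using that by (simp add: abs_if)
    ultimately show ?thesis using q by blast
  qed
  ultimately have c: "code_real f x" unfolding code_real_def approx_def using f by blast
  show ?thesis by (rule exI[of _ f], rule c)
qed

section \<open>The meaning of the formulas about reals\<close>

context seq_model
begin

text \<open>A formula at depth \<open>n\<close> is evaluated at a pair \<open>(n, \<rho>)\<close>, only the variables of index below \<open>n\<close>
  being in use; passing a quantifier leads to an extension of the pair.\<close>

definition extends :: "nat \<Rightarrow> env \<Rightarrow> nat \<Rightarrow> env \<Rightarrow> bool" where
  "extends n \<rho> n' \<rho>' \<longleftrightarrow> n \<le> n' \<and> good \<rho>' \<and> (\<forall>x. fst x < n \<longrightarrow> \<rho>' x = \<rho> x)"

lemma extends_refl: "good \<rho> \<Longrightarrow> extends n \<rho> n \<rho>"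
  by (simp add: extends_def)

lemma extends_trans: "extends n \<rho> n' \<rho>' \<Longrightarrow> extends n' \<rho>' n'' \<rho>'' \<Longrightarrow> extends n \<rho> n'' \<rho>''"
  by (auto simp: extends_def)

lemma extends_good: "extends n \<rho> n' \<rho>' \<Longrightarrow> good \<rho>'"
  by (simp add: extends_def)

lemma extends_upd: "good \<rho> \<Longrightarrow> dom_at \<tau> d \<Longrightarrow> extends n \<rho> (Suc n) (\<rho>((n, \<tau>) := d))"
  by (auto simp add: extends_def intro: good_upd simp del: rel.simps)

lemma extends_den:
  "extends n \<rho> n' \<rho>' \<Longrightarrow> below n t \<Longrightarrow> den \<rho>' t = den \<rho> t"
  by (rule den_cong) (auto simp: extends_def)

lemma extends_below: "extends n \<rho> n' \<rho>' \<Longrightarrow> below n t \<Longrightarrow> below n' t"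
  unfolding extends_def by force

section \<open>Denotations of numbers and rationals\<close>

definition num :: "nat \<Rightarrow> env \<Rightarrow> tm \<Rightarrow> nat \<Rightarrow> bool" where
  "num n \<rho> t v \<longleftrightarrow> below n t \<and> ev (den \<rho> t) v"

lemma num_mono: "extends n \<rho> n' \<rho>' \<Longrightarrow> num n \<rho> t v \<Longrightarrow> num n' \<rho>' t v"
  unfolding num_def using extends_den extends_below by metis

lemma num_bin: "num n \<rho> s a \<Longrightarrow> num n \<rho> t b \<Longrightarrow> num n \<rho> (s \<oplus> t) (a + b)"
  "num n \<rho> s a \<Longrightarrow> num n \<rho> t b \<Longrightarrow> num n \<rho> (s \<otimes> t) (a * b)"
  unfolding num_def by (simp_all add: ev_CBin_iff) blast+

lemma num_const: "num n \<rho> \<zero> 0" "num n \<rho> \<one> 1"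
  by (simp_all add: num_def ev_num ev_CNum_iff)

lemma num_pow2: "good \<rho> \<Longrightarrow> num n \<rho> t v \<Longrightarrow> num n \<rho> (pow2 t) (2 ^ v)"
  unfolding num_def by (simp add: vars_tm_pow2_fun ev_pow2)

lemma num_pair: "num n \<rho> s a \<Longrightarrow> num n \<rho> t b \<Longrightarrow> num n \<rho> (pair s t) (pairN a b)"
  unfolding num_def by (simp add: ev_pair) (simp add: pair_def)

lemma sat_num:
  "num n \<rho> s a \<Longrightarrow> num n \<rho> t b \<Longrightarrow> sat ((s \<doteq> t) n) \<rho> \<longleftrightarrow> a = b"
  "num n \<rho> s a \<Longrightarrow> num n \<rho> t b \<Longrightarrow> sat ((s \<prec> t) n) \<rho> \<longleftrightarrow> a < b"
  "num n \<rho> s a \<Longrightarrow> num n \<rho> t b \<Longrightarrow> sat ((s \<preceq> t) n) \<rho> \<longleftrightarrow> a \<le> b"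
  unfolding num_def leq_def sat_connectives using sat_prime by (auto simp: not_less)

lemma sat_ex_num:
  assumes "good \<rho>" and "\<And>\<rho>' m. extends n \<rho> (Suc n) \<rho>' \<Longrightarrow> num (Suc n) \<rho>' (Var (n, N)) m \<Longrightarrow>
    sat (F (Var (n, N)) (Suc n)) \<rho>' \<longleftrightarrow> P m"
  shows "sat (ex N F n) \<rho> \<longleftrightarrow> (\<exists>m. P m)"
proof -
  have "sat (F (Var (n, N)) (Suc n)) (\<rho>((n, N) := d)) \<longleftrightarrow> P m" if "ev d m" for d m
    using that dom_at_N by (intro assms(2) extends_upd assms(1)) (auto simp: num_def)
  then show ?thesis unfolding sat_exists dom_at_N using ev_num by blast
qed

lemma sat_all_num:
  assumes "good \<rho>" and "\<And>\<rho>' m. extends n \<rho> (Suc n) \<rho>' \<Longrightarrow> num (Suc n) \<rho>' (Var (n, N)) m \<Longrightarrow>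
    sat (F (Var (n, N)) (Suc n)) \<rho>' \<longleftrightarrow> P m"
  shows "sat (all N F n) \<rho> \<longleftrightarrow> (\<forall>m. P m)"
proof -
  have "sat (F (Var (n, N)) (Suc n)) (\<rho>((n, N) := d)) \<longleftrightarrow> P m" if "ev d m" for d m
    using that dom_at_N by (intro assms(2) extends_upd assms(1)) (auto simp: num_def)
  then show ?thesis unfolding sat_forall dom_at_N using ev_num by blast
qed

lemma sat_iffs:
  "(sat (F n) \<rho> \<longleftrightarrow> P) \<Longrightarrow> sat ((\<^bold>\<not> F) n) \<rho> \<longleftrightarrow> \<not> P"
  "(sat (F n) \<rho> \<longleftrightarrow> P) \<Longrightarrow> (sat (G n) \<rho> \<longleftrightarrow> Q) \<Longrightarrow> sat ((F \<^bold>\<and> G) n) \<rho> \<longleftrightarrow> P \<and> Q"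
  "(sat (F n) \<rho> \<longleftrightarrow> P) \<Longrightarrow> (sat (G n) \<rho> \<longleftrightarrow> Q) \<Longrightarrow> sat ((F \<^bold>\<or> G) n) \<rho> \<longleftrightarrow> P \<or> Q"
  "(sat (F n) \<rho> \<longleftrightarrow> P) \<Longrightarrow> (sat (G n) \<rho> \<longleftrightarrow> Q) \<Longrightarrow> sat ((F \<^bold>\<longrightarrow> G) n) \<rho> \<longleftrightarrow> (P \<longrightarrow> Q)"
  by (simp_all add: sat_connectives)

definition rat_den :: "nat \<Rightarrow> env \<Rightarrow> rat_tm \<Rightarrow> real \<Rightarrow> bool" where
  "rat_den n \<rho> r q \<longleftrightarrow> (\<exists>a b d x y z. r = (a, b, d) \<and> num n \<rho> a x \<and> num n \<rho> b y \<and> num n \<rho> d z \<and> 0 < z \<and>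
     q = (real x - real y) / real z)"

lemma rat_den_mono: "extends n \<rho> n' \<rho>' \<Longrightarrow> rat_den n \<rho> r q \<Longrightarrow> rat_den n' \<rho>' r q"
  unfolding rat_den_def using num_mono by metis

lemma rat_denI: "num n \<rho> a x \<Longrightarrow> num n \<rho> b y \<Longrightarrow> num n \<rho> d z \<Longrightarrow> 0 < z \<Longrightarrow>
    q = (real x - real y) / real z \<Longrightarrow> rat_den n \<rho> (a, b, d) q"
  unfolding rat_den_def by blast

lemma rat_den_add: "rat_den n \<rho> r q \<Longrightarrow> rat_den n \<rho> r' q' \<Longrightarrow> rat_den n \<rho> (rat_add r r') (q + q')"
  apply (unfold rat_den_def[of _ _ r] rat_den_def[of _ _ r'], elim exE conjE, hypsubst, unfold rat_add.simps)
  apply (rule rat_denI)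
      apply ((rule num_bin | assumption)+)[3]
  by (simp_all add: field_simps)

lemma rat_den_neg: "rat_den n \<rho> r q \<Longrightarrow> rat_den n \<rho> (rat_neg r) (- q)"
  apply (unfold rat_den_def[of _ _ r], elim exE conjE, hypsubst, unfold rat_neg.simps)
  by (rule rat_denI) (assumption | simp add: field_simps)+

lemma sat_rat_less:
  assumes "rat_den n \<rho> r q" "rat_den n \<rho> r' q'"
  shows "sat (rat_less r r' n) \<rho> \<longleftrightarrow> q < q'"
proof -
  from assms obtain a b d x y z a' b' d' x' y' z' where
    r: "r = (a, b, d)" "num n \<rho> a x" "num n \<rho> b y" "num n \<rho> d z" "0 < z" "q = (real x - real y) / real z"
    and r': "r' = (a', b', d')" "num n \<rho> a' x'" "num n \<rho> b' y'" "num n \<rho> d' z'" "0 < z'"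
      "q' = (real x' - real y') / real z'"
    unfolding rat_den_def by blast
  have "sat (rat_less r r' n) \<rho> \<longleftrightarrow> x * z' + y' * z < x' * z + y * z'"
    unfolding r(1) r'(1) rat_less.simps
    by (intro sat_num num_bin r r')
  also have "\<dots> \<longleftrightarrow> real x * real z' + real y' * real z < real x' * real z + real y * real z'"
    by (simp only: of_nat_less_iff[where 'a = real, symmetric] of_nat_add of_nat_mult)
  also have "\<dots> \<longleftrightarrow> q < q'" using r(5,6) r'(5,6)
    by (simp add: frac_less_eq divide_less_0_iff mult_less_0_iff zero_less_mult_iff algebra_simps)
  finally show ?thesis .
qed

lemma sat_rat_leq:
  "rat_den n \<rho> r q \<Longrightarrow> rat_den n \<rho> r' q' \<Longrightarrow> sat (rat_leq r r' n) \<rho> \<longleftrightarrow> q \<le> q'"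
  unfolding rat_leq_def sat_connectives by (simp add: sat_rat_less not_less)

lemma rat_den_const:
  "rat_den n \<rho> rat_zero 0" "rat_den n \<rho> rat_one 1"
  unfolding rat_zero_def rat_one_def by (rule rat_denI num_const | simp)+

lemma rat_den_eps:
  "good \<rho> \<Longrightarrow> num n \<rho> k v \<Longrightarrow> rat_den n \<rho> (rat_eps k) (1 / 2 ^ v)"
  "good \<rho> \<Longrightarrow> num n \<rho> k v \<Longrightarrow> rat_den n \<rho> (rat_2eps k) (2 / 2 ^ v)"
  unfolding rat_eps_def rat_2eps_def
  by (rule rat_denI num_const num_pow2 num_bin | assumption | simp)+

text \<open>The continuation is evaluated below three further quantifiers, hence the hypothesis on
  \<open>K\<close> ranges over all extensions of \<open>(n, \<rho>)\<close>.\<close>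

lemma sat_decode_rat:
  assumes "good \<rho>" "num n \<rho> t c"
    and K: "\<And>n' \<rho>' r q. extends n \<rho> n' \<rho>' \<Longrightarrow> rat_code c q \<Longrightarrow> rat_den n' \<rho>' r q \<Longrightarrow> sat (K r n') \<rho>' \<longleftrightarrow> P q"
  shows "sat (decode_rat t K n) \<rho> \<longleftrightarrow> (\<exists>q. rat_code c q \<and> P q)"
proof -
  have "sat (decode_rat t K n) \<rho> \<longleftrightarrow>
      (\<exists>a b d. c = pairN (pairN a b) d \<and> P ((real a - real b) / real (d + 1)))"
    unfolding decode_rat_def
  proof (rule sat_ex_num[OF assms(1)], rule sat_ex_num, erule extends_good, rule sat_ex_num, erule extends_good)
    fix \<rho>1 a \<rho>2 b \<rho>3 d
    assume e1: "extends n \<rho> (Suc n) \<rho>1" and a: "num (Suc n) \<rho>1 (Var (n, N)) a"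
      and e2: "extends (Suc n) \<rho>1 (Suc (Suc n)) \<rho>2" and b: "num (Suc (Suc n)) \<rho>2 (Var (Suc n, N)) b"
      and e3: "extends (Suc (Suc n)) \<rho>2 (Suc (Suc (Suc n))) \<rho>3"
      and d: "num (Suc (Suc (Suc n))) \<rho>3 (Var (Suc (Suc n), N)) d"
    have e: "extends n \<rho> (Suc (Suc (Suc n))) \<rho>3" using e1 e2 e3 extends_trans by blast
    let ?n = "Suc (Suc (Suc n))"
    have a: "num ?n \<rho>3 (Var (n, N)) a" using num_mono[OF e3 num_mono[OF e2 a]] .
    have b: "num ?n \<rho>3 (Var (Suc n, N)) b" using num_mono[OF e3 b] .
    have "rat_den ?n \<rho>3 (Var (n, N), Var (Suc n, N), Var (Suc (Suc n), N) \<oplus> \<one>) ((real a - real b) / real (d + 1))"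
      by (rule rat_denI[OF a b num_bin(1)[OF d num_const(2)]]) simp_all
    moreover have "sat ((t \<doteq> pair (pair (Var (n, N)) (Var (Suc n, N))) (Var (Suc (Suc n), N))) ?n) \<rho>3 \<longleftrightarrow>
        c = pairN (pairN a b) d"
      by (rule sat_num[OF num_mono[OF e assms(2)]]) (intro num_pair a b d)
    moreover have "rat_code c ((real a - real b) / real (d + 1))" if "c = pairN (pairN a b) d"
      using that rat_code_def by blast
    ultimately show "sat ((t \<doteq> pair (pair (Var (n, N)) (Var (Suc n, N))) (Var (Suc (Suc n), N)) \<^bold>\<and>
         K (Var (n, N), Var (Suc n, N), Var (Suc (Suc n), N) \<oplus> \<one>)) ?n) \<rho>3 \<longleftrightarrow>
       c = pairN (pairN a b) d \<and> P ((real a - real b) / real (d + 1))"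
      unfolding sat_connectives using K[OF e] by blast
  qed
  then show ?thesis unfolding rat_code_def by blast
qed

text \<open>Real expressions are written in continuation-passing style, so what their approximations are is
  expressed by quantifying over the continuations \<open>K\<close>.\<close>

definition seq_den :: "nat \<Rightarrow> env \<Rightarrow> real_ex \<Rightarrow> (nat \<Rightarrow> real) \<Rightarrow> bool" where
  "seq_den n \<rho> X q \<longleftrightarrow> (\<forall>n' \<rho>' k v K P. extends n \<rho> n' \<rho>' \<longrightarrow> num n' \<rho>' k v \<longrightarrow>
     (\<forall>n'' \<rho>'' r. extends n' \<rho>' n'' \<rho>'' \<longrightarrow> rat_den n'' \<rho>'' r (q v) \<longrightarrow> (sat (K r n'') \<rho>'' \<longleftrightarrow> P)) \<longrightarrow>
     (sat (X k K n') \<rho>' \<longleftrightarrow> P))"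

lemma seq_denI:
  assumes "\<And>n' \<rho>' k v K P. extends n \<rho> n' \<rho>' \<Longrightarrow> good \<rho>' \<Longrightarrow> num n' \<rho>' k v \<Longrightarrow>
     (\<And>n'' \<rho>'' r. extends n' \<rho>' n'' \<rho>'' \<Longrightarrow> rat_den n'' \<rho>'' r (q v) \<Longrightarrow> sat (K r n'') \<rho>'' \<longleftrightarrow> P) \<Longrightarrow>
     sat (X k K n') \<rho>' \<longleftrightarrow> P"
  shows "seq_den n \<rho> X q"
  unfolding seq_den_def
proof (intro allI impI)
  fix n' \<rho>' k v K P
  assume e: "extends n \<rho> n' \<rho>'" and k: "num n' \<rho>' k v"
    and K: "\<forall>n'' \<rho>'' r. extends n' \<rho>' n'' \<rho>'' \<longrightarrow> rat_den n'' \<rho>'' r (q v) \<longrightarrow> (sat (K r n'') \<rho>'' \<longleftrightarrow> P)"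
  show "sat (X k K n') \<rho>' \<longleftrightarrow> P"
    by (rule assms[OF e extends_good[OF e] k]) (rule K[rule_format])
qed

lemma seq_denD:
  assumes "seq_den n \<rho> X q" "extends n \<rho> n' \<rho>'" "num n' \<rho>' k v"
    "\<And>n'' \<rho>'' r. extends n' \<rho>' n'' \<rho>'' \<Longrightarrow> good \<rho>'' \<Longrightarrow> rat_den n'' \<rho>'' r (q v) \<Longrightarrow> sat (K r n'') \<rho>'' \<longleftrightarrow> P"
  shows "sat (X k K n') \<rho>' \<longleftrightarrow> P"
  by (rule assms(1)[unfolded seq_den_def, rule_format, OF assms(2,3)])
    (rule assms(4), assumption, erule extends_good)

lemma seq_den_mono:
  assumes "extends n \<rho> n' \<rho>'" "seq_den n \<rho> X q" shows "seq_den n' \<rho>' X q"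
  by (rule seq_denI, rule seq_denD[OF assms(2) extends_trans[OF assms(1)]])

lemma seq_den_const: assumes "rat_den n \<rho> r q" shows "seq_den n \<rho> (real_const r) (\<lambda>_. q)"
  unfolding real_const_def
proof (rule seq_denI)
  fix n' \<rho>' K P
  assume e: "extends n \<rho> n' \<rho>'" "good \<rho>'"
    and K: "\<And>n'' \<rho>'' r. extends n' \<rho>' n'' \<rho>'' \<Longrightarrow> rat_den n'' \<rho>'' r q \<Longrightarrow> sat (K r n'') \<rho>'' \<longleftrightarrow> P"
  show "sat (K r n') \<rho>' \<longleftrightarrow> P" by (rule K[OF extends_refl[OF e(2)] rat_den_mono[OF e(1) assms]])
qed

lemma seq_den_add:
  assumes "seq_den n \<rho> X q" "seq_den n \<rho> Y q'"
  shows "seq_den n \<rho> (real_add X Y) (\<lambda>v. q (v + 1) + q' (v + 1))"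
  unfolding real_add_def
proof (rule seq_denI, rule seq_denD[OF assms(1)], assumption, rule num_bin, assumption, rule num_const,
    rule seq_denD[OF assms(2)])
  fix n1 \<rho>1 k v K P n2 \<rho>2 r n3 \<rho>3 s
  assume 1: "extends n \<rho> n1 \<rho>1" "num n1 \<rho>1 k v" and 2: "extends n1 \<rho>1 n2 \<rho>2" "rat_den n2 \<rho>2 r (q (v + 1))"
    and K: "\<And>n'' \<rho>'' r. extends n1 \<rho>1 n'' \<rho>'' \<Longrightarrow> rat_den n'' \<rho>'' r (q (v + 1) + q' (v + 1)) \<Longrightarrow>
      sat (K r n'') \<rho>'' \<longleftrightarrow> P"
  show "extends n \<rho> n2 \<rho>2" using 1 2 extends_trans by blast
  show "num n2 \<rho>2 (k \<oplus> \<one>) (v + 1)" by (rule num_bin num_mono[OF 2(1)] 1 num_const)+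
  assume 3: "extends n2 \<rho>2 n3 \<rho>3" "rat_den n3 \<rho>3 s (q' (v + 1))"
  show "sat (K (rat_add r s) n3) \<rho>3 \<longleftrightarrow> P"
    by (rule K[OF extends_trans[OF 2(1) 3(1)] rat_den_add[OF rat_den_mono[OF 3(1) 2(2)] 3(2)]])
qed

lemma seq_den_neg:
  assumes "seq_den n \<rho> X q" shows "seq_den n \<rho> (real_neg X) (\<lambda>v. - q v)"
  unfolding real_neg_def
proof (rule seq_denI, rule seq_denD[OF assms], assumption, assumption)
  fix n1 \<rho>1 v K P n2 \<rho>2 r
  assume 2: "extends n1 \<rho>1 n2 \<rho>2" "rat_den n2 \<rho>2 r (q v)"
    and K: "\<And>n'' \<rho>'' r. extends n1 \<rho>1 n'' \<rho>'' \<Longrightarrow> rat_den n'' \<rho>'' r (- q v) \<Longrightarrow> sat (K r n'') \<rho>'' \<longleftrightarrow> P"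
  show "sat (K (rat_neg r) n2) \<rho>2 \<longleftrightarrow> P" by (rule K[OF 2(1) rat_den_neg[OF 2(2)]])
qed

lemma seq_den_abs:
  assumes "seq_den n \<rho> X q" shows "seq_den n \<rho> (real_abs X) (\<lambda>v. \<bar>q v\<bar>)"
  unfolding real_abs_def
proof (rule seq_denI, rule seq_denD[OF assms], assumption, assumption)
  fix n1 \<rho>1 v K P n2 \<rho>2 r
  assume 2: "extends n1 \<rho>1 n2 \<rho>2" "rat_den n2 \<rho>2 r (q v)"
    and K: "\<And>n'' \<rho>'' r. extends n1 \<rho>1 n'' \<rho>'' \<Longrightarrow> rat_den n'' \<rho>'' r \<bar>q v\<bar> \<Longrightarrow> sat (K r n'') \<rho>'' \<longleftrightarrow> P"
  show "sat ((rat_leq rat_zero r \<^bold>\<and> K r \<^bold>\<or> rat_less r rat_zero \<^bold>\<and> K (rat_neg r)) n2) \<rho>2 \<longleftrightarrow> P"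
    unfolding sat_connectives sat_rat_less[OF 2(2) rat_den_const(1)] sat_rat_leq[OF rat_den_const(1) 2(2)]
    using K[OF 2(1), of r] K[OF 2(1) , of "rat_neg r"] 2(2) rat_den_neg[OF 2(2)]
    by (cases "0 \<le> q v") (simp_all add: not_le)
qed

section \<open>Denotations of real expressions\<close>

definition real_den :: "nat \<Rightarrow> env \<Rightarrow> real_ex \<Rightarrow> real \<Rightarrow> bool" where
  "real_den n \<rho> X x \<longleftrightarrow> (\<exists>q. seq_den n \<rho> X q \<and> approx q x)"

lemma real_den_mono: "extends n \<rho> n' \<rho>' \<Longrightarrow> real_den n \<rho> X x \<Longrightarrow> real_den n' \<rho>' X x"
  unfolding real_den_def by (elim exE conjE, intro exI conjI, rule seq_den_mono)

lemma real_den_const: "rat_den n \<rho> r q \<Longrightarrow> real_den n \<rho> (real_const r) q"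
  unfolding real_den_def approx_def by (intro exI conjI, erule seq_den_const) simp

lemma real_den_add: "real_den n \<rho> X x \<Longrightarrow> real_den n \<rho> Y y \<Longrightarrow> real_den n \<rho> (real_add X Y) (x + y)"
  unfolding real_den_def by (elim exE conjE, intro exI conjI, rule seq_den_add, assumption+, rule approx_add)

lemma real_den_dist: "real_den n \<rho> X x \<Longrightarrow> real_den n \<rho> Y y \<Longrightarrow> real_den n \<rho> (real_dist X Y) \<bar>x - y\<bar>"
  unfolding real_den_def real_dist_def diff_conv_add_uminus
  by (elim exE conjE, intro exI conjI, rule seq_den_abs[OF seq_den_add[OF _ seq_den_neg]], assumption+,
      rule approx_abs[OF approx_add[OF _ approx_neg]])

lemma sat_real_less:
  assumes "good \<rho>" "real_den n \<rho> X x" "real_den n \<rho> Y y"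
  shows "sat (real_less X Y n) \<rho> \<longleftrightarrow> x < y"
proof -
  obtain q r where q: "seq_den n \<rho> X q" "approx q x" and r: "seq_den n \<rho> Y r" "approx r y"
    using assms unfolding real_den_def by blast
  have "sat (real_less X Y n) \<rho> \<longleftrightarrow> (\<exists>v. q v + 2 / 2 ^ v < r v)"
    unfolding real_less_def
  proof (rule sat_ex_num[OF assms(1)], rule seq_denD[OF q(1)], assumption, assumption, rule seq_denD[OF r(1)])
    fix \<rho>1 v n2 \<rho>2 a n3 \<rho>3 b
    assume 1: "extends n \<rho> (Suc n) \<rho>1" "num (Suc n) \<rho>1 (Var (n, N)) v"
      and 2: "extends (Suc n) \<rho>1 n2 \<rho>2" "rat_den n2 \<rho>2 a (q v)"
    show "extends n \<rho> n2 \<rho>2" using 1 2 extends_trans by blast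
    show "num n2 \<rho>2 (Var (n, N)) v" by (rule num_mono[OF 2(1) 1(2)])
    assume 3: "extends n2 \<rho>2 n3 \<rho>3" "good \<rho>3" "rat_den n3 \<rho>3 b (r v)"
    show "sat (rat_less (rat_add a (rat_2eps (Var (n, N)))) b n3) \<rho>3 \<longleftrightarrow> q v + 2 / 2 ^ v < r v"
      by (intro sat_rat_less rat_den_add 3 rat_den_eps rat_den_mono[OF 3(1) 2(2)]
          num_mono[OF extends_trans[OF 2(1) 3(1)] 1(2)])
  qed
  then show ?thesis using approx_less[OF q(2) r(2)] by simp
qed

lemma sat_real_leq:
  "good \<rho> \<Longrightarrow> real_den n \<rho> X x \<Longrightarrow> real_den n \<rho> Y y \<Longrightarrow> sat (real_leq X Y n) \<rho> \<longleftrightarrow> x \<le> y"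
  unfolding real_leq_def sat_connectives by (simp add: sat_real_less not_less)

lemma sat_real_eq:
  assumes "good \<rho>" "real_den n \<rho> X x" "real_den n \<rho> Y y"
  shows "sat (real_eq X Y n) \<rho> \<longleftrightarrow> x = y"
proof -
  obtain q r where q: "seq_den n \<rho> X q" "approx q x" and r: "seq_den n \<rho> Y r" "approx r y"
    using assms unfolding real_den_def by blast
  have "sat (real_eq X Y n) \<rho> \<longleftrightarrow> (\<forall>v. q v \<le> r v + 2 / 2 ^ v \<and> r v \<le> q v + 2 / 2 ^ v)"
    unfolding real_eq_def
  proof (rule sat_all_num[OF assms(1)], rule seq_denD[OF q(1)], assumption, assumption, rule seq_denD[OF r(1)])
    fix \<rho>1 v n2 \<rho>2 a n3 \<rho>3 b
    assume 1: "extends n \<rho> (Suc n) \<rho>1" "num (Suc n) \<rho>1 (Var (n, N)) v"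
      and 2: "extends (Suc n) \<rho>1 n2 \<rho>2" "rat_den n2 \<rho>2 a (q v)"
    show "extends n \<rho> n2 \<rho>2" using 1 2 extends_trans by blast
    show "num n2 \<rho>2 (Var (n, N)) v" by (rule num_mono[OF 2(1) 1(2)])
    assume 3: "extends n2 \<rho>2 n3 \<rho>3" "good \<rho>3" "rat_den n3 \<rho>3 b (r v)"
    show "sat ((rat_leq a (rat_add b (rat_2eps (Var (n, N)))) \<^bold>\<and>
        rat_leq b (rat_add a (rat_2eps (Var (n, N))))) n3) \<rho>3 \<longleftrightarrow> q v \<le> r v + 2 / 2 ^ v \<and> r v \<le> q v + 2 / 2 ^ v"
      by (intro sat_iffs sat_rat_leq rat_den_add 3 rat_den_eps rat_den_mono[OF 3(1) 2(2)]
          num_mono[OF extends_trans[OF 2(1) 3(1)] 1(2)])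
  qed
  then show ?thesis using approx_eq[OF q(2) r(2)] by simp
qed

definition fun_den :: "nat \<Rightarrow> env \<Rightarrow> tm \<Rightarrow> (nat \<Rightarrow> nat) \<Rightarrow> bool" where
  "fun_den n \<rho> t f \<longleftrightarrow> below n t \<and> dom_at ty1 (den \<rho> t) \<and> fun_of (den \<rho> t) = f"

lemma fun_den_mono: "extends n \<rho> n' \<rho>' \<Longrightarrow> fun_den n \<rho> t f \<Longrightarrow> fun_den n' \<rho>' t f"
  unfolding fun_den_def using extends_den extends_below by metis

lemma fun_den_num: "fun_den n \<rho> x f \<Longrightarrow> num n \<rho> k v \<Longrightarrow> num n \<rho> (x \<cdot> k) (f v)"
  unfolding fun_den_def num_def using ev_fun_of by (auto simp del: rel.simps)

lemma sat_R:
  assumes "good \<rho>" "fun_den n \<rho> x f" "num n \<rho> k v"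
    and "\<And>n' \<rho>' r q. extends n \<rho> n' \<rho>' \<Longrightarrow> rat_code (f v) q \<Longrightarrow> rat_den n' \<rho>' r q \<Longrightarrow> sat (K r n') \<rho>' \<longleftrightarrow> P q"
  shows "sat (R x k K n) \<rho> \<longleftrightarrow> (\<exists>q. rat_code (f v) q \<and> P q)"
  unfolding R_def by (rule sat_decode_rat[OF assms(1) fun_den_num[OF assms(2,3)] assms(4)])

text \<open>Decoding quantifies existentially over rationals; since a code determines its rational,
  the continuation can only receive the prescribed approximation.\<close>

lemma real_den_R:
  assumes f: "fun_den n \<rho> x f" and x: "code_real f y"
  shows "real_den n \<rho> (R x) y"
proof -
  obtain q where q: "\<And>v. rat_code (f v) (q v)" "approx q y" using x unfolding code_real_def by blast
  have "seq_den n \<rho> (R x) q"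
  proof (rule seq_denI)
    fix n' \<rho>' k v K P
    assume e: "extends n \<rho> n' \<rho>'" "good \<rho>'" and k: "num n' \<rho>' k v"
      and K: "\<And>n'' \<rho>'' r. extends n' \<rho>' n'' \<rho>'' \<Longrightarrow> rat_den n'' \<rho>'' r (q v) \<Longrightarrow> sat (K r n'') \<rho>'' \<longleftrightarrow> P"
    have "sat (R x k K n') \<rho>' \<longleftrightarrow> (\<exists>p. rat_code (f v) p \<and> P)"
      by (rule sat_R[OF e(2) fun_den_mono[OF e(1) f] k]) (use K rat_code_unique[OF q(1)] in metis)
    then show "sat (R x k K n') \<rho>' \<longleftrightarrow> P" using q(1) by blast
  qed
  then show ?thesis unfolding real_den_def using q(2) by blast
qed

text \<open>The formula only asserts the Cauchy bounds between decoded rationals. The limit comes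
  from completeness of the real line of the metatheory, so the reals of the model are genuine
  reals.\<close>

lemma sat_is_real:
  assumes "good \<rho>" and f: "fun_den n \<rho> x f"
  shows "sat (is_real x n) \<rho> \<longleftrightarrow> (\<exists>y. code_real f y)"
proof -
  have "sat (is_real x n) \<rho> \<longleftrightarrow> (\<forall>v i. \<exists>q. rat_code (f v) q \<and> (\<exists>r. rat_code (f (v + i)) r \<and>
      q < r + 1 / 2 ^ v \<and> r < q + 1 / 2 ^ v))"
    unfolding is_real_def
  proof (rule sat_all_num[OF assms(1)], rule sat_all_num, erule extends_good)
    fix \<rho>1 v \<rho>2 i
    assume 1: "extends n \<rho> (Suc n) \<rho>1" "num (Suc n) \<rho>1 (Var (n, N)) v"
      and 2: "extends (Suc n) \<rho>1 (Suc (Suc n)) \<rho>2" "num (Suc (Suc n)) \<rho>2 (Var (Suc n, N)) i"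
    let ?n2 = "Suc (Suc n)"
    have f2: "fun_den ?n2 \<rho>2 x f" by (rule fun_den_mono[OF extends_trans[OF 1(1) 2(1)] f])
    have v2: "num ?n2 \<rho>2 (Var (n, N)) v" by (rule num_mono[OF 2(1) 1(2)])
    show "sat (R x (Var (n, N)) (\<lambda>q. R x (Var (n, N) \<oplus> Var (Suc n, N)) (\<lambda>r.
        rat_less q (rat_add r (rat_eps (Var (n, N)))) \<^bold>\<and> rat_less r (rat_add q (rat_eps (Var (n, N)))))) ?n2) \<rho>2 \<longleftrightarrow>
      (\<exists>q. rat_code (f v) q \<and> (\<exists>r. rat_code (f (v + i)) r \<and> q < r + 1 / 2 ^ v \<and> r < q + 1 / 2 ^ v))"
    proof (rule sat_R[OF extends_good[OF 2(1)] f2 v2])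
      fix n3 \<rho>3 a q
      assume 3: "extends ?n2 \<rho>2 n3 \<rho>3" "rat_den n3 \<rho>3 a q"
      show "sat (R x (Var (n, N) \<oplus> Var (Suc n, N)) (\<lambda>r. rat_less a (rat_add r (rat_eps (Var (n, N)))) \<^bold>\<and>
          rat_less r (rat_add a (rat_eps (Var (n, N))))) n3) \<rho>3 \<longleftrightarrow>
        (\<exists>r. rat_code (f (v + i)) r \<and> q < r + 1 / 2 ^ v \<and> r < q + 1 / 2 ^ v)"
      proof (rule sat_R[OF extends_good[OF 3(1)] fun_den_mono[OF 3(1) f2]])
        show "num n3 \<rho>3 (Var (n, N) \<oplus> Var (Suc n, N)) (v + i)"
          by (intro num_bin num_mono[OF 3(1)] v2 2)
        fix n4 \<rho>4 b r
        assume 4: "extends n3 \<rho>3 n4 \<rho>4" "rat_den n4 \<rho>4 b r"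
        show "sat ((rat_less a (rat_add b (rat_eps (Var (n, N)))) \<^bold>\<and>
            rat_less b (rat_add a (rat_eps (Var (n, N))))) n4) \<rho>4 \<longleftrightarrow> q < r + 1 / 2 ^ v \<and> r < q + 1 / 2 ^ v"
          by (intro sat_iffs sat_rat_less rat_den_add rat_den_eps 4 rat_den_mono[OF 4(1) 3(2)] extends_good[OF 4(1)]
              num_mono[OF extends_trans[OF 3(1) 4(1)] v2])
      qed
    qed
  qed
  also have "\<dots> \<longleftrightarrow> (\<exists>y. code_real f y)"
  proof
    assume *: "\<forall>v i. \<exists>q. rat_code (f v) q \<and> (\<exists>r. rat_code (f (v + i)) r \<and>
      q < r + 1 / 2 ^ v \<and> r < q + 1 / 2 ^ v)"
    then have "\<forall>v. \<exists>q. rat_code (f v) q" by blast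
    then obtain q where q: "\<And>v. rat_code (f v) (q v)" by (auto dest!: choice)
    have "\<bar>q v - q (v + i)\<bar> < 1 / 2 ^ v" for v i
    proof -
      obtain s r where "rat_code (f v) s" "rat_code (f (v + i)) r" "s < r + 1 / 2 ^ v" "r < s + 1 / 2 ^ v"
        using * by blast
      moreover have "s = q v" "r = q (v + i)" using calculation q rat_code_unique by blast+
      ultimately show ?thesis by (simp add: abs_if)
    qed
    then show "\<exists>y. code_real f y" using fast_Cauchy_approx[of q] q unfolding code_real_def by blast
  next
    assume "\<exists>y. code_real f y"
    then obtain q where q: "\<And>n. rat_code (f n) (q n)" "\<And>n i. \<bar>q n - q (n + i)\<bar> < 1 / 2 ^ n"
      unfolding code_real_def by blast
    have "q v < q (v + i) + 1 / 2 ^ v" "q (v + i) < q v + 1 / 2 ^ v" for v i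
      using q(2)[of v i] by (simp_all add: abs_less_iff)
    then show "\<forall>v i. \<exists>q. rat_code (f v) q \<and> (\<exists>r. rat_code (f (v + i)) r \<and>
      q < r + 1 / 2 ^ v \<and> r < q + 1 / 2 ^ v)" using q(1) by blast
  qed
  finally show ?thesis .
qed

lemma sat_all_real:
  assumes "good \<rho>" and "\<And>\<rho>' f x. extends n \<rho> (Suc n) \<rho>' \<Longrightarrow> good \<rho>' \<Longrightarrow> fun_den (Suc n) \<rho>' (Var (n, ty1)) f \<Longrightarrow>
    f \<in> M \<Longrightarrow> code_real f x \<Longrightarrow> real_den (Suc n) \<rho>' (R (Var (n, ty1))) x \<Longrightarrow>
    sat (F (Var (n, ty1)) (Suc n)) \<rho>' \<longleftrightarrow> P f x"
  shows "sat (all_real F n) \<rho> \<longleftrightarrow> (\<forall>f\<in>M. \<forall>x. code_real f x \<longrightarrow> P f x)"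
proof -
  have "sat ((is_real (Var (n, ty1)) \<^bold>\<longrightarrow> F (Var (n, ty1))) (Suc n)) (\<rho>((n, ty1) := d)) \<longleftrightarrow>
      (\<forall>x. code_real (fun_of d) x \<longrightarrow> P (fun_of d) x)" if d: "dom_at ty1 d" for d
  proof -
    have e: "extends n \<rho> (Suc n) (\<rho>((n, ty1) := d))" by (rule extends_upd[OF assms(1) d])
    have f: "fun_den (Suc n) (\<rho>((n, ty1) := d)) (Var (n, ty1)) (fun_of d)"
      using d by (simp add: fun_den_def del: rel.simps)
    show ?thesis
      unfolding sat_connectives sat_is_real[OF extends_good[OF e] f]
      using assms(2)[OF e extends_good[OF e] f fun_of_in[OF d] _ real_den_R[OF f]] code_real_unique by blast
  qed
  then show ?thesis
    unfolding all_real_def sat_forall using all_dom_ty1[of "\<lambda>f. \<forall>x. code_real f x \<longrightarrow> P f x"]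
    by (simp del: rel.simps)
qed

end

context seq_model
begin

lemma sat_allD: "sat (all \<tau> F n) \<rho> \<Longrightarrow> dom_at \<tau> d \<Longrightarrow> sat (F (Var (n, \<tau>)) (Suc n)) (\<rho>((n, \<tau>) := d))"
  unfolding sat_forall by blast

lemma sat_impD: "sat ((F \<^bold>\<longrightarrow> G) n) \<rho> \<Longrightarrow> sat (F n) \<rho> \<Longrightarrow> sat (G n) \<rho>"
  unfolding sat_connectives by blast

lemma sat_all_realD:
  "sat (all_real F n) \<rho> \<Longrightarrow> dom_at ty1 d \<Longrightarrow> sat (is_real (Var (n, ty1)) (Suc n)) (\<rho>((n, ty1) := d)) \<Longrightarrow>
    sat (F (Var (n, ty1)) (Suc n)) (\<rho>((n, ty1) := d))"
  unfolding all_real_def by (rule sat_impD, rule sat_allD)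

definition reals_den :: "nat \<Rightarrow> env \<Rightarrow> tm \<Rightarrow> (nat \<Rightarrow> real) \<Rightarrow> bool" where
  "reals_den n \<rho> t x \<longleftrightarrow> below n t \<and> dom_at (N \<rightarrow> ty1) (den \<rho> t) \<and>
    (\<forall>v. code_real (fun_of (den \<rho> t \<star> CNum v)) (x v))"

lemma reals_den_mono: "extends n \<rho> n' \<rho>' \<Longrightarrow> reals_den n \<rho> t x \<Longrightarrow> reals_den n' \<rho>' t x"
  unfolding reals_den_def using extends_den extends_below by metis

lemma fun_den_row:
  assumes "below n t" "dom_at (N \<rightarrow> ty1) (den \<rho> t)" "num n \<rho> k v"
  shows "fun_den n \<rho> (t \<cdot> k) (fun_of (den \<rho> t \<star> CNum v))"
proof -
  have k: "eqv N (den \<rho> k) (CNum v)" using assms(3) eqv_num unfolding num_def by blast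
  have "eqv ty1 (den \<rho> t \<star> den \<rho> k) (den \<rho> t \<star> CNum v)" by (rule rel_app[OF assms(2) k])
  then show ?thesis
    using assms(1,3) rel_refl1 fun_of_eq unfolding fun_den_def num_def by (auto simp del: rel.simps)
qed

lemma reals_den_app: "reals_den n \<rho> t x \<Longrightarrow> num n \<rho> k v \<Longrightarrow> real_den n \<rho> (R (t \<cdot> k)) (x v)"
  unfolding reals_den_def using real_den_R fun_den_row by blast

lemma sat_is_real_seq:
  assumes "good \<rho>" "below n t" "dom_at (N \<rightarrow> ty1) (den \<rho> t)"
  shows "sat (is_real_seq t n) \<rho> \<longleftrightarrow> (\<exists>x. reals_den n \<rho> t x)"
proof -
  have "sat (is_real_seq t n) \<rho> \<longleftrightarrow> (\<forall>v. \<exists>y. code_real (fun_of (den \<rho> t \<star> CNum v)) y)"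
    unfolding is_real_seq_def
  proof (rule sat_all_num[OF assms(1)])
    fix \<rho>' v assume e: "extends n \<rho> (Suc n) \<rho>'" and v: "num (Suc n) \<rho>' (Var (n, N)) v"
    have "den \<rho>' t = den \<rho> t" by (rule extends_den[OF e assms(2)])
    then show "sat (is_real (t \<cdot> Var (n, N)) (Suc n)) \<rho>' \<longleftrightarrow> (\<exists>y. code_real (fun_of (den \<rho> t \<star> CNum v)) y)"
      using sat_is_real[OF extends_good[OF e] fun_den_row[OF below_Suc[OF assms(2)] _ v]] assms(3)
      by (simp del: rel.simps)
  qed
  also have "\<dots> \<longleftrightarrow> (\<exists>x. \<forall>v. code_real (fun_of (den \<rho> t \<star> CNum v)) (x v))" by (rule choice_iff)
  finally show ?thesis using assms(2,3) unfolding reals_den_def by blast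
qed

lemma sat_in_interval:
  "good \<rho> \<Longrightarrow> real_den n \<rho> (R a) x \<Longrightarrow> real_den n \<rho> (R y) z \<Longrightarrow> real_den n \<rho> (R b) w \<Longrightarrow>
    sat (in_interval y a b n) \<rho> \<longleftrightarrow> z \<in> {x<..<w}"
  unfolding in_interval_def sat_connectives by (simp add: sat_real_less)

text \<open>Whatever sequence \<open>s\<close> the formula provides, its initial value and recursion
  force it to be the sequence of partial sums up to index \<open>k\<close>.\<close>

lemma sat_total_length_less:
  assumes "good \<rho>" and c: "reals_den n \<rho> c x" and d: "reals_den n \<rho> d y" and m: "num n \<rho> m k"
    and \<epsilon>: "real_den n \<rho> (R \<epsilon>) e" and sat: "sat (total_length_less c d m \<epsilon> n) \<rho>"
  shows "(\<Sum>i\<le>k. \<bar>x i - y i\<bar>) < e"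
proof -
  obtain s where s: "dom_at (N \<rightarrow> ty1) s" and sat: "sat ((is_real_seq (Var (n, N \<rightarrow> ty1)) \<^bold>\<and>
      real_eq (R (Var (n, N \<rightarrow> ty1) \<cdot> \<zero>)) (real_dist (R (c \<cdot> \<zero>)) (R (d \<cdot> \<zero>))) \<^bold>\<and>
      all N (\<lambda>i. i \<prec> m \<^bold>\<longrightarrow> real_eq (R (Var (n, N \<rightarrow> ty1) \<cdot> (i \<oplus> \<one>)))
        (real_add (R (Var (n, N \<rightarrow> ty1) \<cdot> i)) (real_dist (R (c \<cdot> (i \<oplus> \<one>))) (R (d \<cdot> (i \<oplus> \<one>)))))) \<^bold>\<and>
      real_less (R (Var (n, N \<rightarrow> ty1) \<cdot> m)) (R \<epsilon>)) (Suc n)) (\<rho>((n, N \<rightarrow> ty1) := s))"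
    using sat unfolding total_length_less_def sat_exists by blast
  define \<rho>1 where "\<rho>1 = \<rho>((n, N \<rightarrow> ty1) := s)"
  let ?n = "Suc n" and ?s = "Var (n, N \<rightarrow> ty1)"
  have e1: "extends n \<rho> ?n \<rho>1" unfolding \<rho>1_def by (rule extends_upd[OF assms(1) s])
  have g1: "good \<rho>1" by (rule extends_good[OF e1])
  have dom: "below ?n ?s" "dom_at (N \<rightarrow> ty1) (den \<rho>1 ?s)" using s by (simp_all add: \<rho>1_def del: rel.simps)
  note c1 = reals_den_mono[OF e1 c] and d1 = reals_den_mono[OF e1 d] and m1 = num_mono[OF e1 m]
  note sat = sat[folded \<rho>1_def, unfolded sat_connectives]
  obtain z where z: "reals_den ?n \<rho>1 ?s z" using sat sat_is_real_seq[OF g1 dom] by blast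
  have z0: "z 0 = \<bar>x 0 - y 0\<bar>"
    using sat sat_real_eq[OF g1 reals_den_app[OF z num_const(1)]
      real_den_dist[OF reals_den_app[OF c1 num_const(1)] reals_den_app[OF d1 num_const(1)]]] by blast
  have "sat (all N (\<lambda>i. i \<prec> m \<^bold>\<longrightarrow> real_eq (R (?s \<cdot> (i \<oplus> \<one>)))
        (real_add (R (?s \<cdot> i)) (real_dist (R (c \<cdot> (i \<oplus> \<one>))) (R (d \<cdot> (i \<oplus> \<one>)))))) ?n) \<rho>1 \<longleftrightarrow>
      (\<forall>i. i < k \<longrightarrow> z (i + 1) = z i + \<bar>x (i + 1) - y (i + 1)\<bar>)"
  proof (rule sat_all_num[OF g1])
    fix \<rho>2 i assume e2: "extends ?n \<rho>1 (Suc ?n) \<rho>2" and i: "num (Suc ?n) \<rho>2 (Var (?n, N)) i"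
    show "sat ((Var (?n, N) \<prec> m \<^bold>\<longrightarrow> real_eq (R (?s \<cdot> (Var (?n, N) \<oplus> \<one>)))
        (real_add (R (?s \<cdot> Var (?n, N))) (real_dist (R (c \<cdot> (Var (?n, N) \<oplus> \<one>))) (R (d \<cdot> (Var (?n, N) \<oplus> \<one>))))))
        (Suc ?n)) \<rho>2 \<longleftrightarrow> (i < k \<longrightarrow> z (i + 1) = z i + \<bar>x (i + 1) - y (i + 1)\<bar>)"
      by (intro sat_iffs sat_num sat_real_eq real_den_add real_den_dist extends_good[OF e2] num_bin num_const i
          reals_den_app[OF reals_den_mono[OF e2 z]] reals_den_app[OF reals_den_mono[OF e2 c1]]
          reals_den_app[OF reals_den_mono[OF e2 d1]] num_mono[OF e2 m1])
  qed
  then have zS: "z (i + 1) = z i + \<bar>x (i + 1) - y (i + 1)\<bar>" if "i < k" for i using sat that by blast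
  have "z k < e"
    using sat sat_real_less[OF g1 reals_den_app[OF z m1] real_den_mono[OF e1 \<epsilon>]] by blast
  moreover have "i \<le> k \<Longrightarrow> z i = (\<Sum>j\<le>i. \<bar>x j - y j\<bar>)" for i
    by (induction i) (use z0 zS in auto)
  ultimately show ?thesis by simp
qed

lemma sat_ex_rat:
  assumes "good \<rho>" and "\<And>n' \<rho>' r a b d. extends n \<rho> n' \<rho>' \<Longrightarrow> good \<rho>' \<Longrightarrow>
    rat_den n' \<rho>' r ((real a - real b) / real (d + 1)) \<Longrightarrow> sat (K r n') \<rho>' \<longleftrightarrow> P ((real a - real b) / real (d + 1))"
  shows "sat (ex_rat K n) \<rho> \<longleftrightarrow> (\<exists>a b d. P ((real a - real b) / real (d + 1)))"
  unfolding ex_rat_def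
proof (rule sat_ex_num[OF assms(1)], rule sat_ex_num, erule extends_good, rule sat_ex_num, erule extends_good)
  fix \<rho>1 a \<rho>2 b \<rho>3 d
  assume e1: "extends n \<rho> (Suc n) \<rho>1" and a: "num (Suc n) \<rho>1 (Var (n, N)) a"
    and e2: "extends (Suc n) \<rho>1 (Suc (Suc n)) \<rho>2" and b: "num (Suc (Suc n)) \<rho>2 (Var (Suc n, N)) b"
    and e3: "extends (Suc (Suc n)) \<rho>2 (Suc (Suc (Suc n))) \<rho>3"
    and d: "num (Suc (Suc (Suc n))) \<rho>3 (Var (Suc (Suc n), N)) d"
  have e: "extends n \<rho> (Suc (Suc (Suc n))) \<rho>3" using e1 e2 e3 extends_trans by blast
  let ?n = "Suc (Suc (Suc n))"
  have "rat_den ?n \<rho>3 (Var (n, N), Var (Suc n, N), Var (Suc (Suc n), N) \<oplus> \<one>) ((real a - real b) / real (d + 1))"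
    by (rule rat_denI[OF num_mono[OF e3 num_mono[OF e2 a]] num_mono[OF e3 b] num_bin(1)[OF d num_const(2)]]) simp_all
  then show "sat (K (Var (n, N), Var (Suc n, N), Var (Suc (Suc n), N) \<oplus> \<one>) ?n) \<rho>3 \<longleftrightarrow>
      P ((real a - real b) / real (d + 1))"
    by (rule assms(2)[OF e extends_good[OF e]])
qed

text \<open>The hypothesis provides a ball of genuine reals on which \<open>Q\<close> holds, and in
  particular its points coded in \<open>M\<close> satisfy \<open>Q\<close>.\<close>

lemma sat_is_openI:
  assumes "good \<rho>"
    and P: "\<And>n' \<rho>' x f y. extends n \<rho> n' \<rho>' \<Longrightarrow> good \<rho>' \<Longrightarrow> fun_den n' \<rho>' x f \<Longrightarrow> code_real f y \<Longrightarrow>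
      sat (P x n') \<rho>' \<longleftrightarrow> Q y"
    and Q: "\<And>f x. f \<in> M \<Longrightarrow> code_real f x \<Longrightarrow> Q x \<Longrightarrow> \<exists>r>0. \<forall>y. \<bar>x - y\<bar> < r \<longrightarrow> Q y"
  shows "sat (is_open P n) \<rho>"
proof -
  have "sat (is_open P n) \<rho> \<longleftrightarrow> (\<forall>f\<in>M. \<forall>x. code_real f x \<longrightarrow> Q x \<longrightarrow>
      (\<exists>a b d. 0 < (real a - real b) / real (d + 1) \<and>
        (\<forall>g\<in>M. \<forall>y. code_real g y \<longrightarrow> \<bar>x - y\<bar> < (real a - real b) / real (d + 1) \<longrightarrow> Q y)))"
    unfolding is_open_def
  proof (rule sat_all_real[OF assms(1)], intro sat_iffs)
    fix \<rho>1 f x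
    assume e1: "extends n \<rho> (Suc n) \<rho>1" "good \<rho>1" and f: "fun_den (Suc n) \<rho>1 (Var (n, ty1)) f"
      and x: "code_real f x" "real_den (Suc n) \<rho>1 (R (Var (n, ty1))) x"
    show "sat (P (Var (n, ty1)) (Suc n)) \<rho>1 \<longleftrightarrow> Q x" by (rule P[OF e1 f x(1)])
    show "sat (ex_rat (\<lambda>r. rat_less rat_zero r \<^bold>\<and> all_real (\<lambda>y. real_less (real_dist (R (Var (n, ty1))) (R y)) (real_const r) \<^bold>\<longrightarrow> P y)) (Suc n)) \<rho>1 \<longleftrightarrow>
       (\<exists>a b d. 0 < (real a - real b) / real (d + 1) \<and>
        (\<forall>g\<in>M. \<forall>y. code_real g y \<longrightarrow> \<bar>x - y\<bar> < (real a - real b) / real (d + 1) \<longrightarrow> Q y))"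
    proof (rule sat_ex_rat[OF e1(2)], intro sat_iffs)
      fix n2 \<rho>2 r a b d
      assume e2: "extends (Suc n) \<rho>1 n2 \<rho>2" "good \<rho>2" and r: "rat_den n2 \<rho>2 r ((real a - real b) / real (d + 1))"
      show "sat (rat_less rat_zero r n2) \<rho>2 \<longleftrightarrow> 0 < (real a - real b) / real (d + 1)"
        by (rule sat_rat_less[OF rat_den_const(1) r])
      show "sat (all_real (\<lambda>y. real_less (real_dist (R (Var (n, ty1))) (R y)) (real_const r) \<^bold>\<longrightarrow> P y) n2) \<rho>2 \<longleftrightarrow>
        (\<forall>g\<in>M. \<forall>y. code_real g y \<longrightarrow> \<bar>x - y\<bar> < (real a - real b) / real (d + 1) \<longrightarrow> Q y)"
      proof (rule sat_all_real[OF e2(2)], intro sat_iffs)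
        fix \<rho>3 g y
        assume e3: "extends n2 \<rho>2 (Suc n2) \<rho>3" "good \<rho>3" and g: "fun_den (Suc n2) \<rho>3 (Var (n2, ty1)) g"
          and y: "code_real g y" "real_den (Suc n2) \<rho>3 (R (Var (n2, ty1))) y"
        show "sat (real_less (real_dist (R (Var (n, ty1))) (R (Var (n2, ty1)))) (real_const r) (Suc n2)) \<rho>3 \<longleftrightarrow>
          \<bar>x - y\<bar> < (real a - real b) / real (d + 1)"
          by (intro sat_real_less e3 real_den_dist y real_den_const rat_den_mono[OF e3(1) r]
              real_den_mono[OF extends_trans[OF e2(1) e3(1)] x(2)])
        show "sat (P (Var (n2, ty1)) (Suc n2)) \<rho>3 \<longleftrightarrow> Q y"
          by (rule P[OF extends_trans[OF extends_trans[OF e1(1) e2(1)] e3(1)] e3(2) g y(1)])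
      qed
    qed
  qed
  moreover have "\<exists>a b d. 0 < (real a - real b) / real (d + 1) \<and>
        (\<forall>g\<in>M. \<forall>y. code_real g y \<longrightarrow> \<bar>x - y\<bar> < (real a - real b) / real (d + 1) \<longrightarrow> Q y)"
    if x: "f \<in> M" "code_real f x" "Q x" for f x
  proof -
    obtain r where r: "0 < r" "\<And>y. \<bar>x - y\<bar> < r \<Longrightarrow> Q y" using Q[OF x] by blast
    \<comment> \<open>The formula asks for a rational radius; 1/(d+1) is taken, in the
      representation with numerator 1 - 0.\<close>
    obtain d where "inverse (real (Suc d)) < r" using reals_Archimedean[OF r(1)] by blast
    then have "(real 1 - real 0) / real (d + 1) < r" by (simp add: inverse_eq_divide)
    then have "0 < (real 1 - real 0) / real (d + 1) \<and>
        (\<forall>g\<in>M. \<forall>y. code_real g y \<longrightarrow> \<bar>x - y\<bar> < (real 1 - real 0) / real (d + 1) \<longrightarrow> Q y)"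
      using r(2) by fastforce
    then show ?thesis by blast
  qed
  ultimately show ?thesis by blast
qed

end

section \<open>Refuting the covering principle\<close>

text \<open>Since 6 is the code of the rational number 1, \<open>Z_char\<close> says that the characteristic function of
  \<open>Z\<close> belongs to the model.\<close>

locale WHBC_counterexample = Z2_model +
  fixes Z :: "real set" and A B :: "nat \<Rightarrow> real" and ca cb :: "nat \<Rightarrow> nat"
  assumes Z_char: "f \<in> M \<Longrightarrow> (\<lambda>i. if \<exists>z\<in>Z. code_real (slice f i) z then 6 else 0) \<in> M"
    and Z_closed: "f \<in> M \<Longrightarrow> code_real f x \<Longrightarrow> x \<notin> Z \<Longrightarrow> \<exists>r>0. \<forall>z\<in>Z. r \<le> \<bar>x - z\<bar>"
    and Z_unit: "Z \<subseteq> {0..1}"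
    and Z_coded: "z \<in> Z \<Longrightarrow> \<exists>f\<in>M. code_real f z"
    and ca: "ca \<in> M" "\<And>n. rat_code (ca n) (A n)"
    and cb: "cb \<in> M" "\<And>n. rat_code (cb n) (B n)"
    and Z_covered: "z \<in> Z \<Longrightarrow> \<exists>n. z \<in> {A n<..<B n}"
    and Z_not_finitely_covered: "\<And>(c :: nat \<Rightarrow> real) d m k. (\<Sum>i\<le>m. \<bar>c i - d i\<bar>) < 1 / 4 \<Longrightarrow>
      \<exists>z\<in>Z. (\<forall>n\<le>k. z \<notin> {A n<..<B n}) \<and> (\<forall>i\<le>m. z \<notin> {c i<..<d i})"
begin

text \<open>The numerical argument is ignored: the output is a constant sequence of codes, hence a
  code of the real 1 or 0. It depends on the coded real only, as a function on the reals
  must.\<close>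

definition char_of_Z :: ctm where
  "char_of_Z = COp (\<lambda>f _. if \<exists>z\<in>Z. code_real f z then 6 else 0)"

lemma rat_code_6: "rat_code 6 1"
  \<comment> \<open>Indeed \<open>pairN 1 0 = 2\<close> and \<open>pairN 2 0 = 6\<close>.\<close>
  unfolding rat_code_def by (intro exI[of _ 1] exI[of _ 0]) (simp add: pairN_def)

lemma rat_code_0: "rat_code 0 0"
  unfolding rat_code_def by (intro exI[of _ 0]) (simp add: pairN_def)

lemma dom_char_of_Z: "dom_at (ty1 \<rightarrow> ty1) char_of_Z"
  unfolding char_of_Z_def by (rule rel_op) (rule Z_char)

definition char_den :: "nat \<Rightarrow> env \<Rightarrow> tm \<Rightarrow> bool" where
  "char_den n \<rho> C \<longleftrightarrow> below n C \<and> den \<rho> C = char_of_Z"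

lemma char_den_mono: "extends n \<rho> n' \<rho>' \<Longrightarrow> char_den n \<rho> C \<Longrightarrow> char_den n' \<rho>' C"
  unfolding char_den_def using extends_den extends_below by metis

lemma fun_den_char:
  assumes "char_den n \<rho> C" "fun_den n \<rho> x f" "code_real f y"
  shows "fun_den n \<rho> (C \<cdot> x) (\<lambda>_. if y \<in> Z then 6 else 0)"
proof -
  have d: "dom_at ty1 (den \<rho> x)" "fun_of (den \<rho> x) = f" using assms(2) by (simp_all add: fun_den_def del: rel.simps)
  have "ev (char_of_Z \<star> den \<rho> x \<star> CNum k) (if \<exists>z\<in>Z. code_real (fun_of (den \<rho> x)) z then 6 else 0)" for k
    unfolding char_of_Z_def by (rule ev_op[OF ev_fun_of[OF d(1) ev_num] ev_num])
  moreover have "(\<exists>z\<in>Z. code_real f z) \<longleftrightarrow> y \<in> Z" using assms(3) code_real_unique by blast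
  ultimately have "fun_of (char_of_Z \<star> den \<rho> x) = (\<lambda>_. if y \<in> Z then 6 else 0)"
    unfolding fun_of_def[of "char_of_Z \<star> den \<rho> x"] d(2) by (auto intro!: ext val_eq)
  moreover have "dom_at ty1 (char_of_Z \<star> den \<rho> x)" by (rule rel_app[OF dom_char_of_Z d(1)])
  ultimately show ?thesis using assms(1,2) by (simp add: fun_den_def char_den_def del: rel.simps)
qed

lemma code_real_char: "code_real (\<lambda>_. if y \<in> Z then 6 else 0) (if y \<in> Z then 1 else 0)"
  using code_real_const[OF rat_code_6] code_real_const[OF rat_code_0] by simp

lemma real_den_char:
  "char_den n \<rho> C \<Longrightarrow> fun_den n \<rho> x f \<Longrightarrow> code_real f y \<Longrightarrow>
    real_den n \<rho> (R (C \<cdot> x)) (if y \<in> Z then 1 else 0)"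
  by (rule real_den_R[OF fun_den_char code_real_char])

lemma sat_mem:
  "good \<rho> \<Longrightarrow> char_den n \<rho> C \<Longrightarrow> fun_den n \<rho> x f \<Longrightarrow> code_real f y \<Longrightarrow> sat (mem x C n) \<rho> \<longleftrightarrow> y \<in> Z"
  unfolding mem_def using sat_real_less[OF _ real_den_const[OF rat_den_const(1)] real_den_char] by simp

text \<open>A binary constant of type \<open>N \<rightarrow> N \<rightarrow> N\<close> is the same
  as a sequence of functions; each rational is represented by the constant sequence of its
  code.\<close>

lemma reals_den_CBin:
  assumes "below n t" "den \<rho> t = CBin (\<lambda>k _. c k)" "c \<in> M" "\<And>k. rat_code (c k) (x k)"
  shows "reals_den n \<rho> t x"
proof -
  have "dom_at (N \<rightarrow> ty1) (CBin (\<lambda>k _. c k))" by (rule rel_bin) (rule M_comp[OF assms(3)])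
  moreover have "fun_of (CBin (\<lambda>k _. c k) \<star> CNum v) = (\<lambda>_. c v)" for v
    unfolding fun_of_def using val_eq[OF ev_bin[OF ev_num ev_num]] by fastforce
  ultimately show ?thesis
    using assms code_real_const unfolding reals_den_def by (simp del: rel.simps)
qed

text \<open>The statement is instantiated with 1/4, \<open>char_of_Z\<close> and the cover, and its
  hypotheses are discharged one after the other. The data it then returns contradict
  \<open>Z_not_finitely_covered\<close>, since the uncovered point is itself coded in
  \<open>M\<close>.\<close>

lemma not_sat_WHBC:
  assumes "good \<rho>" shows "\<not> sat WHBC \<rho>"
proof
  assume W: "sat WHBC \<rho>"
  let ?\<epsilon> = "Var (0, ty1)" and ?C = "Var (Suc 0, ty1 \<rightarrow> ty1)" and ?a = "Var (Suc (Suc 0), N \<rightarrow> ty1)"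
    and ?b = "Var (Suc (Suc (Suc 0)), N \<rightarrow> ty1)" and ?n = "Suc (Suc (Suc (Suc 0)))"
  \<comment> \<open>The number 1/4 is written as (1 - 0)/(3 + 1).\<close>
  define e where "e = pairN (pairN 1 0) 3"
  have e: "rat_code e (1 / 4)" unfolding rat_code_def e_def by (intro exI conjI, rule refl) simp
  have de: "dom_at ty1 (cfun (\<lambda>_. e))" by (rule dom_cfun[OF M_const])
  have da: "dom_at (N \<rightarrow> ty1) (CBin (\<lambda>k _. ca k))" by (rule rel_bin) (rule M_comp[OF ca(1)])
  have db: "dom_at (N \<rightarrow> ty1) (CBin (\<lambda>k _. cb k))" by (rule rel_bin) (rule M_comp[OF cb(1)])
  define \<rho>1 where "\<rho>1 = \<rho>((0, ty1) := cfun (\<lambda>_. e))"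
  define \<rho>4 where "\<rho>4 = \<rho>1((Suc 0, ty1 \<rightarrow> ty1) := char_of_Z, (Suc (Suc 0), N \<rightarrow> ty1) := CBin (\<lambda>k _. ca k),
    (Suc (Suc (Suc 0)), N \<rightarrow> ty1) := CBin (\<lambda>k _. cb k))"
  have g1: "good \<rho>1" unfolding \<rho>1_def using assms de by (intro good_upd) simp_all
  have g: "good \<rho>4" unfolding \<rho>4_def using g1 dom_char_of_Z da db by (intro good_upd) simp_all
  have \<epsilon>1: "fun_den (Suc 0) \<rho>1 ?\<epsilon> (\<lambda>_. e)" using de by (simp add: fun_den_def \<rho>1_def del: rel.simps)
  have \<epsilon>: "real_den ?n \<rho>4 (R ?\<epsilon>) (1 / 4)"
    by (rule real_den_R[OF _ code_real_const[OF e]])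
      (use de in \<open>simp add: fun_den_def \<rho>1_def \<rho>4_def del: rel.simps\<close>)
  have C: "char_den ?n \<rho>4 ?C" by (simp add: char_den_def \<rho>4_def)
  have a: "reals_den ?n \<rho>4 ?a A" by (rule reals_den_CBin[OF _ _ ca]) (simp_all add: \<rho>4_def)
  have b: "reals_den ?n \<rho>4 ?b B" by (rule reals_den_CBin[OF _ _ cb]) (simp_all add: \<rho>4_def)
  have "sat (is_real ?\<epsilon> (Suc 0)) \<rho>1" using sat_is_real[OF g1 \<epsilon>1] code_real_const[OF e] by blast
  note W1 = sat_all_realD[OF W[unfolded WHBC_def sentence_def] de, folded \<rho>1_def, OF this]
  note W4 = sat_allD[OF sat_allD[OF sat_allD[OF W1 dom_char_of_Z] da] db, folded \<rho>4_def]
  have "sat (real_less (real_const rat_zero) (R ?\<epsilon>) ?n) \<rho>4"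
    using sat_real_less[OF g real_den_const[OF rat_den_const(1)] \<epsilon>] by simp
  note W5 = sat_impD[OF W4 this]
  have "sat (is_real_fun ?C ?n) \<rho>4 \<longleftrightarrow>
      (\<forall>f\<in>M. \<forall>x. code_real f x \<longrightarrow> (\<exists>y. code_real (\<lambda>_. if x \<in> Z then 6 else 0) y)) \<and>
      (\<forall>f\<in>M. \<forall>x. code_real f x \<longrightarrow> (\<forall>g\<in>M. \<forall>y. code_real g y \<longrightarrow>
        x = y \<longrightarrow> (if x \<in> Z then 1 else 0) = (if y \<in> Z then 1 else 0 :: real)))"
    unfolding is_real_fun_def
  proof (rule sat_iffs(2); rule sat_all_real[OF g])
    fix \<rho>' f x assume e: "extends ?n \<rho>4 (Suc ?n) \<rho>'" "good \<rho>'" and f: "fun_den (Suc ?n) \<rho>' (Var (?n, ty1)) f"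
      and x: "code_real f x"
    show "sat (is_real (?C \<cdot> Var (?n, ty1)) (Suc ?n)) \<rho>' \<longleftrightarrow> (\<exists>y. code_real (\<lambda>_. if x \<in> Z then 6 else 0) y)"
      by (rule sat_is_real[OF e(2) fun_den_char[OF char_den_mono[OF e(1) C] f x]])
    assume rx: "real_den (Suc ?n) \<rho>' (R (Var (?n, ty1))) x"
    show "sat (all_real (\<lambda>y. real_eq (R (Var (?n, ty1))) (R y) \<^bold>\<longrightarrow> real_eq (R (?C \<cdot> Var (?n, ty1))) (R (?C \<cdot> y))) (Suc ?n)) \<rho>' \<longleftrightarrow>
      (\<forall>g\<in>M. \<forall>y. code_real g y \<longrightarrow> x = y \<longrightarrow> (if x \<in> Z then 1 else 0) = (if y \<in> Z then 1 else 0 :: real))"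
    proof (rule sat_all_real[OF e(2)], rule sat_iffs(4))
      fix \<rho>'' h y assume e': "extends (Suc ?n) \<rho>' (Suc (Suc ?n)) \<rho>''" "good \<rho>''"
        and h: "fun_den (Suc (Suc ?n)) \<rho>'' (Var (Suc ?n, ty1)) h" and y: "code_real h y"
          "real_den (Suc (Suc ?n)) \<rho>'' (R (Var (Suc ?n, ty1))) y"
      show "sat (real_eq (R (Var (?n, ty1))) (R (Var (Suc ?n, ty1))) (Suc (Suc ?n))) \<rho>'' \<longleftrightarrow> x = y"
        by (rule sat_real_eq[OF e'(2) real_den_mono[OF e'(1) rx] y(2)])
      have C'': "char_den (Suc (Suc ?n)) \<rho>'' ?C" by (rule char_den_mono[OF extends_trans[OF e(1) e'(1)] C])
      show "sat (real_eq (R (?C \<cdot> Var (?n, ty1))) (R (?C \<cdot> Var (Suc ?n, ty1))) (Suc (Suc ?n))) \<rho>'' \<longleftrightarrow>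
        (if x \<in> Z then 1 else 0) = (if y \<in> Z then 1 else 0 :: real)"
        by (rule sat_real_eq[OF e'(2) real_den_char[OF C'' fun_den_mono[OF e'(1) f] x] real_den_char[OF C'' h y(1)]])
    qed
  qed
  then have "sat (is_real_fun ?C ?n) \<rho>4" using code_real_char by blast
  note W6 = sat_impD[OF W5 this]
  have "sat (is_closed ?C ?n) \<rho>4"
    unfolding is_closed_def
  proof (rule sat_is_openI[OF g, where Q = "\<lambda>x. x \<notin> Z"], rule sat_iffs(1))
    fix n' \<rho>' x f y
    assume "extends ?n \<rho>4 n' \<rho>'" "good \<rho>'" "fun_den n' \<rho>' x f" "code_real f y"
    then show "sat (mem x ?C n') \<rho>' \<longleftrightarrow> y \<in> Z" by (intro sat_mem char_den_mono[OF _ C])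
  next
    fix f x assume "f \<in> M" "code_real f x" "x \<notin> Z"
    from Z_closed[OF this] show "\<exists>r>0. \<forall>y. \<bar>x - y\<bar> < r \<longrightarrow> y \<notin> Z" using not_le by blast
  qed
  note W7 = sat_impD[OF W6 this]
  have "sat (all_real (\<lambda>x. mem x ?C \<^bold>\<longrightarrow> real_leq (real_const rat_zero) (R x) \<^bold>\<and> real_leq (R x) (real_const rat_one)) ?n) \<rho>4 \<longleftrightarrow>
      (\<forall>f\<in>M. \<forall>x. code_real f x \<longrightarrow> x \<in> Z \<longrightarrow> 0 \<le> x \<and> x \<le> 1)"
  proof (rule sat_all_real[OF g])
    fix \<rho>' f x assume e: "extends ?n \<rho>4 (Suc ?n) \<rho>'" "good \<rho>'" and f: "fun_den (Suc ?n) \<rho>' (Var (?n, ty1)) f"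
      "code_real f x" "real_den (Suc ?n) \<rho>' (R (Var (?n, ty1))) x"
    show "sat ((mem (Var (?n, ty1)) ?C \<^bold>\<longrightarrow> real_leq (real_const rat_zero) (R (Var (?n, ty1))) \<^bold>\<and>
        real_leq (R (Var (?n, ty1))) (real_const rat_one)) (Suc ?n)) \<rho>' \<longleftrightarrow> (x \<in> Z \<longrightarrow> 0 \<le> x \<and> x \<le> 1)"
      by (intro sat_iffs sat_mem[OF e(2) char_den_mono[OF e(1) C] f(1,2)] sat_real_leq e(2) real_den_const rat_den_const f(3))
  qed
  then have "sat (all_real (\<lambda>x. mem x ?C \<^bold>\<longrightarrow> real_leq (real_const rat_zero) (R x) \<^bold>\<and> real_leq (R x) (real_const rat_one)) ?n) \<rho>4"
    using Z_unit by auto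
  note W8 = sat_impD[OF W7 this]
  have "sat (is_real_seq ?a ?n) \<rho>4" using a sat_is_real_seq[OF g, of ?a ?n] unfolding reals_den_def by blast
  note W9 = sat_impD[OF W8 this]
  have "sat (is_real_seq ?b ?n) \<rho>4" using b sat_is_real_seq[OF g, of ?b ?n] unfolding reals_den_def by blast
  note W10 = sat_impD[OF W9 this]
  have "sat (all_real (\<lambda>x. mem x ?C \<^bold>\<longrightarrow> ex N (\<lambda>n. in_interval x (?a \<cdot> n) (?b \<cdot> n))) ?n) \<rho>4 \<longleftrightarrow>
      (\<forall>f\<in>M. \<forall>x. code_real f x \<longrightarrow> x \<in> Z \<longrightarrow> (\<exists>n. x \<in> {A n<..<B n}))"
  proof (rule sat_all_real[OF g], rule sat_iffs(4))
    fix \<rho>' f x assume e: "extends ?n \<rho>4 (Suc ?n) \<rho>'" "good \<rho>'" and f: "fun_den (Suc ?n) \<rho>' (Var (?n, ty1)) f"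
      "code_real f x" "real_den (Suc ?n) \<rho>' (R (Var (?n, ty1))) x"
    show "sat (mem (Var (?n, ty1)) ?C (Suc ?n)) \<rho>' \<longleftrightarrow> x \<in> Z"
      by (rule sat_mem[OF e(2) char_den_mono[OF e(1) C] f(1,2)])
    show "sat (ex N (\<lambda>n. in_interval (Var (?n, ty1)) (?a \<cdot> n) (?b \<cdot> n)) (Suc ?n)) \<rho>' \<longleftrightarrow> (\<exists>n. x \<in> {A n<..<B n})"
    proof (rule sat_ex_num[OF e(2)])
      fix \<rho>'' k assume e': "extends (Suc ?n) \<rho>' (Suc (Suc ?n)) \<rho>''" and k: "num (Suc (Suc ?n)) \<rho>'' (Var (Suc ?n, N)) k"
      note e'' = extends_trans[OF e(1) e']
      show "sat (in_interval (Var (?n, ty1)) (?a \<cdot> Var (Suc ?n, N)) (?b \<cdot> Var (Suc ?n, N)) (Suc (Suc ?n))) \<rho>'' \<longleftrightarrow> x \<in> {A k<..<B k}"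
        by (rule sat_in_interval[OF extends_good[OF e'] reals_den_app[OF reals_den_mono[OF e'' a] k]
            real_den_mono[OF e' f(3)] reals_den_app[OF reals_den_mono[OF e'' b] k]])
    qed
  qed
  then have "sat (all_real (\<lambda>x. mem x ?C \<^bold>\<longrightarrow> ex N (\<lambda>n. in_interval x (?a \<cdot> n) (?b \<cdot> n))) ?n) \<rho>4"
    using Z_covered by blast
  note W11 = sat_impD[OF W10 this]
  let ?N = "Var (?n, N)" and ?m = "Var (Suc ?n, N)" and ?c = "Var (Suc (Suc ?n), N \<rightarrow> ty1)"
    and ?d = "Var (Suc (Suc (Suc ?n)), N \<rightarrow> ty1)" and ?n8 = "Suc (Suc (Suc (Suc ?n)))"
  obtain dN dm dc dd where dom: "dom_at N dN" "dom_at N dm" "dom_at (N \<rightarrow> ty1) dc" "dom_at (N \<rightarrow> ty1) dd"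
    and W12: "sat ((is_real_seq ?c \<^bold>\<and> is_real_seq ?d \<^bold>\<and>
         all_real (\<lambda>x. mem x ?C \<^bold>\<longrightarrow>
           ex N (\<lambda>n. n \<preceq> ?N \<^bold>\<and> in_interval x (?a \<cdot> n) (?b \<cdot> n)) \<^bold>\<or>
           ex N (\<lambda>m. m \<preceq> ?m \<^bold>\<and> in_interval x (?c \<cdot> m) (?d \<cdot> m))) \<^bold>\<and>
         total_length_less ?c ?d ?m ?\<epsilon>) ?n8)
      (\<rho>4((?n, N) := dN, (Suc ?n, N) := dm, (Suc (Suc ?n), N \<rightarrow> ty1) := dc, (Suc (Suc (Suc ?n)), N \<rightarrow> ty1) := dd))"
    using W11 unfolding sat_exists by blast
  define \<rho>8 where "\<rho>8 = \<rho>4((?n, N) := dN, (Suc ?n, N) := dm, (Suc (Suc ?n), N \<rightarrow> ty1) := dc,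
    (Suc (Suc (Suc ?n)), N \<rightarrow> ty1) := dd)"
  have g8: "good \<rho>8" unfolding \<rho>8_def using g dom by (intro good_upd) simp_all
  have e8: "extends ?n \<rho>4 ?n8 \<rho>8" using g8 unfolding extends_def by (auto simp: \<rho>8_def)
  note W = W12[folded \<rho>8_def, unfolded sat_connectives]
  obtain k m where "ev dN k" "ev dm m" using dom dom_at_N by blast
  then have k: "num ?n8 \<rho>8 ?N k" and m: "num ?n8 \<rho>8 ?m m" by (simp_all add: num_def \<rho>8_def)
  have "below ?n8 ?c" "dom_at (N \<rightarrow> ty1) (den \<rho>8 ?c)" "below ?n8 ?d" "dom_at (N \<rightarrow> ty1) (den \<rho>8 ?d)"
    using dom by (simp_all add: \<rho>8_def del: rel.simps)
  then obtain c d where c: "reals_den ?n8 \<rho>8 ?c c" and d: "reals_den ?n8 \<rho>8 ?d d"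
    using W sat_is_real_seq[OF g8] by blast
  have "(\<Sum>i\<le>m. \<bar>c i - d i\<bar>) < 1 / 4"
    using sat_total_length_less[OF g8 c d m real_den_mono[OF e8 \<epsilon>]] W by blast
  from Z_not_finitely_covered[OF this, of k]
  obtain z where z: "z \<in> Z" "\<forall>n\<le>k. z \<notin> {A n<..<B n}" "\<forall>i\<le>m. z \<notin> {c i<..<d i}" by blast
  have "sat (all_real (\<lambda>x. mem x ?C \<^bold>\<longrightarrow>
           ex N (\<lambda>n. n \<preceq> ?N \<^bold>\<and> in_interval x (?a \<cdot> n) (?b \<cdot> n)) \<^bold>\<or>
           ex N (\<lambda>m. m \<preceq> ?m \<^bold>\<and> in_interval x (?c \<cdot> m) (?d \<cdot> m))) ?n8) \<rho>8 \<longleftrightarrow>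
    (\<forall>f\<in>M. \<forall>x. code_real f x \<longrightarrow> x \<in> Z \<longrightarrow> (\<exists>n. n \<le> k \<and> x \<in> {A n<..<B n}) \<or> (\<exists>i. i \<le> m \<and> x \<in> {c i<..<d i}))"
  proof (rule sat_all_real[OF g8], intro sat_iffs(3,4))
    fix \<rho>' f x assume e: "extends ?n8 \<rho>8 (Suc ?n8) \<rho>'" "good \<rho>'" and f: "fun_den (Suc ?n8) \<rho>' (Var (?n8, ty1)) f"
      "code_real f x" "real_den (Suc ?n8) \<rho>' (R (Var (?n8, ty1))) x"
    note e4 = extends_trans[OF e8 e(1)]
    show "sat (mem (Var (?n8, ty1)) ?C (Suc ?n8)) \<rho>' \<longleftrightarrow> x \<in> Z"
      by (rule sat_mem[OF e(2) char_den_mono[OF e4 C] f(1,2)])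
    show "sat (ex N (\<lambda>n. n \<preceq> ?N \<^bold>\<and> in_interval (Var (?n8, ty1)) (?a \<cdot> n) (?b \<cdot> n)) (Suc ?n8)) \<rho>' \<longleftrightarrow>
      (\<exists>n. n \<le> k \<and> x \<in> {A n<..<B n})"
    proof (rule sat_ex_num[OF e(2)], rule sat_iffs(2))
      fix \<rho>'' j assume e': "extends (Suc ?n8) \<rho>' (Suc (Suc ?n8)) \<rho>''" and j: "num (Suc (Suc ?n8)) \<rho>'' (Var (Suc ?n8, N)) j"
      show "sat ((Var (Suc ?n8, N) \<preceq> ?N) (Suc (Suc ?n8))) \<rho>'' \<longleftrightarrow> j \<le> k"
        by (rule sat_num(3)[OF j num_mono[OF extends_trans[OF e(1) e'] k]])
      note e'' = extends_trans[OF e4 e']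
      show "sat (in_interval (Var (?n8, ty1)) (?a \<cdot> Var (Suc ?n8, N)) (?b \<cdot> Var (Suc ?n8, N)) (Suc (Suc ?n8))) \<rho>'' \<longleftrightarrow> x \<in> {A j<..<B j}"
        by (rule sat_in_interval[OF extends_good[OF e'] reals_den_app[OF reals_den_mono[OF e'' a] j]
            real_den_mono[OF e' f(3)] reals_den_app[OF reals_den_mono[OF e'' b] j]])
    qed
    show "sat (ex N (\<lambda>n. n \<preceq> ?m \<^bold>\<and> in_interval (Var (?n8, ty1)) (?c \<cdot> n) (?d \<cdot> n)) (Suc ?n8)) \<rho>' \<longleftrightarrow>
      (\<exists>n. n \<le> m \<and> x \<in> {c n<..<d n})"
    proof (rule sat_ex_num[OF e(2)], rule sat_iffs(2))
      fix \<rho>'' j assume e': "extends (Suc ?n8) \<rho>' (Suc (Suc ?n8)) \<rho>''" and j: "num (Suc (Suc ?n8)) \<rho>'' (Var (Suc ?n8, N)) j"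
      note e'' = extends_trans[OF e(1) e']
      show "sat ((Var (Suc ?n8, N) \<preceq> ?m) (Suc (Suc ?n8))) \<rho>'' \<longleftrightarrow> j \<le> m"
        by (rule sat_num(3)[OF j num_mono[OF e'' m]])
      show "sat (in_interval (Var (?n8, ty1)) (?c \<cdot> Var (Suc ?n8, N)) (?d \<cdot> Var (Suc ?n8, N)) (Suc (Suc ?n8))) \<rho>'' \<longleftrightarrow> x \<in> {c j<..<d j}"
        by (rule sat_in_interval[OF extends_good[OF e'] reals_den_app[OF reals_den_mono[OF e'' c] j]
            real_den_mono[OF e' f(3)] reals_den_app[OF reals_den_mono[OF e'' d] j]])
    qed
  qed
  then have "\<forall>f\<in>M. \<forall>x. code_real f x \<longrightarrow> x \<in> Z \<longrightarrow>
      (\<exists>n. n \<le> k \<and> x \<in> {A n<..<B n}) \<or> (\<exists>i. i \<le> m \<and> x \<in> {c i<..<d i})" using W by blast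
  then show False using z Z_coded[OF z(1)] by blast
qed

text \<open>Every type is inhabited: constant functions, formed with \<open>CK\<close>, lead from
  \<tau> to any type with values in \<tau>.\<close>

lemma good_exists: "\<exists>\<rho>. good \<rho>"
proof -
  have "\<exists>d. dom_at \<tau> d" for \<tau>
  proof (induction \<tau>)
    case N
    show ?case using dom_at_N ev_num by blast
  next
    case (Fn \<sigma> \<tau>)
    then obtain d where d: "dom_at \<tau> d" by blast
    show ?case by (intro exI, rule rel_app[OF rel_K d])
  qed
  then have "\<forall>x. \<exists>d. dom_at (snd x) d" by blast
  then show ?thesis unfolding good_def by (rule choice)
qed

theorem not_provable_WHBC: "\<not> Z2\<omega> \<turnstile> WHBC"
  using good_exists soundness not_sat_WHBC by blast

end

section \<open>The functions of the model\<close>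

definition centre :: "nat \<Rightarrow> real" where "centre n = of_rat (from_nat n)"
text \<open>The centres enumerate the rationals, which makes the union of the intervals dense. The
  radii give lengths \<open>(1/2) ^ (n + 3)\<close> with sum 1/4.\<close>

definition left_end :: "nat \<Rightarrow> real" where "left_end n = centre n - (1/2) ^ (n + 4)"
definition right_end :: "nat \<Rightarrow> real" where "right_end n = centre n + (1/2) ^ (n + 4)"
definition left_code :: "nat \<Rightarrow> nat" where "left_code n = (SOME c. rat_code c (left_end n))"
definition right_code :: "nat \<Rightarrow> nat" where "right_code n = (SOME c. rat_code c (right_end n))"

lemma rat_code_ends: "rat_code (left_code n) (left_end n)" "rat_code (right_code n) (right_end n)"
proof -
  have "centre n \<in> \<rat>" "(1/2) ^ (n + 4) \<in> (\<rat> :: real set)"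
    by (simp_all add: centre_def Rats_power)
  then have "left_end n \<in> \<rat>" "right_end n \<in> \<rat>" unfolding left_end_def right_end_def by simp_all
  then show "rat_code (left_code n) (left_end n)" "rat_code (right_code n) (right_end n)"
    unfolding left_code_def right_code_def by (auto intro!: someI_ex rat_code_exists)
qed

text \<open>\<open>OLeft\<close> and \<open>ORight\<close> put the cover into the model.
  \<open>OSame\<close> tests which rows of a sequence code a given real, and \<open>OMax\<close>
  joins finitely many such tests.\<close>

datatype opn = OConst nat | OFst | OSnd | OLeft | ORight | OComp | OPair | OPlus | OTimes | OEq | OLess | OMax
  | ORec | OLeast | OSigma nat | OWitness nat bool | OSame

instance opn :: countable
  by countable_datatype

text \<open>\<open>OSigma\<close> refers to truth over all functions, so its meaning is independent
  of the generators. For \<open>OWitness\<close> the head of the list is the parameter and the tail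
  holds the functions already quantified; the choice is a witness if \<open>e\<close> holds and a
  counterexample otherwise.\<close>

primrec opn_fun :: "opn \<Rightarrow> (nat \<Rightarrow> nat) list \<Rightarrow> nat \<Rightarrow> nat" where
  "opn_fun (OConst c) gs = (\<lambda>_. c)"
| "opn_fun OFst gs = (\<lambda>i. fst (prod_decode i))"
| "opn_fun OSnd gs = (\<lambda>i. snd (prod_decode i))"
| "opn_fun OLeft gs = left_code"
| "opn_fun ORight gs = right_code"
| "opn_fun OComp gs = (\<lambda>i. (gs ! 0) ((gs ! 1) i))"
| "opn_fun OPair gs = (\<lambda>i. prod_encode ((gs ! 0) i, (gs ! 1) i))"
| "opn_fun OPlus gs = (\<lambda>i. (gs ! 0) i + (gs ! 1) i)"
| "opn_fun OTimes gs = (\<lambda>i. (gs ! 0) i * (gs ! 1) i)"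
| "opn_fun OEq gs = (\<lambda>i. of_bool ((gs ! 0) i = (gs ! 1) i))"
| "opn_fun OLess gs = (\<lambda>i. of_bool ((gs ! 0) i < (gs ! 1) i))"
| "opn_fun OMax gs = (\<lambda>i. max ((gs ! 0) i) ((gs ! 1) i))"
| "opn_fun ORec gs =
    (\<lambda>i. rec_nat ((gs ! 1) i) (\<lambda>n y. (gs ! 0) (prod_encode (i, prod_encode (n, y)))) ((gs ! 2) i))"
| "opn_fun OLeast gs = (\<lambda>i. LEAST n. 0 < slice (gs ! 0) i n)"
| "opn_fun (OSigma k) gs = (\<lambda>i. of_bool (\<not> alt UNIV k True (slice (gs ! 0) i) []))"
| "opn_fun (OWitness k e) gs =
    (SOME g. alt UNIV k (\<not> e) (hd gs) (tl gs @ [g]) \<longleftrightarrow> e)"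
| "opn_fun OSame gs = (\<lambda>i. if \<exists>z. code_real (slice (gs ! 0) i) z \<and> code_real (gs ! 1) z then 6 else 0)"

text \<open>Keeping the syntax has two uses: the generators occurring in an expression bound the
  stage at which its value is available, and the number of an expression determines the radius of
  the ball about its real.\<close>

datatype expr = Gen nat | Opn opn "expr list"

instance expr :: countable
  by countable_datatype

primrec eval :: "(nat \<Rightarrow> nat \<Rightarrow> nat) \<Rightarrow> expr \<Rightarrow> nat \<Rightarrow> nat" where
  "eval y (Gen n) = y n"
| "eval y (Opn p ts) = opn_fun p (map (eval y) ts)"

primrec gens :: "expr \<Rightarrow> nat set" where
  "gens (Gen n) = {n}"
| "gens (Opn p ts) = \<Union> (set (map gens ts))"

lemma finite_gens: "finite (gens t)"
  by (induction t) auto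

lemma eval_cong: "(\<And>n. n \<in> gens t \<Longrightarrow> y n = y' n) \<Longrightarrow> eval y t = eval y' t"
proof (induction t)
  case (Opn p ts)
  then have "map (eval y) ts = map (eval y') ts" by (intro map_cong refl) auto
  then show ?case by (simp only: eval.simps)
qed simp

definition generated :: "(nat \<Rightarrow> nat \<Rightarrow> nat) \<Rightarrow> nat set \<Rightarrow> (nat \<Rightarrow> nat) set" where
  "generated y I = {eval y t | t. gens t \<subseteq> I}"

text \<open>Argument lists of any length occur, since \<open>OWitness\<close> takes all functions
  quantified so far.\<close>

lemma generated_opn: "set gs \<subseteq> generated y I \<Longrightarrow> opn_fun p gs \<in> generated y I"
proof -
  assume "set gs \<subseteq> generated y I"
  then have "\<exists>ts. gs = map (eval y) ts \<and> \<Union> (set (map gens ts)) \<subseteq> I"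
  proof (induction gs)
    case (Cons g gs)
    then obtain t ts where "g = eval y t" "gens t \<subseteq> I" "gs = map (eval y) ts" "\<Union> (set (map gens ts)) \<subseteq> I"
      by (auto simp: generated_def)
    then show ?case by (intro exI[of _ "t # ts"]) auto
  qed simp
  then obtain ts where "gs = map (eval y) ts" "\<Union> (set (map gens ts)) \<subseteq> I" by blast
  then have "opn_fun p gs = eval y (Opn p ts)" "gens (Opn p ts) \<subseteq> I" by simp_all
  then show ?thesis unfolding generated_def by blast
qed

lemma generated_gen: "n \<in> I \<Longrightarrow> y n \<in> generated y I"
  unfolding generated_def using eval.simps(1) gens.simps(1) by (metis (mono_tags, lifting) empty_subsetI insert_subset mem_Collect_eq)

lemma countable_generated: "countable (generated y I)"
proof -
  have "generated y I \<subseteq> range (eval y)" unfolding generated_def by auto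
  then show ?thesis by (rule countable_subset) (rule countable_image[OF countableI_type])
qed

lemma generated_cong: "(\<And>n. n \<in> I \<Longrightarrow> y n = y' n) \<Longrightarrow> generated y I = generated y' I"
  unfolding generated_def using eval_cong by (metis (no_types, lifting) subsetD)

lemma generated_0: "opn_fun p [] \<in> generated y I"
  by (rule generated_opn) simp

lemma generated_1: "f \<in> generated y I \<Longrightarrow> opn_fun p [f] \<in> generated y I"
  by (rule generated_opn) simp

lemma generated_2: "f \<in> generated y I \<Longrightarrow> g \<in> generated y I \<Longrightarrow> opn_fun p [f, g] \<in> generated y I"
  by (rule generated_opn) simp

lemma generated_slice:
  assumes "f \<in> generated y I" shows "slice f i \<in> generated y I"
proof -
  have "(\<lambda>j. j) = opn_fun OPair [opn_fun OFst [], opn_fun OSnd []]" by (simp add: prod.collapse)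
  then have id: "(\<lambda>j. j) \<in> generated y I" using generated_2[OF generated_0 generated_0] by metis
  have "slice f i = opn_fun OComp [f, opn_fun OPair [opn_fun (OConst i) [], (\<lambda>j. j)]]" by simp
  then show ?thesis using generated_2[OF assms generated_2[OF generated_0 id]] by metis
qed

text \<open>The operations \<open>OWitness\<close> are Skolem functions, which make \<open>generated y I\<close> an elementary submodel
  of the full structure as far as the formulas \<open>sigma k\<close> are concerned.\<close>

lemma alt_generated:
  "f \<in> generated y I \<Longrightarrow> set gs \<subseteq> generated y I \<Longrightarrow> alt (generated y I) k e f gs \<longleftrightarrow> alt UNIV k e f gs"
proof (induction k arbitrary: e gs)
  case (Suc k)
  \<comment> \<open>One predicate serves both quantifiers: a \<open>g\<close> with this property
    verifies an existential formula or refutes a universal one.\<close>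
  let ?P = "\<lambda>g. alt UNIV k (\<not> e) f (gs @ [g]) \<longleftrightarrow> e"
  have IH: "alt (generated y I) k (\<not> e) f (gs @ [g]) \<longleftrightarrow> alt UNIV k (\<not> e) f (gs @ [g])" if "g \<in> generated y I" for g
    using Suc that by simp
  have "\<exists>g\<in>generated y I. ?P g" if "\<exists>g. ?P g"
  proof
    show "?P (opn_fun (OWitness k e) (f # gs))" using someI_ex[OF that] by simp
    show "opn_fun (OWitness k e) (f # gs) \<in> generated y I" using Suc.prems by (intro generated_opn) simp
  qed
  then show ?case using IH by (cases e) auto
qed simp

lemma Z2_model_generated: "Z2_model (generated y I)"
proof
  show "(\<lambda>_. c) \<in> generated y I" for c using generated_0[of "OConst c"] by simp
  show "(\<lambda>i. fst (prod_decode i)) \<in> generated y I" using generated_0[of OFst] by simp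
  show "(\<lambda>i. snd (prod_decode i)) \<in> generated y I" using generated_0[of OSnd] by simp
  fix f assume f: "f \<in> generated y I"
  show "(\<lambda>i. LEAST n. 0 < slice f i n) \<in> generated y I" using generated_1[OF f, of OLeast] by simp
  show "(\<lambda>i. of_bool (\<not> alt (generated y I) k True (slice f i) [])) \<in> generated y I" for k
    using generated_1[OF f, of "OSigma k"] alt_generated[OF generated_slice[OF f], of "[]" k True] by simp
  fix g assume g: "g \<in> generated y I"
  show "(\<lambda>i. f (g i)) \<in> generated y I" using generated_2[OF f g, of OComp] by simp
  show "(\<lambda>i. prod_encode (f i, g i)) \<in> generated y I" using generated_2[OF f g, of OPair] by simp
  show "(\<lambda>i. f i + g i) \<in> generated y I" using generated_2[OF f g, of OPlus] by simp
  show "(\<lambda>i. f i * g i) \<in> generated y I" using generated_2[OF f g, of OTimes] by simp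
  show "(\<lambda>i. of_bool (f i = g i)) \<in> generated y I" using generated_2[OF f g, of OEq] by simp
  show "(\<lambda>i. of_bool (f i < g i)) \<in> generated y I" using generated_2[OF f g, of OLess] by simp
  fix h assume "h \<in> generated y I"
  then show "(\<lambda>i. rec_nat (g i) (\<lambda>n x. f (prod_encode (i, prod_encode (n, x)))) (h i)) \<in> generated y I"
    using generated_opn[of "[f, g, h]" y I ORec] f g by simp
qed

section \<open>The closed set\<close>

definition reals_of :: "(nat \<Rightarrow> nat) set \<Rightarrow> real set" where
  "reals_of X = {x. \<exists>f\<in>X. code_real f x}"

lemma countable_reals_of: "countable X \<Longrightarrow> countable (reals_of X)"
proof -
  assume "countable X"
  then have "countable ((\<lambda>f. THE x. code_real f x) ` X)" by simp
  moreover have "reals_of X \<subseteq> (\<lambda>f. THE x. code_real f x) ` X"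
  proof
    fix x assume "x \<in> reals_of X"
    then obtain f where f: "f \<in> X" "code_real f x" unfolding reals_of_def by blast
    then have "(THE x. code_real f x) = x" using code_real_unique by blast
    then show "x \<in> (\<lambda>f. THE x. code_real f x) ` X" using f by blast
  qed
  ultimately show ?thesis using countable_subset by blast
qed

definition covered :: "real set" where "covered = (\<Union>n. {left_end n<..<right_end n})"

definition target :: "nat \<Rightarrow> real set" where
  "target m = (case from_nat m of (p, r) \<Rightarrow> {of_rat p<..<of_rat r})"

text \<open>The radius decreases with the number of the expression, so all balls together have
  length at most 1/4. An expression that codes no real excludes nothing.\<close>

definition excluded :: "(nat \<Rightarrow> nat \<Rightarrow> nat) \<Rightarrow> nat \<Rightarrow> real set" where
  "excluded y k = {w. \<exists>x. code_real (eval y (from_nat k)) x \<and> \<bar>x - w\<bar> \<le> (1/2) ^ (k + 4)}"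

text \<open>Only expressions in generators below \<open>m\<close> are consulted, so the condition on
  the generator \<open>m\<close> refers to earlier generators alone. The bound
  \<open>k \<le> m\<close> keeps the union finite, hence closed.\<close>

definition admissible :: "(nat \<Rightarrow> nat \<Rightarrow> nat) \<Rightarrow> nat \<Rightarrow> real set" where
  "admissible y m = target m \<inter> covered \<inter> {0..1} -
     (\<Union>k\<in>{k. k \<le> m \<and> gens (from_nat k) \<subseteq> {..<m}}. excluded y k)"

definition productive :: "(nat \<Rightarrow> nat \<Rightarrow> nat) \<Rightarrow> nat \<Rightarrow> bool" where
  "productive y m \<longleftrightarrow> (\<exists>p r. p < r \<and> {p<..<r} \<subseteq> admissible y m)"

lemma excluded_cong: "(\<And>n. n \<in> gens (from_nat k) \<Longrightarrow> y n = y' n) \<Longrightarrow> excluded y k = excluded y' k"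
  unfolding excluded_def using eval_cong by metis

lemma admissible_cong:
  assumes "\<And>n. n < m \<Longrightarrow> y n = y' n" shows "admissible y m = admissible y' m"
proof -
  have "excluded y k = excluded y' k" if "gens (from_nat k) \<subseteq> {..<m}" for k
    using that assms by (intro excluded_cong) auto
  then have "(\<Union>k\<in>{k. k \<le> m \<and> gens (from_nat k) \<subseteq> {..<m}}. excluded y k) =
      (\<Union>k\<in>{k. k \<le> m \<and> gens (from_nat k) \<subseteq> {..<m}}. excluded y' k)" by (intro SUP_cong) auto
  then show ?thesis unfolding admissible_def by simp
qed

lemma productive_cong: "(\<And>n. n < m \<Longrightarrow> y n = y' n) \<Longrightarrow> productive y m = productive y' m"
  unfolding productive_def using admissible_cong[of m y y'] by simp

text \<open>A new generator avoids all reals available before; hence the set of these generators has only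
  finitely many elements at each stage, which puts its characteristic function into the model.\<close>

lemma generators_exist:
  "\<exists>y. \<forall>m. productive y m \<longrightarrow>
    (\<exists>z. z \<in> admissible y m \<and> z \<notin> reals_of (generated y {..<m}) \<and> code_real (y m) z)"
proof (rule dependent_wellorder_choice)
  fix f g :: "nat \<Rightarrow> nat \<Rightarrow> nat" and r m
  assume "\<And>n. n < m \<Longrightarrow> f n = g n"
  then have "admissible f m = admissible g m" "productive f m = productive g m" "generated f {..<m} = generated g {..<m}"
    by (auto intro!: admissible_cong productive_cong generated_cong)
  then show "(productive f m \<longrightarrow> (\<exists>z. z \<in> admissible f m \<and> z \<notin> reals_of (generated f {..<m}) \<and> code_real r z)) =
      (productive g m \<longrightarrow> (\<exists>z. z \<in> admissible g m \<and> z \<notin> reals_of (generated g {..<m}) \<and> code_real r z))" by simp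
next
  fix y :: "nat \<Rightarrow> nat \<Rightarrow> nat" and m
  have "\<exists>r z. z \<in> admissible y m \<and> z \<notin> reals_of (generated y {..<m}) \<and> code_real r z" if "productive y m"
  proof -
    obtain p r where pr: "p < r" "{p<..<r} \<subseteq> admissible y m" using \<open>productive y m\<close> productive_def by blast
    have "uncountable {p<..<r}" using uncountable_open_interval pr(1) by blast
    then have "\<not> {p<..<r} \<subseteq> reals_of (generated y {..<m})"
      using countable_reals_of[OF countable_generated] countable_subset by blast
    then show ?thesis using pr(2) code_real_exists by blast
  qed
  then show "\<exists>r. productive y m \<longrightarrow> (\<exists>z. z \<in> admissible y m \<and> z \<notin> reals_of (generated y {..<m}) \<and> code_real r z)"
    by blast
qed

lemma half_powers_sum: "(\<lambda>n. (1/2) ^ (n + 3)) sums (1/4 :: real)"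
proof -
  have "(\<lambda>n. (1/2) ^ Suc n * (1/4)) sums (1 * (1/4) :: real)" by (rule sums_mult2[OF power_half_series])
  then show ?thesis by (simp add: power_add field_simps)
qed

text \<open>Used for the cover and for the excluded balls alike: both families have radii
  \<open>(1/2) ^ (n + 4)\<close>, and countable subadditivity bounds each union by 1/4.\<close>

lemma emeasure_small_intervals:
  assumes "\<And>n. S n \<subseteq> {x n - (1/2) ^ (n + 4)..x n + (1/2) ^ (n + 4) :: real}" "\<And>n. S n \<in> sets lborel"
  shows "emeasure lborel (\<Union>n. S n) \<le> ennreal (1/4)"
proof -
  have "emeasure lborel (\<Union>n. S n) \<le> (\<Sum>n. emeasure lborel (S n))"
    by (rule emeasure_subadditive_countably) (use assms in auto)
  also have "\<dots> \<le> (\<Sum>n. ennreal ((1/2) ^ (n + 3)))"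
  proof (rule suminf_le)
    fix n
    have "emeasure lborel (S n) \<le> emeasure lborel {x n - (1/2) ^ (n + 4)..x n + (1/2) ^ (n + 4)}"
      by (rule emeasure_mono[OF assms(1)]) simp
    also have "\<dots> = ennreal ((1/2) ^ (n + 3))" by (simp add: power_add power4_eq_xxxx power3_eq_cube)
    finally show "emeasure lborel (S n) \<le> ennreal ((1/2) ^ (n + 3))" .
  qed simp_all
  also have "\<dots> = ennreal (1/4)" by (rule suminf_ennreal_eq[OF _ half_powers_sum]) simp
  finally show ?thesis .
qed

lemma closed_excluded: "closed (excluded y k)"
proof (cases "\<exists>x. code_real (eval y (from_nat k)) x")
  case True
  then obtain x where x: "code_real (eval y (from_nat k)) x" ..
  then have "excluded y k = {w. \<bar>x - w\<bar> \<le> (1/2) ^ (k + 4)}"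
    unfolding excluded_def using code_real_unique by blast
  also have "\<dots> = cball x ((1/2) ^ (k + 4))" by (auto simp: dist_real_def)
  finally show ?thesis by simp
next
  case False
  then show ?thesis unfolding excluded_def by simp
qed

text \<open>The intervals of the cover, the excluded neighbourhoods and the additional intervals have total
  length less than \<open>3/4\<close>.\<close>

lemma avoiding_point:
  fixes c d :: "nat \<Rightarrow> real"
  assumes "(\<Sum>i\<le>m. \<bar>c i - d i\<bar>) < 1 / 4"
  shows "\<exists>w\<in>{0<..<1}. (\<forall>n. w \<notin> {left_end n..right_end n}) \<and> (\<forall>k. w \<notin> excluded y k) \<and>
    (\<forall>i\<le>m. w \<notin> {c i..d i})"
proof -
  define X1 where "X1 = (\<Union>n. {left_end n..right_end n})"
  define X2 where "X2 = (\<Union>k. excluded y k)"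
  define X3 where "X3 = (\<Union>i\<in>{..m}. {c i..d i})"
  have 1: "emeasure lborel X1 \<le> ennreal (1/4)"
    unfolding X1_def by (rule emeasure_small_intervals[where x = centre]) (simp_all add: left_end_def right_end_def)
  have 2: "emeasure lborel X2 \<le> ennreal (1/4)"
    unfolding X2_def
  \<comment> \<open>If expression \<open>k\<close> codes no real, this centre is unspecified, but
    the excluded set is then empty.\<close>
  proof (rule emeasure_small_intervals[where x = "\<lambda>k. THE x. code_real (eval y (from_nat k)) x"])
    fix k
    have "(THE x. code_real (eval y (from_nat k)) x) = x" if "code_real (eval y (from_nat k)) x" for x
      using that code_real_unique by blast
    then show "excluded y k \<subseteq> {(THE x. code_real (eval y (from_nat k)) x) - (1/2) ^ (k + 4)..
        (THE x. code_real (eval y (from_nat k)) x) + (1/2) ^ (k + 4)}"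
      unfolding excluded_def by (auto simp: abs_le_iff)
    show "excluded y k \<in> sets lborel" using closed_excluded by simp
  qed
  have "emeasure lborel X3 \<le> (\<Sum>i\<le>m. emeasure lborel {c i..d i})"
    unfolding X3_def by (rule emeasure_subadditive_finite) auto
  also have "\<dots> \<le> (\<Sum>i\<le>m. ennreal \<bar>c i - d i\<bar>)"
    by (rule sum_mono) (simp add: emeasure_lborel_Icc_eq ennreal_leI)
  also have "\<dots> = ennreal (\<Sum>i\<le>m. \<bar>c i - d i\<bar>)" by (rule sum_ennreal) simp
  also have "\<dots> \<le> ennreal (1/4)" using assms by (intro ennreal_leI) simp
  finally have 3: "emeasure lborel X3 \<le> ennreal (1/4)" .
  have meas: "X1 \<in> sets lborel" "X2 \<in> sets lborel" "X3 \<in> sets lborel"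
    unfolding X1_def X2_def X3_def using closed_excluded by auto
  have "emeasure lborel (X1 \<union> X2 \<union> X3) \<le> emeasure lborel X1 + emeasure lborel X2 + emeasure lborel X3"
    using emeasure_subadditive[of "X1 \<union> X2" lborel X3] emeasure_subadditive[of X1 lborel X2] meas
    by (meson add_right_mono order_trans sets.Un)
  also have "\<dots> \<le> ennreal (1/4) + ennreal (1/4) + ennreal (1/4)" by (intro add_mono 1 2 3)
  also have "\<dots> = ennreal (1/4 + 1/4 + 1/4)"
    by (subst ennreal_plus, simp, simp, subst ennreal_plus, simp_all)
  also have "\<dots> < emeasure lborel {0<..<1::real}" by (simp add: ennreal_less_iff flip: ennreal_1)
  finally have "\<not> {0<..<1} \<subseteq> X1 \<union> X2 \<union> X3"
    using emeasure_mono[of "{0<..<1}" "X1 \<union> X2 \<union> X3" lborel] meas by (meson leD sets.Un)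
  then obtain w where w: "w \<in> {0<..<1}" "w \<notin> X1" "w \<notin> X2" "w \<notin> X3" by blast
  show ?thesis
    by (rule bexI[OF _ w(1)]) (use w(2-4) in \<open>simp only: X1_def X2_def X3_def UN_iff atMost_iff Ball_def Bex_def; blast\<close>)
qed

lemma rational_interval_target:
  assumes "w < u" "u' < w" shows "\<exists>m. w \<in> target m \<and> target m \<subseteq> {u'<..<u}"
proof -
  obtain p where p: "u' < of_rat p" "of_rat p < w" using of_rat_dense[OF assms(2)] by blast
  obtain r where r: "w < of_rat r" "of_rat r < u" using of_rat_dense[OF assms(1)] by blast
  have "target (to_nat (p, r)) = {of_rat p<..<of_rat r}" by (simp add: target_def)
  then show ?thesis using p r by (intro exI[of _ "to_nat (p, r)"]) auto
qed

text \<open>A rational near \<open>w\<close> is the centre of its own interval of the cover.\<close>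

lemma covered_dense:
  assumes "open S" "w \<in> S" shows "S \<inter> covered \<noteq> {}"
proof -
  obtain e where e: "0 < e" "ball w e \<subseteq> S" using assms openE by blast
  then obtain q where q: "w < of_rat q" "of_rat q < w + e" using of_rat_dense[of w "w + e"] by auto
  then have "of_rat q \<in> S" using e(2) by (auto simp: dist_real_def)
  moreover have "of_rat q \<in> {left_end (to_nat q)<..<right_end (to_nat q)}"
    by (simp add: left_end_def right_end_def centre_def)
  ultimately show ?thesis unfolding covered_def by blast
qed

theorem WHBC_counterexample_exists:
  "\<exists>M Z. WHBC_counterexample M Z left_end right_end left_code right_code"
proof -
  obtain y where y: "\<And>m. productive y m \<Longrightarrow>
      \<exists>z. z \<in> admissible y m \<and> z \<notin> reals_of (generated y {..<m}) \<and> code_real (y m) z"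
    using generators_exist by blast
  define M where "M = generated y UNIV"
  define Z where "Z = {z. \<exists>m. productive y m \<and> code_real (y m) z}"
  have new: "z \<in> admissible y m" "z \<notin> reals_of (generated y {..<m})" if "productive y m" "code_real (y m) z" for m z
    using y[OF that(1)] that(2) code_real_unique by blast+
  interpret Z2_model M unfolding M_def by (rule Z2_model_generated)
  have y_M: "y m \<in> M" for m unfolding M_def by (rule generated_gen) simp
  have bound: "\<exists>m\<ge>k. gens t \<subseteq> {..<m}" for t k
  proof -
    obtain m where "gens t \<subseteq> {..<m}" using finite_nat_iff_bounded[of "gens t"] finite_gens by blast
    then show ?thesis by (intro exI[of _ "max k m"]) auto
  qed
  have "WHBC_counterexample_axioms M Z left_end right_end left_code right_code"
  proof
    fix f assume "f \<in> M"
    then obtain t where t: "f = eval y t" unfolding M_def generated_def by blast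
    obtain m where m: "gens t \<subseteq> {..<m}" using bound by blast
    have f: "f \<in> generated y {..<m}" using t m unfolding generated_def by blast
    \<comment> \<open>\<open>?D n\<close> tests the rows of \<open>f\<close> against the first
      \<open>n\<close> generators. Each step of the induction joins one more test by a maximum; for
      \<open>n = m\<close> nothing of \<open>Z\<close> is missed.\<close>
    let ?D = "\<lambda>n i. \<exists>j<n. productive y j \<and> (\<exists>z. code_real (slice f i) z \<and> code_real (y j) z)"
    have "(\<lambda>i. if ?D n i then 6 else 0) \<in> M" for n
    proof (induction n)
      case 0
      show ?case using M_const[of 0] by simp
    next
      case (Suc n)
      show ?case
      proof (cases "productive y n")
        case True
        have "(\<lambda>i. if ?D (Suc n) i then 6 else 0) =
            opn_fun OMax [\<lambda>i. if ?D n i then 6 else 0, opn_fun OSame [f, y n]]"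
          using True by (auto simp: less_Suc_eq fun_eq_iff)
        moreover have "opn_fun OMax [\<lambda>i. if ?D n i then 6 else 0, opn_fun OSame [f, y n]] \<in> M"
          unfolding M_def
          by (rule generated_2[OF Suc[unfolded M_def] generated_2[OF \<open>f \<in> M\<close>[unfolded M_def] y_M[unfolded M_def]]])
        ultimately show ?thesis by simp
      next
        case False
        then have "?D (Suc n) i \<longleftrightarrow> ?D n i" for i by (auto simp: less_Suc_eq)
        then show ?thesis using Suc by simp
      qed
    qed
    moreover have "(\<exists>z\<in>Z. code_real (slice f i) z) \<longleftrightarrow> ?D m i" for i
    proof
      assume "\<exists>z\<in>Z. code_real (slice f i) z"
      then obtain z j where z: "code_real (slice f i) z" "productive y j" "code_real (y j) z" unfolding Z_def by blast
      \<comment> \<open>At a stage \<open>j \<ge> m\<close> all rows of \<open>f\<close> are already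
        available, and the generator \<open>j\<close> codes a real different from theirs.\<close>
      have "j < m"
      proof (rule ccontr)
        assume "\<not> j < m"
        then have "gens t \<subseteq> {..<j}" using m by auto
        then have "f \<in> generated y {..<j}" using t unfolding generated_def by blast
        then show False using new(2)[OF z(2,3)] z(1) generated_slice unfolding reals_of_def by blast
      qed
      then show "?D m i" using z by blast
    qed (auto simp: Z_def)
    ultimately show "(\<lambda>i. if \<exists>z\<in>Z. code_real (slice f i) z then 6 else 0) \<in> M" by simp
  next
    fix f x assume f: "f \<in> M" "code_real f x" and "x \<notin> Z"
    obtain t where t: "f = eval y t" using f unfolding M_def generated_def by blast
    define k where "k = to_nat t"
    obtain m where m: "k \<le> m" "gens t \<subseteq> {..<m}" using bound by blast
    \<comment> \<open>From stage \<open>m\<close> on the expression for \<open>x\<close> is among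
      those consulted, so later generators stay out of its ball. The finitely many earlier ones have
      a positive distance to \<open>x\<close>.\<close>
    have far: "(1/2) ^ (k + 4) \<le> \<bar>x - z\<bar>" if "productive y j" "code_real (y j) z" "m \<le> j" for j z
    proof (rule ccontr)
      assume "\<not> (1/2) ^ (k + 4) \<le> \<bar>x - z\<bar>"
      then have "z \<in> excluded y k" using f t unfolding excluded_def k_def by auto
      moreover have "k \<le> j" "gens (from_nat k) \<subseteq> {..<j}" using m that(3) by (auto simp: k_def)
      ultimately show False using new(1)[OF that(1,2)] unfolding admissible_def by blast
    qed
    let ?F = "{z. \<exists>j<m. productive y j \<and> code_real (y j) z}"
    have "?F \<subseteq> (\<lambda>j. THE z. code_real (y j) z) ` {..<m}"
    proof
      fix z assume "z \<in> ?F"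
      then obtain j where j: "j < m" "code_real (y j) z" by blast
      then have "(THE z. code_real (y j) z) = z" using code_real_unique by blast
      then show "z \<in> (\<lambda>j. THE z. code_real (y j) z) ` {..<m}" using j(1) by blast
    qed
    then have "finite ?F" by (rule finite_subset) simp
    then obtain r where r: "0 < r" "\<forall>z\<in>?F. z \<noteq> x \<longrightarrow> r \<le> dist x z" using finite_set_avoid by blast
    have "min r ((1/2) ^ (k + 4)) \<le> \<bar>x - z\<bar>" if z: "z \<in> Z" for z
    proof -
      obtain j where j: "productive y j" "code_real (y j) z" using z unfolding Z_def by blast
      show ?thesis
      proof (cases "j < m")
        case True
        then have "z \<in> ?F" "z \<noteq> x" using j \<open>x \<notin> Z\<close> z by auto
        then show ?thesis using r(2) by (auto simp: dist_real_def)
      next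
        case False
        then show ?thesis using far[OF j] by simp
      qed
    qed
    then show "\<exists>r>0. \<forall>z\<in>Z. r \<le> \<bar>x - z\<bar>" using r(1) by (intro exI[of _ "min r ((1/2) ^ (k + 4))"]) simp
  next
    show "Z \<subseteq> {0..1}" using new(1) unfolding Z_def admissible_def by blast
  next
    fix z assume "z \<in> Z"
    then show "\<exists>f\<in>M. code_real f z" using y_M unfolding Z_def by blast
    show "\<exists>n. z \<in> {left_end n<..<right_end n}"
      using \<open>z \<in> Z\<close> new(1) unfolding Z_def admissible_def covered_def by blast
  next
    show "left_code \<in> M" "right_code \<in> M"
      unfolding M_def using generated_0[of OLeft] generated_0[of ORight] by simp_all
    show "rat_code (left_code n) (left_end n)" "rat_code (right_code n) (right_end n)" for n
      by (rule rat_code_ends)+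
  next
    fix c d :: "nat \<Rightarrow> real" and m k
    assume "(\<Sum>i\<le>m. \<bar>c i - d i\<bar>) < 1 / 4"
    from avoiding_point[OF this, of y] obtain w where w: "w \<in> {0<..<1}" "\<forall>n. w \<notin> {left_end n..right_end n}"
      "\<forall>k. w \<notin> excluded y k" "\<forall>i\<le>m. w \<notin> {c i..d i}" by blast
    \<comment> \<open>Only finitely many closed intervals are removed, so \<open>S\<close> is an
      open neighbourhood of \<open>w\<close>; any element of \<open>Z\<close> in \<open>S\<close> is
      uncovered.\<close>
    define S where "S = {0<..<1} - ((\<Union>n\<in>{..k}. {left_end n..right_end n}) \<union> (\<Union>i\<in>{..m}. {c i..d i}))"
    have "open S" unfolding S_def by (intro open_Diff open_greaterThanLessThan closed_Un closed_UN) simp_all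
    moreover have "w \<in> S" using w unfolding S_def by auto
    ultimately obtain e where e: "0 < e" "ball w e \<subseteq> S" using openE by blast
    obtain j where j: "w \<in> target j" "target j \<subseteq> {w - e<..<w + e}"
      using rational_interval_target[of w "w + e" "w - e"] e(1) by auto
    have "{w - e<..<w + e} \<subseteq> ball w e" by (auto simp: dist_real_def)
    then have jS: "target j \<subseteq> S" using j(2) e(2) by blast
    define E where "E = (\<Union>k\<in>{k. k \<le> j \<and> gens (from_nat k) \<subseteq> {..<j}}. excluded y k)"
    have "open (target j)" by (auto simp: target_def split: prod.splits)
    then have opn: "open (target j - E)"
      unfolding E_def using closed_excluded by (intro open_Diff closed_UN) auto
    moreover have "w \<in> target j - E" using j(1) w(3) unfolding E_def by blast
    \<comment> \<open>The point \<open>w\<close> lies outside the cover, while generators must lie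
      inside. Density of the cover moves to a nearby \<open>v\<close>, which is covered only by
      intervals of index above \<open>k\<close>, as the target lies in \<open>S\<close>.\<close>
    ultimately obtain v where v: "v \<in> (target j - E) \<inter> covered" using covered_dense by blast
    have "open ((target j - E) \<inter> covered)" unfolding covered_def using opn by (intro open_Int open_UN) auto
    then obtain r where r: "0 < r" "ball v r \<subseteq> (target j - E) \<inter> covered" using v openE by blast
    have "{v - r<..<v + r} \<subseteq> ball v r" by (auto simp: dist_real_def)
    moreover have "(target j - E) \<inter> covered \<subseteq> admissible y j"
      using jS unfolding admissible_def E_def S_def by auto
    ultimately have "productive y j"
      unfolding productive_def using r by (intro exI[of _ "v - r"] exI[of _ "v + r"]) auto
    then obtain z where z: "z \<in> admissible y j" "code_real (y j) z" using y by blast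
    then have "z \<in> S" using jS unfolding admissible_def by blast
    then have "\<forall>n\<le>k. z \<notin> {left_end n..right_end n}" "\<forall>i\<le>m. z \<notin> {c i..d i}"
      unfolding S_def by blast+
    moreover have "{l<..<u} \<subseteq> {l..u}" for l u :: real by auto
    ultimately have "(\<forall>n\<le>k. z \<notin> {left_end n<..<right_end n}) \<and> (\<forall>i\<le>m. z \<notin> {c i<..<d i})" by blast
    moreover have "z \<in> Z" using \<open>productive y j\<close> z(2) unfolding Z_def by blast
    ultimately show "\<exists>z\<in>Z. (\<forall>n\<le>k. z \<notin> {left_end n<..<right_end n}) \<and> (\<forall>i\<le>m. z \<notin> {c i<..<d i})" by blast
  qed
  then show ?thesis using Z2_model_axioms unfolding WHBC_counterexample_def by blast
qed

theorem theorem3p12: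
  shows "\<not> (Z2\<omega> \<turnstile> WHBC)"
  using WHBC_counterexample_exists WHBC_counterexample.not_provable_WHBC by blast

end
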